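(* Let $G$ be a connected graph with maximum degree at most $3$ and girth at least $5$ that is not isomorphic to $H_1$ or $H_2$. Then $$\nu_{ur}(G) \geq \frac{n(G)-1}{3},$$ where $n(G)$ is the number of vertices of $G$.
   Context: A matching $M$ in a graph $G$ is uniquely restricted if no other matching in $G$ covers the same set of vertices; $\nu_{ur}(G)$ denotes the maximum size of a uniquely restricted matching in $G$. Girth at least $5$ means $G$ has no cycle of length $3$ or $4$. The graphs $H_1$ and $H_2$ are defined as follows. Let $G_1$ be the graph with vertices $a_1,a_2,a_3,a_4$ and $s_{ij}$ for $1\le i<j\le 4$, and edges $a_is_{ij}$ and $a_js_{ij}$ for all $1\le i<j\le 4$ (the graph obtained from $K_4$ by subdividing every edge once). Let $G_2$ arise from $G_1$ by adding new vertices $t_1,t_2,t_3$ with $t_1$ adjacent to $s_{14},s_{23}$, $t_2$ adjacent to $s_{24},s_{13}$, and $t_3$ adjacent to $s_{12},s_{34}$. Then $H_1$ arises from $G_2$ by adding a new vertex $x$ adjacent to $t_1,t_2,t_3$ (a cubic graph on $14$ vertices). Let $G_3$ be the graph with vertices $z$, $w_0,w_2,w_4$, $b_0,\dots,b_5$, $c_0,\dots,c_5$ and edges $b_ib_{i+1}$ and $c_ic_{i+1}$ for $i=0,\dots,5$ (indices mod $6$), $zw_j$, $w_jb_j$, $w_jc_j$ for $j\in\{0,2,4\}$. Let $G_4$ arise from $G_3$ by adding new vertices $w_1,w_3,w_5$ with $w_j$ adjacent to $b_j$ and $c_j$ for $j\in\{1,3,5\}$. Then $H_2$ arises from $G_4$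 by adding a new vertex $x$ adjacent to $w_1,w_3,w_5$ (a cubic graph on $20$ vertices). *)

theory Defs
  imports Complex_Main
begin

text \<open>Finite simple graphs: a finite vertex set V and a set E of edges, each edge
  a 2-element subset of V.\<close>

definition simple_graph :: "'a set \<Rightarrow> 'a set set \<Rightarrow> bool" where
  "simple_graph V E \<longleftrightarrow> finite V \<and>
     (\<forall>e\<in>E. \<exists>u v. e = {u, v} \<and> u \<noteq> v \<and> u \<in> V \<and> v \<in> V)"

definition degree :: "'a set set \<Rightarrow> 'a \<Rightarrow> nat" where
  "degree E v = card {e\<in>E. v \<in> e}"

definition max_degree_le :: "'a set \<Rightarrow> 'a set set \<Rightarrow> nat \<Rightarrow> bool" where
  "max_degree_le V E k \<longleftrightarrow> (\<forall>v\<in>V. degree E v \<le> k)"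

definition connected_graph :: "'a set \<Rightarrow> 'a set set \<Rightarrow> bool" where
  "connected_graph V E \<longleftrightarrow>
     (\<forall>u\<in>V. \<forall>v\<in>V. (u, v) \<in> {(x, y). {x, y} \<in> E}\<^sup>*)"

text \<open>Girth at least 5: no cycle of length 3 and no cycle of length 4.\<close>
definition girth_ge_5 :: "'a set \<Rightarrow> 'a set set \<Rightarrow> bool" where
  "girth_ge_5 V E \<longleftrightarrow>
     \<not> (\<exists>a b c. distinct [a, b, c] \<and> {a, b} \<in> E \<and> {b, c} \<in> E \<and> {c, a} \<in> E) \<and>
     \<not> (\<exists>a b c d. distinct [a, b, c, d] \<and> {a, b} \<in> E \<and> {b, c} \<in> E \<and> {c, d} \<in> E \<and> {d, a} \<in> E)"

definition matching :: "'a set set \<Rightarrow> 'a set set \<Rightarrow> bool" where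
  "matching E M \<longleftrightarrow> M \<subseteq> E \<and> (\<forall>e\<in>M. \<forall>f\<in>M. e \<noteq> f \<longrightarrow> e \<inter> f = {})"

text \<open>A matching is uniquely restricted if no other matching covers the same vertex set.\<close>
definition uniquely_restricted :: "'a set set \<Rightarrow> 'a set set \<Rightarrow> bool" where
  "uniquely_restricted E M \<longleftrightarrow> matching E M \<and>
     (\<forall>M'. matching E M' \<and> \<Union>M' = \<Union>M \<longrightarrow> M' = M)"

definition nu_ur :: "'a set set \<Rightarrow> nat" where
  "nu_ur E = Max {card M | M. uniquely_restricted E M}"

definition graph_iso :: "'a set \<Rightarrow> 'a set set \<Rightarrow> 'b set \<Rightarrow> 'b set set \<Rightarrow> bool" where
  "graph_iso V E V' E' \<longleftrightarrow> (\<exists>f. bij_betw f V V' \<and>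
     (\<forall>u\<in>V. \<forall>v\<in>V. {u, v} \<in> E \<longleftrightarrow> {f u, f v} \<in> E'))"

text \<open>The graph H1 (14 vertices).\<close>
datatype h1v = A nat | S nat nat | T nat | X1

definition H1_V :: "h1v set" where
  "H1_V = A ` {1..4} \<union> {S i j | i j. 1 \<le> i \<and> i < j \<and> j \<le> 4} \<union> T ` {1..3} \<union> {X1}"

definition H1_E :: "h1v set set" where
  "H1_E = {{A i, S i j} | i j. 1 \<le> i \<and> i < j \<and> j \<le> 4}
        \<union> {{A j, S i j} | i j. 1 \<le> i \<and> i < j \<and> j \<le> 4}
        \<union> {{T 1, S 1 4}, {T 1, S 2 3}, {T 2, S 2 4}, {T 2, S 1 3}, {T 3, S 1 2}, {T 3, S 3 4}}
        \<union> {{X1, T k} | k. k \<in> {1..3}}"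

text \<open>The graph H2 (20 vertices); indices mod 6.\<close>
datatype h2v = Z | W nat | B nat | C nat | X2

definition H2_V :: "h2v set" where
  "H2_V = {Z, X2} \<union> W ` {0..<6} \<union> B ` {0..<6} \<union> C ` {0..<6}"

definition H2_E :: "h2v set set" where
  "H2_E = {{B i, B ((i + 1) mod 6)} | i. i < 6}
        \<union> {{C i, C ((i + 1) mod 6)} | i. i < 6}
        \<union> {{Z, W j} | j. j \<in> {0, 2, 4}}
        \<union> {{W j, B j} | j. j < 6}
        \<union> {{W j, C j} | j. j < 6}
        \<union> {{X2, W j} | j. j \<in> {1, 3, 5}}"

end

theory Submission
  imports Defs
begin

text \<open>
  Put \<open>deficit X = |X| - 3 \<nu>\<^sub>u\<^sub>r(G[X])\<close>; the claim is \<open>deficit V \<le> 1\<close>. Three operations bound it: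
  deleting a vertex costs at most 1, matching a leaf gains 1, and a bridge may be put into the
  matching or left out (by parity, no alternative matching can treat it differently). Moreover
  \<open>deficit X\<close> is congruent to \<open>|X|\<close> modulo 3, so a deficit that is small is often forced to drop by 3.

  In a minimal non-cubic counterexample these rules exclude bridges, and then any connected piece of
  deficit 1 that is attached by two edges is a single vertex. Deleting a vertex of degree 2 with its
  two neighbours leaves two such pieces, hence a 4-cycle.

  A cubic graph of deficit 2 satisfies \<open>3 deficit X \<le> cut X (V - X)\<close> for all proper \<open>X\<close>. A minimal
  bridgeless piece of deficit 1 in it is a subdivided \<open>K\<^sub>4\<close>. Consider the outer neighbours \<open>t i j\<close> of
  its six subdivision vertices. If opposite ones coincide in all three cases, the graph is the
  exceptional graph on 14 vertices. If some but not all coincide, the inequality is violated. If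
  none do, the inequality is tight, which forces a second subdivided \<open>K\<^sub>4\<close>, and triangles of the first
  must correspond to stars of the second, which is the exceptional graph on 20 vertices.
\<close>

text \<open>All arguments concern vertex sets \<open>X\<close> of one fixed graph, so that induction
  runs over subsets and no new graphs are built. A proper subset of a connected graph of maximum
  degree 3 always contains a vertex with at most two neighbours inside it; hence the non-cubic case
  is hereditary, and it supplies the bound 1 for all proper connected subsets of a cubic graph.
  Deficits are then squeezed between two estimates: from below by deleting a few vertices and
  matching leaves, from above by \<open>t * deficit X\<close> being at most the number of edges
  leaving \<open>X\<close>. The factor \<open>t\<close> is 1 for connected, 2 for bridgeless and 3
  for cubic deficient ground sets. Single vertices of degree \<open>t\<close> attain equality, and
  triviality of larger equality pieces is what the two-edge and three-edge lemmas provide; so tight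
  sets fall apart into isolated vertices, and two of these with two common neighbours form a
  4-cycle. The configuration around a subdivided \<open>K_4\<close> comes from another squeeze: a
  set of deficit 1 that has a bridge contains a vertex whose removal leaves deficit at least 3, so
  its three neighbours lie in three different components.\<close>

hide_const (open) A B C S T W Z

section \<open>Neighbourhoods, connectivity through cuts, and the deficit\<close>

locale subcubic_girth5 =
  fixes V :: "'a set" and E :: "'a set set"
  assumes simple: "simple_graph V E"
    and max_degree: "max_degree_le V E 3"
    and girth: "girth_ge_5 V E"
begin

definition nb :: "'a \<Rightarrow> 'a set" where
  "nb v = {w. {v, w} \<in> E}"

text \<open>For disjoint sets the ordered pairs correspond to the edges, each taken once, so
  \<open>cut\<close> then is the size of an edge cut.\<close>

definition between :: "'a set \<Rightarrow> 'a set \<Rightarrow> ('a \<times> 'a) set" where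
  "between A B = {(a, b). a \<in> A \<and> b \<in> B \<and> b \<in> nb a}"

definition cut :: "'a set \<Rightarrow> 'a set \<Rightarrow> nat" where
  "cut A B = card (between A B)"

text \<open>Connectivity is phrased by cuts rather than by paths, because cuts are what the counting
  arguments consume. The empty set is excluded, single vertices are included.\<close>

definition conn :: "'a set \<Rightarrow> bool" where
  "conn X \<longleftrightarrow> X \<noteq> {} \<and> (\<forall>Y. Y \<subset> X \<longrightarrow> Y \<noteq> {} \<longrightarrow> cut Y (X - Y) \<noteq> 0)"

definition two_edge_conn :: "'a set \<Rightarrow> bool" where
  "two_edge_conn X \<longleftrightarrow> (\<forall>Y. Y \<subset> X \<longrightarrow> Y \<noteq> {} \<longrightarrow> 2 \<le> cut Y (X - Y))"

text \<open>This is the parameter of the induced subgraph on \<open>X\<close>: a competing matching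
  covers the same vertices, hence also lives inside \<open>X\<close>, and it does not matter that
  uniqueness is tested in the whole graph.\<close>

definition nu :: "'a set \<Rightarrow> nat" where
  "nu X = Max {card M | M. uniquely_restricted E M \<and> \<Union>M \<subseteq> X}"

definition deficit :: "'a set \<Rightarrow> int" where
  "deficit X = int (card X) - 3 * int (nu X)"

lemma finite_V: "finite V"
  using simple by (simp add: simple_graph_def)

lemma edgeE:
  assumes "e \<in> E"
  obtains u v where "e = {u, v}" "u \<noteq> v" "u \<in> V" "v \<in> V"
  using simple assms unfolding simple_graph_def by blast

lemma edge_subset: "e \<in> E \<Longrightarrow> e \<subseteq> V"
  by (metis edgeE empty_subsetI insert_subset)

lemma finite_E: "finite E"
  by (rule finite_subset[of _ "Pow V"]) (use edge_subset finite_V in auto)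

lemma nb_sym: "w \<in> nb v \<longleftrightarrow> v \<in> nb w"
  by (simp add: nb_def insert_commute)

lemma nb_irrefl: "v \<notin> nb v"
proof
  assume "v \<in> nb v"
  then have "{v, v} \<in> E" by (simp add: nb_def)
  then show False by (elim edgeE) auto
qed

lemma nb_neq: "w \<in> nb v \<Longrightarrow> v \<noteq> w"
  using nb_irrefl by blast

lemma nb_subset: "nb v \<subseteq> V"
  using edge_subset by (auto simp: nb_def)

lemma finite_nb [simp]: "finite (nb v)"
  using finite_subset[OF nb_subset finite_V] .

lemma degree_eq: "degree E v = card (nb v)"
proof -
  have "bij_betw (\<lambda>w. {v, w}) (nb v) {e \<in> E. v \<in> e}"
  proof (rule bij_betwI')
    fix x y assume "x \<in> nb v" "y \<in> nb v"
    then show "({v, x} = {v, y}) = (x = y)" using nb_irrefl by (auto simp: doubleton_eq_iff)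
  next
    fix x assume "x \<in> nb v"
    then show "{v, x} \<in> {e \<in> E. v \<in> e}" by (simp add: nb_def)
  next
    fix e assume e: "e \<in> {e \<in> E. v \<in> e}"
    then obtain a b where "e = {a, b}" by (auto elim: edgeE)
    with e show "\<exists>x\<in>nb v. e = {v, x}" by (auto simp: nb_def insert_commute)
  qed
  from bij_betw_same_card[OF this] show ?thesis by (simp add: degree_def)
qed

lemma card_nb_le: "card (nb v) \<le> 3"
proof (cases "v \<in> V")
  case True
  then show ?thesis using max_degree by (simp add: max_degree_le_def degree_eq)
next
  case False
  then have "nb v = {}" using nb_subset nb_sym by blast
  then show ?thesis by simp
qed

text \<open>Two common neighbours of two vertices would close a 4-cycle. Later arguments use the
  girth in this form.\<close>

lemma common_nb_unique:
  assumes "x \<noteq> y" "c \<in> nb x" "c \<in> nb y" "d \<in> nb x" "d \<in> nb y"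
  shows "c = d"
proof (rule ccontr)
  assume "c \<noteq> d"
  moreover have "x \<noteq> c" "y \<noteq> c" "x \<noteq> d" "y \<noteq> d" using assms nb_irrefl by auto
  moreover have "{x, c} \<in> E" "{c, y} \<in> E" "{y, d} \<in> E" "{d, x} \<in> E"
    using assms by (auto simp: nb_def insert_commute)
  ultimately show False
    using girth \<open>x \<noteq> y\<close> unfolding girth_ge_5_def
    by (metis distinct_length_2_or_more distinct_singleton)
qed

section \<open>Cuts\<close>

lemma finite_between: "A \<subseteq> V \<Longrightarrow> finite (between A B)"
  by (rule finite_subset[of _ "V \<times> V"]) (use nb_subset finite_V in \<open>auto simp: between_def\<close>)

lemma between_commute: "between B A = prod.swap ` between A B"
  using nb_sym by (force simp: between_def)

lemma cut_commute: "cut A B = cut B A"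
  unfolding cut_def between_commute[of B A] by (simp add: card_image)

lemma cut_Un_right:
  assumes "A \<subseteq> V" "B \<inter> C = {}"
  shows "cut A (B \<union> C) = cut A B + cut A C"
proof -
  have "between A (B \<union> C) = between A B \<union> between A C" "between A B \<inter> between A C = {}"
    using assms(2) by (auto simp: between_def)
  then show ?thesis using finite_between[OF assms(1)] by (simp add: cut_def card_Un_disjoint)
qed

lemma cut_Un_left:
  assumes "C \<subseteq> V" "A \<inter> B = {}"
  shows "cut (A \<union> B) C = cut A C + cut B C"
  using cut_Un_right[OF assms] by (simp add: cut_commute)

lemma cut_singleton: "cut A {b} = card (nb b \<inter> A)"
proof -
  have "between A {b} = (\<lambda>a. (a, b)) ` (nb b \<inter> A)"
    using nb_sym by (auto simp: between_def)
  then show ?thesis by (simp add: cut_def card_image inj_on_def)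
qed

lemma cut_insert:
  assumes "A \<subseteq> V" "b \<notin> B"
  shows "cut A (insert b B) = card (nb b \<inter> A) + cut A B"
  using cut_Un_right[OF assms(1), of "{b}" B] assms(2) by (simp add: cut_singleton)

lemma cut_empty [simp]: "cut A {} = 0" "cut {} A = 0"
  by (simp_all add: cut_def between_def)

lemma cut_eq_0_iff: "A \<subseteq> V \<Longrightarrow> cut A B = 0 \<longleftrightarrow> (\<forall>a\<in>A. nb a \<inter> B = {})"
  using finite_between[of A B] by (auto simp: cut_def between_def)

lemma cut_eq_0I: "(\<And>a b. a \<in> P \<Longrightarrow> b \<in> Q \<Longrightarrow> b \<notin> nb a) \<Longrightarrow> cut P Q = 0"
proof -
  assume "\<And>a b. a \<in> P \<Longrightarrow> b \<in> Q \<Longrightarrow> b \<notin> nb a"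
  then have "between P Q = {}" by (auto simp: between_def)
  then show ?thesis by (simp add: cut_def)
qed

lemma cut_eq_0D: "P \<subseteq> V \<Longrightarrow> cut P Q = 0 \<Longrightarrow> a \<in> P \<Longrightarrow> b \<in> Q \<Longrightarrow> b \<notin> nb a"
  using cut_eq_0_iff[of P Q] by auto

lemma cut_eq_1E:
  assumes "cut A B = 1"
  obtains x y where "x \<in> A" "y \<in> B" "y \<in> nb x"
    "\<And>u v. u \<in> A \<Longrightarrow> v \<in> B \<Longrightarrow> v \<in> nb u \<Longrightarrow> u = x \<and> v = y"
proof -
  obtain x y where eq: "between A B = {(x, y)}"
    using assms unfolding cut_def by (metis card_1_singletonE surj_pair)
  then have "(x, y) \<in> between A B" by simp
  moreover have "u = x \<and> v = y" if "u \<in> A" "v \<in> B" "v \<in> nb u" for u v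
  proof -
    have "(u, v) \<in> between A B" using that by (simp add: between_def)
    then show ?thesis using eq by simp
  qed
  ultimately show thesis using that[of x y] by (auto simp: between_def)
qed

lemma conn_subset_cut: "conn X \<Longrightarrow> Y \<subset> X \<Longrightarrow> Y \<noteq> {} \<Longrightarrow> 1 \<le> cut Y (X - Y)"
  unfolding conn_def by (metis One_nat_def Suc_leI neq0_conv)

text \<open>The component is a smallest subset of \<open>X\<close> that contains \<open>v\<close>
  and has no edge to the remainder of \<open>X\<close>.\<close>

lemma component_exists:
  assumes "v \<in> X" "X \<subseteq> V"
  obtains C where "v \<in> C" "C \<subseteq> X" "conn C" "cut C (X - C) = 0"
proof -
  define P where "P C \<longleftrightarrow> v \<in> C \<and> C \<subseteq> X \<and> cut C (X - C) = 0" for C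
  have "P X" using assms by (simp add: P_def)
  then obtain C where C: "P C" and min: "\<And>D. P D \<Longrightarrow> card C \<le> card D"
    using ex_has_least_nat[of P X card] by blast
  have CX: "v \<in> C" "C \<subseteq> X" "cut C (X - C) = 0" using C by (auto simp: P_def)
  have fin: "finite C" using CX assms finite_V by (meson finite_subset)
  have no: "nb a \<inter> (X - C) = {}" if "a \<in> C" for a
    using CX assms that cut_eq_0_iff[of C "X - C"] by blast
  have "conn C"
    unfolding conn_def
  proof (intro conjI allI impI notI)
    assume "C = {}" then show False using CX by simp
  next
    fix Y assume Y: "Y \<subset> C" "Y \<noteq> {}" "cut Y (C - Y) = 0"
    have no2: "nb a \<inter> (C - Y) = {}" if "a \<in> Y" for a
      using Y CX assms that cut_eq_0_iff[of Y "C - Y"] by blast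
    \<comment> \<open>If the candidate falls apart, the part containing \<open>v\<close> is a
      smaller closed set.\<close>
    define D where "D = (if v \<in> Y then Y else C - Y)"
    have "nb a \<inter> (X - D) = {}" if a: "a \<in> D" for a
    proof (cases "v \<in> Y")
      case True
      then show ?thesis using a no[of a] no2[of a] Y CX by (auto simp: D_def)
    next
      case False
      have "b \<notin> nb a" if "b \<in> Y" for b
        using no2[OF that] a False nb_sym by (auto simp: D_def)
      then show ?thesis using a no[of a] Y CX False by (auto simp: D_def)
    qed
    moreover have "D \<subset> C" "v \<in> D" using Y CX by (auto simp: D_def)
    ultimately have "P D" using CX assms cut_eq_0_iff[of D "X - D"] by (auto simp: P_def)
    then show False using min[of D] psubset_card_mono[OF fin \<open>D \<subset> C\<close>] by simp
  qed
  then show thesis using that CX by blast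
qed

section \<open>Uniquely restricted matchings\<close>

lemma matching_finite: "matching E M \<Longrightarrow> finite M"
  unfolding matching_def using finite_E finite_subset by blast

lemma matching_cover_subset: "matching E M \<Longrightarrow> \<Union>M \<subseteq> V"
  unfolding matching_def using edge_subset by blast

lemma card_edge: "e \<in> E \<Longrightarrow> card e = 2"
  by (elim edgeE) simp

lemma card_matching_cover: "matching E M \<Longrightarrow> card (\<Union>M) = 2 * card M"
proof -
  assume M: "matching E M"
  have "card (\<Union>M) = (\<Sum>e\<in>M. card e)"
    by (rule card_Union_disjoint)
      (use M in \<open>auto simp: matching_def pairwise_def disjnt_def intro: finite_subset[OF edge_subset finite_V]\<close>)
  also have "\<dots> = (\<Sum>e\<in>M. 2)"
    by (rule sum.cong) (use M card_edge in \<open>auto simp: matching_def\<close>)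
  finally show ?thesis by simp
qed

lemma matching_subset: "matching E M \<Longrightarrow> N \<subseteq> M \<Longrightarrow> matching E N"
  unfolding matching_def by blast

lemma matching_Un:
  "matching E M \<Longrightarrow> matching E N \<Longrightarrow> \<Union>M \<inter> \<Union>N = {} \<Longrightarrow> matching E (M \<union> N)"
  unfolding matching_def by (simp add: ball_Un) blast

lemma matching_disjoint: "matching E M \<Longrightarrow> e \<in> M \<Longrightarrow> f \<in> M \<Longrightarrow> e \<noteq> f \<Longrightarrow> e \<inter> f = {}"
  unfolding matching_def by simp

lemma matching_Diff_disjoint:
  assumes "matching E M" "N \<subseteq> M"
  shows "\<Union>N \<inter> \<Union>(M - N) = {}"
proof (rule equals0I)
  fix x assume "x \<in> \<Union>N \<inter> \<Union>(M - N)"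
  then obtain e f where "x \<in> e" "e \<in> N" "x \<in> f" "f \<in> M" "f \<notin> N" by blast
  then show False using matching_disjoint[OF assms(1), of e f] assms(2) by blast
qed

lemma matching_singleton: "e \<in> E \<Longrightarrow> matching E {e}"
  unfolding matching_def by blast

text \<open>A different matching on the vertices of \<open>N\<close>, completed by
  \<open>M - N\<close>, would be a different matching on the vertices of \<open>M\<close>.\<close>

lemma uniquely_restricted_subset:
  assumes "uniquely_restricted E M" "N \<subseteq> M"
  shows "uniquely_restricted E N"
  unfolding uniquely_restricted_def
proof (intro conjI allI impI)
  have M: "matching E M" using assms by (simp add: uniquely_restricted_def)
  then show N: "matching E N" using assms matching_subset by blast
  fix N' assume N': "matching E N' \<and> \<Union>N' = \<Union>N"
  have d: "\<Union>N \<inter> \<Union>(M - N) = {}" using matching_Diff_disjoint[OF M assms(2)] .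
  have "matching E (N' \<union> (M - N))"
    by (rule matching_Un) (use N' d matching_subset[OF M, of "M - N"] in auto)
  moreover have "\<Union>(N' \<union> (M - N)) = \<Union>M" using N' assms(2) by auto
  ultimately have eq: "N' \<union> (M - N) = M" using assms(1) unfolding uniquely_restricted_def by blast
  have "N' \<inter> (M - N) = {}"
  proof (rule equals0I)
    fix e assume e: "e \<in> N' \<inter> (M - N)"
    then have "e \<in> E" using M unfolding matching_def by blast
    then have "e \<noteq> {}" using card_edge by fastforce
    moreover have "e \<subseteq> \<Union>N" "e \<subseteq> \<Union>(M - N)" using e N' by auto
    ultimately show False using d by blast
  qed
  then show "N' = N" using eq assms(2) by blast
qed

lemma uniquely_restricted_empty: "uniquely_restricted E {}"
  unfolding uniquely_restricted_def
proof (intro conjI allI impI)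
  show "matching E {}" by (simp add: matching_def)
  fix M' :: "'a set set" assume M': "matching E M' \<and> \<Union>M' = \<Union>{}"
  then have "2 * card M' = card (\<Union>{} :: 'a set)" using card_matching_cover[of M'] by metis
  then show "M' = {}" using M' matching_finite by simp
qed

lemma finite_ur_cards: "finite {card M | M. uniquely_restricted E M \<and> \<Union>M \<subseteq> X}"
proof -
  have "{card M | M. uniquely_restricted E M \<and> \<Union>M \<subseteq> X} \<subseteq> card ` Pow E"
    by (auto simp: uniquely_restricted_def matching_def)
  then show ?thesis using finite_E by (meson finite_Pow_iff finite_imageI finite_subset)
qed

lemma nu_ge: "uniquely_restricted E M \<Longrightarrow> \<Union>M \<subseteq> X \<Longrightarrow> card M \<le> nu X"
  unfolding nu_def by (rule Max_ge[OF finite_ur_cards]) blast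

lemma nu_attained:
  obtains M where "uniquely_restricted E M" "\<Union>M \<subseteq> X" "card M = nu X"
proof -
  have "nu X \<in> {card M | M. uniquely_restricted E M \<and> \<Union>M \<subseteq> X}"
    unfolding nu_def
    by (rule Max_in[OF finite_ur_cards]) (use uniquely_restricted_empty in blast)
  then show thesis using that by auto
qed

lemma nu_V: "nu V = nu_ur E"
proof -
  have "{card M | M. uniquely_restricted E M \<and> \<Union>M \<subseteq> V} = {card M | M. uniquely_restricted E M}"
    using matching_cover_subset by (metis uniquely_restricted_def)
  then show ?thesis by (simp add: nu_def nu_ur_def)
qed

lemma nu_mono: "Y \<subseteq> X \<Longrightarrow> nu Y \<le> nu X"
  by (metis nu_attained nu_ge subset_trans)

lemma deficit_le_card: "deficit X \<le> int (card X)"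
  by (simp add: deficit_def)

lemma deficit_empty [simp]: "deficit {} = 0"
proof -
  obtain M where "uniquely_restricted E M" "\<Union>M \<subseteq> {}" "card M = nu {}" by (rule nu_attained)
  then have "2 * nu {} = card ({} :: 'a set)"
    using card_matching_cover[of M] by (metis subset_empty uniquely_restricted_def)
  then show ?thesis by (simp add: deficit_def)
qed

lemma deficit_Diff:
  assumes "X \<subseteq> V"
  shows "deficit X \<le> deficit (X - S) + int (card (X \<inter> S))"
proof -
  have "card X = card (X - S) + card (X \<inter> S)"
    using assms finite_V by (metis Diff_Int_distrib2 card_Diff_subset_Int card_mono
        finite_Int finite_subset inf_le1 le_add_diff_inverse2)
  then show ?thesis using nu_mono[of "X - S" X] by (simp add: deficit_def)
qed

lemma deficit_remove:
  assumes "X \<subseteq> V"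
  shows "deficit X \<le> deficit (X - {v}) + 1"
  using deficit_Diff[OF assms, of "{v}"] by (cases "v \<in> X") auto

text \<open>Among the covered vertices \<open>u\<close> has only \<open>v\<close> as a possible
  partner, so the new edge is forced in every competitor, and the remainder is decided by
  \<open>M\<close>.\<close>

lemma uniquely_restricted_insert_leaf:
  assumes M: "uniquely_restricted E M" and uv: "v \<in> nb u" "u \<notin> \<Union>M" "v \<notin> \<Union>M"
    and leaf: "nb u \<inter> \<Union>M = {}"
  shows "uniquely_restricted E (insert {u, v} M)"
  unfolding uniquely_restricted_def
proof (intro conjI allI impI)
  have mM: "matching E M" using M by (simp add: uniquely_restricted_def)
  have e: "{u, v} \<in> E" using uv by (simp add: nb_def)
  show "matching E (insert {u, v} M)"
    using matching_Un[OF matching_singleton[OF e] mM] uv by auto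
  fix M' assume M': "matching E M' \<and> \<Union>M' = \<Union>(insert {u, v} M)"
  then obtain f where f: "f \<in> M'" "u \<in> f" by auto
  then have "f \<in> E" using M' by (auto simp: matching_def)
  then obtain w where w: "f = {u, w}" using f by (auto elim!: edgeE)
  then have "w \<in> nb u" using \<open>f \<in> E\<close> by (simp add: nb_def)
  moreover have "w \<in> \<Union>(insert {u, v} M)" using M' f w by blast
  ultimately have "w = v" using leaf nb_irrefl by auto
  then have uvM': "{u, v} \<in> M'" using f w by simp
  have "matching E (M' - {{u, v}})" using M' matching_subset by blast
  moreover have "\<Union>(M' - {{u, v}}) = \<Union>M"
  proof -
    have "\<Union>(M' - {{u, v}}) \<inter> {u, v} = {}"
      using matching_Diff_disjoint[of M' "{{u, v}}"] M' uvM' by (simp add: Int_commute)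
    moreover have "\<Union>(M' - {{u, v}}) \<union> {u, v} = \<Union>M \<union> {u, v}" using M' uvM' by auto
    ultimately show ?thesis using uv by blast
  qed
  ultimately have "M' - {{u, v}} = M" using M unfolding uniquely_restricted_def by blast
  then show "M' = insert {u, v} M" using uvM' by blast
qed

lemma card_Diff_pair:
  assumes "X \<subseteq> V" "u \<in> X" "v \<in> X" "u \<noteq> v"
  shows "card X = card (X - {u, v}) + 2"
  using card_Diff_subset[of "{u, v}" X] card_mono[of X "{u, v}"] assms finite_subset[OF assms(1) finite_V]
  by auto

lemma deficit_leaf:
  assumes X: "X \<subseteq> V" and uv: "u \<in> X" "v \<in> X" "v \<in> nb u" and leaf: "nb u \<inter> X \<subseteq> {v}"
  shows "deficit X \<le> deficit (X - {u, v}) - 1"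
proof -
  obtain M where M: "uniquely_restricted E M" "\<Union>M \<subseteq> X - {u, v}" "card M = nu (X - {u, v})"
    by (rule nu_attained)
  have "uniquely_restricted E (insert {u, v} M)"
    by (rule uniquely_restricted_insert_leaf) (use M uv leaf in auto)
  then have "card (insert {u, v} M) \<le> nu X" by (rule nu_ge) (use M uv in auto)
  moreover have "{u, v} \<notin> M" using M(2) by auto
  moreover have "finite M" using M matching_finite by (simp add: uniquely_restricted_def)
  ultimately have "nu (X - {u, v}) + 1 \<le> nu X" using M(3) by simp
  then show ?thesis using card_Diff_pair[OF X uv(1,2)] nb_neq[OF uv(3)] by (simp add: deficit_def)
qed

lemma matching_split:
  assumes M: "matching E M" "\<Union>M \<subseteq> X \<union> Y" and "X \<inter> Y = {}"
    and bridge: "\<And>u v. u \<in> X \<Longrightarrow> v \<in> Y \<Longrightarrow> v \<in> nb u \<Longrightarrow> u = x \<and> v = y"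
    and "x \<in> X" "y \<in> Y"
  shows "M - {{x, y}} = {e \<in> M. e \<subseteq> X} \<union> {e \<in> M. e \<subseteq> Y}"
proof -
  have "e \<subseteq> X \<or> e \<subseteq> Y \<or> e = {x, y}" if "e \<in> M" for e
  proof -
    have "e \<in> E" "e \<subseteq> X \<union> Y" using that M by (auto simp: matching_def)
    then obtain u v where uv: "e = {u, v}" by (auto elim: edgeE)
    then have "v \<in> nb u" "u \<in> nb v" using \<open>e \<in> E\<close> by (auto simp: nb_def insert_commute)
    then show ?thesis using bridge[of u v] bridge[of v u] uv \<open>e \<subseteq> X \<union> Y\<close> by auto
  qed
  moreover have "\<not> {x, y} \<subseteq> X" "\<not> {x, y} \<subseteq> Y"
    using \<open>X \<inter> Y = {}\<close> \<open>x \<in> X\<close> \<open>y \<in> Y\<close> by auto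
  ultimately show ?thesis by auto
qed

text \<open>The set \<open>B\<close> treats both choices at once: the bridge is left out, or it is
  used while its ends are avoided on both sides.\<close>

lemma uniquely_restricted_bridge:
  assumes MX: "uniquely_restricted E MX" "\<Union>MX \<subseteq> X"
    and MY: "uniquely_restricted E MY" "\<Union>MY \<subseteq> Y"
    and XY: "X \<inter> Y = {}" "x \<in> X" "y \<in> Y"
    and bridge: "\<And>u v. u \<in> X \<Longrightarrow> v \<in> Y \<Longrightarrow> v \<in> nb u \<Longrightarrow> u = x \<and> v = y"
    and B: "B = {} \<or> B = {{x, y}} \<and> y \<in> nb x \<and> x \<notin> \<Union>MX \<and> y \<notin> \<Union>MY"
  shows "uniquely_restricted E (MX \<union> MY \<union> B)"
  unfolding uniquely_restricted_def
proof (intro conjI allI impI)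
  have mX: "matching E MX" and mY: "matching E MY" using MX MY by (auto simp: uniquely_restricted_def)
  have mXY: "matching E (MX \<union> MY)"
    by (rule matching_Un[OF mX mY]) (use MX MY XY in blast)
  have mB: "matching E B" using B by (auto simp: matching_def nb_def)
  show "matching E (MX \<union> MY \<union> B)"
    by (rule matching_Un[OF mXY mB]) (use MX MY XY B in blast)
  fix M' assume "matching E M' \<and> \<Union>M' = \<Union>(MX \<union> MY \<union> B)"
  then have M': "matching E M'" and U: "\<Union>M' = \<Union>MX \<union> \<Union>MY \<union> \<Union>B" by auto
  define NX NY where "NX = {e \<in> M'. e \<subseteq> X}" and "NY = {e \<in> M'. e \<subseteq> Y}"
  have sub: "\<Union>M' \<subseteq> X \<union> Y" using U MX MY XY B by auto
  have split: "M' - {{x, y}} = NX \<union> NY"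
    unfolding NX_def NY_def by (rule matching_split[OF M' sub XY(1) bridge XY(2,3)])
  have mNX: "matching E NX" and mNY: "matching E NY"
    using M' by (auto simp: NX_def NY_def intro: matching_subset)
  have NXX: "\<Union>NX \<subseteq> X" "\<Union>NY \<subseteq> Y" by (auto simp: NX_def NY_def)
  text \<open>The bridge can only be used if it is used by the given matching, since a matching
    covers an even number of vertices of \<open>X\<close> without it.\<close>
  have used: "{x, y} \<in> M' \<longleftrightarrow> {x, y} \<in> B"
  proof -
    have d: "\<Union>(NX \<union> NY) \<inter> {x, y} = {}" if "{x, y} \<in> M'"
      using matching_Diff_disjoint[OF M', of "{{x, y}}"] that by (simp add: split[symmetric] Int_commute)
    have c: "\<Union>M' = \<Union>(NX \<union> NY) \<union> (if {x, y} \<in> M' then {x, y} else {})"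
      using split by auto
    have "X \<inter> \<Union>M' = \<Union>NX \<union> (if {x, y} \<in> M' then {x} else {})"
      using c NXX XY by (auto split: if_splits)
    moreover have "X \<inter> \<Union>M' = \<Union>MX \<union> (if {x, y} \<in> B then {x} else {})"
      using U MX MY XY B by (auto split: if_splits)
    ultimately have eq: "\<Union>NX \<union> (if {x, y} \<in> M' then {x} else {}) = \<Union>MX \<union> (if {x, y} \<in> B then {x} else {})"
      by simp
    have fin: "finite (\<Union>NX)" "finite (\<Union>MX)"
      using matching_cover_subset[OF mNX] matching_cover_subset[OF mX] finite_V by (auto intro: finite_subset)
    have "x \<notin> \<Union>NX" if "{x, y} \<in> M'" using d[OF that] by auto
    moreover have "x \<notin> \<Union>MX" if "{x, y} \<in> B" using B that by auto
    ultimately have "card (\<Union>NX) + (if {x, y} \<in> M' then 1 else 0) = card (\<Union>MX) + (if {x, y} \<in> B then 1 else 0)"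
      using arg_cong[OF eq, of card] fin by (auto split: if_splits)
    then show ?thesis
      unfolding card_matching_cover[OF mNX] card_matching_cover[OF mX]
      by (cases "{x, y} \<in> M'"; cases "{x, y} \<in> B"; simp; presburger)
  qed
  have eqM: "M' = NX \<union> NY \<union> B" using split used B by auto
  then have c: "\<Union>M' = \<Union>(NX \<union> NY) \<union> \<Union>B" by auto
  have dB: "(NX \<union> NY) \<inter> B = {}" using split B by auto
  have "e \<inter> f = {}" if "e \<in> NX \<union> NY" "f \<in> B" for e f
  proof (rule matching_disjoint[OF M'])
    show "e \<in> M'" "f \<in> M'" using that eqM by auto
    show "e \<noteq> f" using that dB by blast
  qed
  then have db: "\<Union>(NX \<union> NY) \<inter> \<Union>B = {}" by blast
  have "\<Union>NX = X \<inter> (\<Union>M' - \<Union>B)" "\<Union>NY = Y \<inter> (\<Union>M' - \<Union>B)"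
    using c db NXX XY by auto
  moreover have "\<Union>B \<inter> (\<Union>MX \<union> \<Union>MY) = {}" using B MX(2) MY(2) XY by auto
  then have "\<Union>MX = X \<inter> (\<Union>M' - \<Union>B)" "\<Union>MY = Y \<inter> (\<Union>M' - \<Union>B)"
    unfolding U using MX(2) MY(2) XY(1) by blast+
  ultimately have "\<Union>NX = \<Union>MX" "\<Union>NY = \<Union>MY" by simp_all
  then have "NX = MX" "NY = MY"
    using MX(1) MY(1) mNX mNY unfolding uniquely_restricted_def by blast+
  then show "M' = MX \<union> MY \<union> B" using eqM by simp
qed

text \<open>The two inequalities are the two choices for the bridge. Using it spends two vertices on
  one matching edge, which accounts for 2 - 3 = -1.\<close>

lemma deficit_bridge:
  assumes V: "X \<subseteq> V" "Y \<subseteq> V" and XY: "X \<inter> Y = {}" "x \<in> X" "y \<in> Y"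
    and bridge: "\<And>u v. u \<in> X \<Longrightarrow> v \<in> Y \<Longrightarrow> v \<in> nb u \<Longrightarrow> u = x \<and> v = y"
  shows "deficit (X \<union> Y) \<le> deficit X + deficit Y"
    and "y \<in> nb x \<Longrightarrow> deficit (X \<union> Y) \<le> deficit (X - {x}) + deficit (Y - {y}) - 1"
proof -
  have fin: "finite X" "finite Y" using V finite_V by (auto intro: finite_subset)
  have disj: "card (MX \<union> MY) = card MX + card MY"
    if "uniquely_restricted E MX" "uniquely_restricted E MY" "\<Union>MX \<subseteq> X" "\<Union>MY \<subseteq> Y" for MX MY
  proof -
    have "e \<notin> MY" if "e \<in> MX" for e
    proof
      assume "e \<in> MY"
      then have "e \<subseteq> X" "e \<subseteq> Y" using that \<open>\<Union>MX \<subseteq> X\<close> \<open>\<Union>MY \<subseteq> Y\<close> by auto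
      then have "e = {}" using XY by blast
      moreover have "e \<in> E" using that \<open>uniquely_restricted E MX\<close>
        by (auto simp: uniquely_restricted_def matching_def)
      ultimately show False using card_edge by fastforce
    qed
    then show ?thesis
      using that matching_finite by (intro card_Un_disjoint) (auto simp: uniquely_restricted_def)
  qed
  show "deficit (X \<union> Y) \<le> deficit X + deficit Y"
  proof -
    obtain MX where MX: "uniquely_restricted E MX" "\<Union>MX \<subseteq> X" "card MX = nu X" by (rule nu_attained)
    obtain MY where MY: "uniquely_restricted E MY" "\<Union>MY \<subseteq> Y" "card MY = nu Y" by (rule nu_attained)
    have "uniquely_restricted E (MX \<union> MY \<union> {})"
      by (rule uniquely_restricted_bridge[OF MX(1,2) MY(1,2) XY bridge]) auto
    then have "card (MX \<union> MY) \<le> nu (X \<union> Y)" using MX MY by (intro nu_ge) auto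
    then have "nu X + nu Y \<le> nu (X \<union> Y)" using disj[OF MX(1) MY(1) MX(2) MY(2)] MX MY by simp
    then show ?thesis using card_Un_disjoint[OF fin XY(1)] by (simp add: deficit_def)
  qed
  show "deficit (X \<union> Y) \<le> deficit (X - {x}) + deficit (Y - {y}) - 1" if xy: "y \<in> nb x"
  proof -
    obtain MX where MX: "uniquely_restricted E MX" "\<Union>MX \<subseteq> X - {x}" "card MX = nu (X - {x})"
      by (rule nu_attained)
    obtain MY where MY: "uniquely_restricted E MY" "\<Union>MY \<subseteq> Y - {y}" "card MY = nu (Y - {y})"
      by (rule nu_attained)
    have MX': "\<Union>MX \<subseteq> X" and MY': "\<Union>MY \<subseteq> Y" using MX MY by auto
    have "uniquely_restricted E (MX \<union> MY \<union> {{x, y}})"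
      by (rule uniquely_restricted_bridge[OF MX(1) MX' MY(1) MY' XY bridge]) (use MX MY xy in auto)
    then have "card (MX \<union> MY \<union> {{x, y}}) \<le> nu (X \<union> Y)" by (rule nu_ge) (use MX' MY' XY in auto)
    moreover have "{x, y} \<notin> MX \<union> MY" using MX(2) MY(2) by auto
    moreover have "finite (MX \<union> MY)" using MX MY matching_finite by (auto simp: uniquely_restricted_def)
    ultimately have "nu (X - {x}) + nu (Y - {y}) + 1 \<le> nu (X \<union> Y)"
      using disj[OF MX(1) MY(1) MX' MY'] MX(3) MY(3) by simp
    moreover have "card X = card (X - {x}) + 1" "card Y = card (Y - {y}) + 1"
      using card_Suc_Diff1[OF fin(1) XY(2)] card_Suc_Diff1[OF fin(2) XY(3)] by simp_all
    ultimately show ?thesis using card_Un_disjoint[OF fin XY(1)] by (simp add: deficit_def)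
  qed
qed

text \<open>One inequality joins optimal matchings of the parts; for the other, an optimal matching
  of the union splits because none of its edges crosses.\<close>

lemma deficit_Un:
  assumes V: "X \<subseteq> V" "Y \<subseteq> V" and XY: "X \<inter> Y = {}" and no: "cut X Y = 0"
  shows "deficit (X \<union> Y) = deficit X + deficit Y"
proof (rule antisym)
  have none: "v \<notin> nb u" if "u \<in> X" "v \<in> Y" for u v
    using no that cut_eq_0_iff[OF V(1)] by blast
  show "deficit (X \<union> Y) \<le> deficit X + deficit Y"
  proof (cases "X = {} \<or> Y = {}")
    case False
    then obtain x y where "x \<in> X" "y \<in> Y" by blast
    then show ?thesis using none by (intro deficit_bridge(1)[OF V XY]) auto
  qed auto
  obtain M where M: "uniquely_restricted E M" "\<Union>M \<subseteq> X \<union> Y" "card M = nu (X \<union> Y)" by (rule nu_attained)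
  define MX MY where "MX = {e \<in> M. e \<subseteq> X}" and "MY = {e \<in> M. e \<subseteq> Y}"
  have "M \<subseteq> MX \<union> MY"
  proof
    fix e assume e: "e \<in> M"
    then have "e \<in> E" using M by (auto simp: uniquely_restricted_def matching_def)
    then obtain u v where uv: "e = {u, v}" by (auto elim: edgeE)
    then have "v \<in> nb u" "u \<in> nb v" using \<open>e \<in> E\<close> by (auto simp: nb_def insert_commute)
    then have "e \<subseteq> X \<or> e \<subseteq> Y" using none uv M(2) e by auto
    then show "e \<in> MX \<union> MY" using e by (auto simp: MX_def MY_def)
  qed
  then have "card M \<le> card MX + card MY"
    using M matching_finite by (metis (no_types, lifting) MX_def MY_def card_Un_le card_mono
        finite_Un finite_subset mem_Collect_eq order_trans subsetI uniquely_restricted_def)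
  moreover have "card MX \<le> nu X" "card MY \<le> nu Y"
    using M by (auto simp: MX_def MY_def intro!: nu_ge intro: uniquely_restricted_subset)
  moreover have "card (X \<union> Y) = card X + card Y"
    using V XY finite_V by (meson card_Un_disjoint finite_subset)
  ultimately show "deficit X + deficit Y \<le> deficit (X \<union> Y)" using M(3) by (simp add: deficit_def)
qed

section \<open>The non-cubic case\<close>

lemma deficit_cong_card: "3 dvd deficit X - int (card X)"
  by (simp add: deficit_def)

text \<open>By summing over components, an isoperimetric inequality for connected sets extends to all
  sets, and equality is inherited by the components.\<close>

definition expands :: "int \<Rightarrow> 'a set \<Rightarrow> bool" where
  "expands t D \<longleftrightarrow> (\<forall>C. C \<subset> D \<longrightarrow> conn C \<longrightarrow> t * deficit C \<le> int (cut C (D - C)))"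

lemma cut_component:
  assumes "C \<subseteq> X" "X \<subseteq> D" "D \<subseteq> V" "cut C (X - C) = 0"
  shows "cut X (D - X) = cut C (D - C) + cut (X - C) (D - (X - C))"
proof -
  have "D - C = (D - X) \<union> (X - C)" "D - (X - C) = (D - X) \<union> C" using assms by auto
  moreover have "(D - X) \<inter> (X - C) = {}" "(D - X) \<inter> C = {}" using assms by auto
  moreover have "C \<subseteq> V" "X - C \<subseteq> V" using assms by auto
  ultimately have "cut C (D - C) = cut C (D - X)" "cut (X - C) (D - (X - C)) = cut (X - C) (D - X)"
    using assms(4) cut_commute[of "X - C" C] by (simp_all add: cut_Un_right)
  moreover have "cut (C \<union> (X - C)) (D - X) = cut C (D - X) + cut (X - C) (D - X)"
    by (rule cut_Un_left) (use assms in auto)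
  moreover have "C \<union> (X - C) = X" using assms by auto
  ultimately show ?thesis by simp
qed

lemma deficit_component:
  assumes "C \<subseteq> X" "X \<subseteq> V" "cut C (X - C) = 0"
  shows "deficit X = deficit C + deficit (X - C)"
  using deficit_Un[of C "X - C"] assms by (simp add: Un_absorb1 subset_iff Un_Diff_cancel)

lemma expands_deficit:
  assumes D: "D \<subseteq> V" "expands t D" and X: "X \<subset> D"
  shows "t * deficit X \<le> int (cut X (D - X))"
proof -
  have "finite X" using X D finite_V by (meson finite_subset psubset_imp_subset)
  then show ?thesis using X
  proof (induction X rule: finite_psubset_induct)
    case (psubset X)
    show ?case
    proof (cases "X = {}")
      case False
      then obtain v where "v \<in> X" by auto
      have XV: "X \<subseteq> V" using psubset.prems D by auto
      obtain C where C: "v \<in> C" "C \<subseteq> X" "conn C" "cut C (X - C) = 0"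
        using component_exists[OF \<open>v \<in> X\<close> XV] by blast
      have "t * deficit C \<le> int (cut C (D - C))"
        using D C psubset.prems unfolding expands_def by auto
      moreover have "t * deficit (X - C) \<le> int (cut (X - C) (D - (X - C)))"
        by (rule psubset.IH) (use C psubset.prems in auto)
      moreover have "X \<subseteq> D" using psubset.prems by auto
      ultimately show ?thesis
        using cut_component[OF C(2) \<open>X \<subseteq> D\<close> D(1) C(4)] deficit_component[OF C(2) XV C(4)]
        by (simp add: algebra_simps)
    qed simp
  qed
qed

lemma expands_tight:
  assumes D: "D \<subseteq> V" "expands t D" and X: "X \<subset> D"
    and C: "C \<subseteq> X" "cut C (X - C) = 0" and tight: "int (cut X (D - X)) \<le> t * deficit X"
  shows "int (cut C (D - C)) = t * deficit C"
proof -
  have "X \<subseteq> D" "X \<subseteq> V" using X D by auto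
  note eqs = cut_component[OF C(1) this(1) D(1) C(2)] deficit_component[OF C(1) this(2) C(2)]
  have "t * deficit C \<le> int (cut C (D - C))" "t * deficit (X - C) \<le> int (cut (X - C) (D - (X - C)))"
    using X C by (auto intro!: expands_deficit[OF D])
  then show ?thesis using eqs tight by (simp add: algebra_simps)
qed

section \<open>Bridges and two-edge cuts when all proper connected subsets have deficit at most
  1\<close>

text \<open>This is the induction hypothesis of a minimal counterexample in the form in which it
  passes to subsets.\<close>

definition all_small :: "'a set \<Rightarrow> bool" where
  "all_small D \<longleftrightarrow> (\<forall>C. C \<subset> D \<longrightarrow> conn C \<longrightarrow> deficit C \<le> 1)"

lemma all_small_mono: "all_small D \<Longrightarrow> D' \<subseteq> D \<Longrightarrow> all_small D'"
  unfolding all_small_def by blast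

lemma expands_1:
  assumes "conn D" "all_small D"
  shows "expands 1 D"
  unfolding expands_def
proof (intro allI impI)
  fix C assume C: "C \<subset> D" "conn C"
  then have "1 \<le> cut C (D - C)" using assms conn_subset_cut by (auto simp: conn_def)
  moreover have "deficit C \<le> 1" using C assms(2) by (simp add: all_small_def)
  ultimately show "1 * deficit C \<le> int (cut C (D - C))" by linarith
qed

lemma expands_2:
  assumes "two_edge_conn D" "all_small D"
  shows "expands 2 D"
  unfolding expands_def
proof (intro allI impI)
  fix C assume C: "C \<subset> D" "conn C"
  then have "2 \<le> cut C (D - C)" using assms unfolding two_edge_conn_def conn_def by blast
  moreover have "deficit C \<le> 1" using C assms(2) by (simp add: all_small_def)
  ultimately show "2 * deficit C \<le> int (cut C (D - C))" by linarith
qed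

text \<open>Besides the bridge, \<open>h\<close> has at most two edges, and these are the only ones
  leaving \<open>H - {h}\<close>. So the deficit there is at most 2, and it is divisible by 3 if
  \<open>H\<close> has deficit 1.\<close>

lemma bridge_side:
  assumes X: "X \<subseteq> V" "conn X" "all_small X"
    and H: "H \<subset> X" "cut H (X - H) = 1" "h \<in> H" "nb h \<inter> (X - H) \<noteq> {}"
      "\<And>u v. u \<in> H \<Longrightarrow> v \<in> X - H \<Longrightarrow> v \<in> nb u \<Longrightarrow> u = h"
  shows "deficit H \<le> 1 \<and> (deficit H = 1 \<longrightarrow> deficit (H - {h}) \<le> 0)"
proof -
  note expd = expands_deficit[OF X(1) expands_1[OF X(2,3)]]
  have "deficit H \<le> 1" using expd[OF H(1)] H(2) by simp
  moreover have "deficit (H - {h}) \<le> 0" if "deficit H = 1"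
  proof -
    have HV: "H \<subseteq> V" using H X by auto
    have "cut (H - {h}) (X - H) = 0"
      by (rule cut_eq_0I) (use H(5) in blast)
    moreover have "X - (H - {h}) = insert h (X - H)" using H by auto
    ultimately have "cut (H - {h}) (X - (H - {h})) = card (nb h \<inter> (H - {h}))"
      using cut_insert[of "H - {h}" h "X - H"] HV H(3) by auto
    moreover have "card (nb h \<inter> (H - {h})) < card (nb h)"
      by (rule psubset_card_mono) (use H in auto)
    ultimately have "deficit (H - {h}) \<le> 2"
      using expd[of "H - {h}"] H(1) card_nb_le[of h] by force
    moreover have "card H = card (H - {h}) + 1"
      using H HV finite_V by (metis Suc_eq_plus1 card_Suc_Diff1 finite_subset)
    then have "3 dvd deficit (H - {h})"
      using that deficit_cong_card[of H] deficit_cong_card[of "H - {h}"] by presburger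
    ultimately show ?thesis by presburger
  qed
  ultimately show ?thesis by blast
qed

text \<open>Leaving a bridge out of the matching bounds the deficit by the sum over both sides, so
  deficit 2 requires deficit 1 on each. But then putting the bridge into the matching yields at most
  0 + 0 - 1.\<close>

lemma bridgeless_of_deficit:
  assumes X: "X \<subseteq> V" "conn X" "all_small X" "2 \<le> deficit X"
  shows "two_edge_conn X"
  unfolding two_edge_conn_def
proof (intro allI impI, rule ccontr)
  fix Y assume Y: "Y \<subset> X" "Y \<noteq> {}" "\<not> 2 \<le> cut Y (X - Y)"
  then have one: "cut Y (X - Y) = 1" using conn_subset_cut[OF X(2), of Y] by linarith
  obtain x y where xy: "x \<in> Y" "y \<in> X - Y" "y \<in> nb x"
    and only: "\<And>u v. u \<in> Y \<Longrightarrow> v \<in> X - Y \<Longrightarrow> v \<in> nb u \<Longrightarrow> u = x \<and> v = y"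
    using cut_eq_1E[OF one] by blast
  note half = bridge_side[OF X(1-3)]
  have Y': "X - Y \<subset> X" "X - (X - Y) = Y" using Y by auto
  have V: "Y \<subseteq> V" "X - Y \<subseteq> V" "Y \<inter> (X - Y) = {}" and U: "Y \<union> (X - Y) = X" using X Y by auto
  have hY: "deficit Y \<le> 1 \<and> (deficit Y = 1 \<longrightarrow> deficit (Y - {x}) \<le> 0)"
  proof (rule half)
    show "nb x \<inter> (X - Y) \<noteq> {}" using xy by blast
    show "u = x" if "u \<in> Y" "v \<in> X - Y" "v \<in> nb u" for u v using only that by blast
  qed (use Y one xy in auto)
  have hX: "deficit (X - Y) \<le> 1 \<and> (deficit (X - Y) = 1 \<longrightarrow> deficit (X - Y - {y}) \<le> 0)"
  proof (rule half)
    show "nb y \<inter> (X - (X - Y)) \<noteq> {}" using xy nb_sym Y' by auto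
    show "u = y" if "u \<in> X - Y" "v \<in> X - (X - Y)" "v \<in> nb u" for u v
      using only[of v u] that nb_sym Y' by blast
    show "cut (X - Y) (X - (X - Y)) = 1" unfolding Y'(2) using one cut_commute by simp
  qed (use Y' xy in auto)
  have "deficit X \<le> deficit Y + deficit (X - Y)"
    using deficit_bridge(1)[OF V xy(1,2) only] U by simp
  moreover have "deficit X \<le> deficit (Y - {x}) + deficit (X - Y - {y}) - 1"
    using deficit_bridge(2)[OF V xy(1,2) only xy(3)] U by simp
  ultimately show False using hY hX X(4) by presburger
qed

lemma cut_pair:
  assumes "X \<subseteq> V" "x \<noteq> y"
  shows "cut X {x, y} = card (nb x \<inter> X) + card (nb y \<inter> X)"
  using cut_insert[OF assms(1), of x "{y}"] assms(2) by (simp add: cut_singleton)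

lemma card_nb_Int_le_2:
  assumes "y \<in> nb x" "y \<notin> X"
  shows "card (nb x \<inter> X) \<le> 2"
proof -
  have "card (nb x \<inter> X) < card (nb x)" by (rule psubset_card_mono) (use assms in auto)
  then show ?thesis using card_nb_le[of x] by simp
qed

lemma cut_eq_2E:
  assumes "cut P Q = 2"
  obtains x y x' y' where "x \<in> P" "y \<in> Q" "y \<in> nb x" "x' \<in> P" "y' \<in> Q" "y' \<in> nb x'" "(x, y) \<noteq> (x', y')"
    "\<forall>u\<in>P. \<forall>v\<in>Q. v \<in> nb u \<longrightarrow> u = x \<and> v = y \<or> u = x' \<and> v = y'"
proof -
  obtain p p' where eq: "between P Q = {p, p'}" "p \<noteq> p'"
    using assms unfolding cut_def by (meson card_2_iff)
  obtain x y x' y' where p: "p = (x, y)" "p' = (x', y')" by (meson surj_pair)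
  have "(x, y) \<in> between P Q" "(x', y') \<in> between P Q" using eq p by auto
  moreover have "u = x \<and> v = y \<or> u = x' \<and> v = y'" if "u \<in> P" "v \<in> Q" "v \<in> nb u" for u v
  proof -
    have "(u, v) \<in> between P Q" using that by (simp add: between_def)
    then show ?thesis using eq p by simp
  qed
  ultimately show thesis using that[of x y x' y'] eq(2) p by (auto simp: between_def)
qed

text \<open>Deleting \<open>y\<close> turns the two-edge cut into a bridge \<open>x q\<close>, which then enters the matching.\<close>

lemma two_edge_piece_trivial:
  assumes D: "D \<subseteq> V" "two_edge_conn D" "all_small D" "1 \<le> deficit D"
    and F: "F \<subset> D" "conn F" "deficit F = 1" "cut F (D - F) = 2"
  shows "\<exists>v. F = {v}"
proof -
  have "finite F" using F D finite_V by (meson finite_subset psubset_imp_subset)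
  then show ?thesis using F
  proof (induction F rule: finite_psubset_induct)
    case (psubset F)
    note F = psubset.prems
    have FV: "F \<subseteq> V" using F D by auto
    note expd = expands_deficit[OF D(1) expands_2[OF D(2,3)]]
    obtain x q y r where xq: "x \<in> F" "q \<in> D - F" "q \<in> nb x" and yr: "y \<in> F" "r \<in> D - F" "r \<in> nb y"
      and "(x, q) \<noteq> (y, r)"
      and ends: "\<forall>u\<in>F. \<forall>v\<in>D - F. v \<in> nb u \<longrightarrow> u = x \<and> v = q \<or> u = y \<and> v = r"
      by (rule cut_eq_2E[OF F(4)])
    have only: "u = x \<and> v = q \<or> u = y \<and> v = r" if "u \<in> F" "v \<in> D - F" "v \<in> nb u" for u v
      using ends that by blast
    show ?case
    proof (cases "x = y")
      case True
      \<comment> \<open>With both leaving edges at \<open>x\<close>, at most one edge at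
        \<open>x\<close> remains; it would be a bridge separating \<open>F - {x}\<close>.\<close>
      have "F - {x} = {}"
      proof (rule ccontr)
        assume ne: "F - {x} \<noteq> {}"
        have "cut (F - {x}) (D - F) = 0"
          by (rule cut_eq_0I) (use only True in blast)
        moreover have "D - (F - {x}) = insert x (D - F)" using F xq by auto
        ultimately have "cut (F - {x}) (D - (F - {x})) = card (nb x \<inter> (F - {x}))"
          using cut_insert[of "F - {x}" x "D - F"] FV xq by auto
        moreover have "card (nb x \<inter> (F - {x})) \<le> 1"
        proof -
          have "card (nb x \<inter> (F - {x})) + card {q, r} \<le> card (nb x)"
            using card_mono[of "nb x" "(nb x \<inter> (F - {x})) \<union> {q, r}"]
              card_Un_disjoint[of "nb x \<inter> (F - {x})" "{q, r}"] xq yr True by auto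
          then show ?thesis using card_nb_le[of x] \<open>(x, q) \<noteq> (y, r)\<close> True by simp
        qed
        moreover have "2 \<le> cut (F - {x}) (D - (F - {x}))"
          using D(2) ne F(1) unfolding two_edge_conn_def by (meson Diff_subset subset_psubset_trans)
        ultimately show False by simp
      qed
      then show ?thesis using xq by blast
    next
      case False
      define U where "U = F - {x, y}"
      have U: "U \<subset> D" "U \<subseteq> V" using F D by (auto simp: U_def)
      have "D - U = {x, y} \<union> (D - F)" using F xq yr by (auto simp: U_def)
      moreover have "cut U (D - F) = 0"
        by (rule cut_eq_0I) (use only in \<open>auto simp: U_def\<close>)
      moreover have "{x, y} \<inter> (D - F) = {}" using xq yr by auto
      ultimately have cutU: "cut U (D - U) = card (nb x \<inter> U) + card (nb y \<inter> U)"
        using cut_Un_right[OF U(2), of "{x, y}" "D - F"] cut_pair[OF U(2) False] by (metis add.right_neutral)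
      have le4: "cut U (D - U) \<le> 4"
        using cutU card_nb_Int_le_2[of q x U] card_nb_Int_le_2[of r y U] xq yr by (auto simp: U_def)
      \<comment> \<open>At most four edges leave \<open>U\<close>, so deficit 2 would be tight. The
        components would then be single vertices by induction, each adjacent to both
        \<open>x\<close> and \<open>y\<close>. Deficit 2 needs two of them, which gives a
        4-cycle.\<close>
      have "deficit U \<le> 1"
      proof (rule ccontr)
        assume "\<not> deficit U \<le> 1"
        then have tight: "int (cut U (D - U)) \<le> 2 * deficit U" using le4 by simp
        have def2: "2 * deficit U \<le> 4" using expd[OF U(1)] le4 by simp
        have single: "\<exists>c. C = {c} \<and> c \<in> nb x \<and> c \<in> nb y"
          if C: "C \<subseteq> U" "conn C" "cut C (U - C) = 0" for C
        proof -
          have eq: "int (cut C (D - C)) = 2 * deficit C"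
            by (rule expands_tight[OF D(1) expands_2[OF D(2,3)] U(1) C(1,3) tight])
          have CD: "C \<subset> D" "C \<noteq> {}" "C \<subset> F" using C U xq by (auto simp: conn_def U_def)
          then have "2 \<le> cut C (D - C)" using D(2) unfolding two_edge_conn_def by blast
          moreover have "deficit C \<le> 1" using D(3) CD C unfolding all_small_def by blast
          ultimately have "deficit C = 1" "cut C (D - C) = 2" using eq by auto
          then obtain c where c: "C = {c}" using psubset.IH[OF CD(3)] CD C by blast
          have "nb c \<inter> (D - C) \<subseteq> {x, y}"
          proof
            fix z assume z: "z \<in> nb c \<inter> (D - C)"
            have "c \<in> F" "c \<noteq> x" "c \<noteq> y" using c C by (auto simp: U_def)
            then have "z \<notin> D - F" using only[of c z] z by blast
            moreover have "z \<notin> U - C"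
              using z C c U cut_eq_0_iff[of C "U - C"] by blast
            ultimately show "z \<in> {x, y}" using z by (auto simp: U_def)
          qed
          moreover have "card (nb c \<inter> (D - C)) = 2"
            using \<open>cut C (D - C) = 2\<close> c cut_commute[of C] by (simp add: cut_singleton)
          ultimately have "nb c \<inter> (D - C) = {x, y}"
            using False by (intro card_subset_eq) auto
          then show ?thesis using c nb_sym by blast
        qed
        have "U \<noteq> {}" using \<open>\<not> deficit U \<le> 1\<close> by auto
        then obtain v where "v \<in> U" by auto
        then obtain C where C: "C \<subseteq> U" "conn C" "cut C (U - C) = 0"
          using component_exists U(2) by metis
        then obtain c where c: "C = {c}" "c \<in> nb x" "c \<in> nb y" using single by blast
        have "deficit C \<le> 1" using deficit_le_card[of C] c by simp
        then have "deficit (U - C) \<noteq> 0"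
          using deficit_component[OF C(1) U(2) C(3)] \<open>\<not> deficit U \<le> 1\<close> by simp
        then have "U - C \<noteq> {}" by (metis deficit_empty)
        then obtain w where "w \<in> U" "w \<noteq> c" using c by auto
        then obtain C' where C': "w \<in> C'" "C' \<subseteq> U" "conn C'" "cut C' (U - C') = 0"
          using component_exists U(2) by metis
        then obtain c' where "C' = {c'}" "c' \<in> nb x" "c' \<in> nb y" using single by blast
        then show False using common_nb_unique[OF False c(2,3)] C'(1) \<open>w \<noteq> c\<close> by auto
      qed
      moreover have "card F = card U + 2"
        using card_Diff_pair[OF FV xq(1) yr(1) False] by (simp add: U_def)
      \<comment> \<open>Modulo 3 the deficit of \<open>U\<close> is that of \<open>F\<close> minus
        2, that is -1, so the bound 1 drops to -1.\<close>
      ultimately have Um1: "deficit U \<le> -1"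
        using F(3) deficit_cong_card[of F] deficit_cong_card[of U] by presburger
      \<comment> \<open>The part outside \<open>F\<close> without \<open>q\<close>: at most two
        edges to \<open>q\<close> and the edge at \<open>y\<close> leave it, so its deficit is at
        most 1. Altogether \<open>D\<close> has deficit at most 1 + (-1) + 1 - 1 = 0.\<close>
      define R where "R = D - F - {q}"
      have R: "R \<subset> D" "R \<subseteq> V" using D xq by (auto simp: R_def)
      have "deficit R \<le> 1"
      proof -
        have "D - R = insert q F" using F xq by (auto simp: R_def)
        then have "cut R (D - R) = card (nb q \<inter> R) + cut R F"
          using R xq by (simp add: cut_insert)
        moreover have "card (nb q \<inter> R) \<le> 2"
          by (rule card_nb_Int_le_2[of x]) (use xq nb_sym in \<open>auto simp: R_def\<close>)
        moreover have "cut R F \<le> 1"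
        proof -
          have "between R F \<subseteq> {(r, y)}"
            using only nb_sym by (fastforce simp: between_def R_def)
          then show ?thesis unfolding cut_def using card_mono[of "{(r, y)}"] by fastforce
        qed
        ultimately show ?thesis using expd[OF R(1)] by simp
      qed
      moreover have "deficit D \<le> deficit (D - {y}) + 1" by (rule deficit_remove[OF D(1)])
      moreover have "deficit (D - {y}) \<le> deficit U + deficit R - 1"
      proof -
        have "deficit ((F - {y}) \<union> (D - F)) \<le> deficit (F - {y} - {x}) + deficit (D - F - {q}) - 1"
          by (rule deficit_bridge(2)) (use FV D xq False only in auto)
        moreover have "(F - {y}) \<union> (D - F) = D - {y}" "F - {y} - {x} = U"
          using F yr by (auto simp: U_def)
        ultimately show ?thesis by (simp add: R_def)
      qed
      ultimately show ?thesis using Um1 D(4) by simp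
    qed
  qed
qed

text \<open>Some edge leaves \<open>Y\<close>, and its end in \<open>Y\<close> has lost a neighbour.
  This makes the non-cubic case hereditary.\<close>

lemma conn_psubset_low_degree:
  assumes "X \<subseteq> V" "conn X" "Y \<subset> X" "Y \<noteq> {}"
  shows "\<exists>y\<in>Y. card (nb y \<inter> Y) \<le> 2"
proof -
  have "cut Y (X - Y) \<noteq> 0" using assms by (auto simp: conn_def)
  moreover have "Y \<subseteq> V" using assms by auto
  ultimately obtain y where "y \<in> Y" "nb y \<inter> (X - Y) \<noteq> {}"
    using cut_eq_0_iff[of Y "X - Y"] by auto
  then show ?thesis using card_nb_Int_le_2 by blast
qed

text \<open>Induction over subsets: in a minimal counterexample the deletion around a vertex
  \<open>u\<close> of degree 2 leaves a tight set, and a component of it is a single vertex with the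
  same two neighbours as \<open>u\<close>.\<close>

theorem deficit_non_cubic:
  assumes "X \<subseteq> V" "conn X" "\<exists>x\<in>X. card (nb x \<inter> X) \<le> 2"
  shows "deficit X \<le> 1"
proof -
  have "finite X" using assms finite_V by (meson finite_subset)
  then show ?thesis using assms
  proof (induction X rule: finite_psubset_induct)
    case (psubset X)
    note X = psubset.prems
    have small: "all_small X"
      unfolding all_small_def
    proof (intro allI impI)
      fix C assume C: "C \<subset> X" "conn C"
      then have "C \<noteq> {}" by (simp add: conn_def)
      then show "deficit C \<le> 1"
        using psubset.IH[OF C(1)] C X conn_psubset_low_degree[OF X(1,2) C(1)] by (meson psubset_imp_subset subset_trans)
    qed
    show ?case
    proof (rule ccontr)
      assume neg: "\<not> ?case"
      then have bl: "two_edge_conn X" using bridgeless_of_deficit X small by simp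
      note expd = expands_deficit[OF X(1) expands_2[OF bl small]]
      obtain u where u: "u \<in> X" "card (nb u \<inter> X) \<le> 2" using X by blast
      have "X \<noteq> {u}" using neg deficit_le_card[of X] by auto
      then have "{u} \<subset> X" using u by auto
      then have "2 \<le> cut {u} (X - {u})" using bl unfolding two_edge_conn_def by blast
      then have "2 \<le> card (nb u \<inter> (X - {u}))" using cut_commute[of "{u}"] by (simp add: cut_singleton)
      moreover have "nb u \<inter> (X - {u}) = nb u \<inter> X" using nb_irrefl by auto
      ultimately have "card (nb u \<inter> X) = 2" using u by simp
      then obtain a v where av: "nb u \<inter> X = {a, v}" "a \<noteq> v" by (meson card_2_iff)
      have in_nb: "a \<in> nb u" "v \<in> nb u" "a \<in> X" "v \<in> X" "u \<in> nb a" "u \<in> nb v" using av nb_sym by blast+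
      define U where "U = X - {u, a, v}"
      have U: "U \<subset> X" "U \<subseteq> V" using u X by (auto simp: U_def)
      \<comment> \<open>Deleting \<open>a\<close> costs 1 and makes \<open>u\<close> a leaf;
        matching \<open>u\<close> with \<open>v\<close> regains it. So \<open>U\<close> still has
        deficit at least 2, with at most four edges leaving.\<close>
      have "deficit X \<le> deficit (X - {a}) + 1" by (rule deficit_remove[OF X(1)])
      moreover have "deficit (X - {a}) \<le> deficit (X - {a} - {u, v}) - 1"
        by (rule deficit_leaf) (use X u av in_nb nb_neq in auto)
      moreover have "X - {a} - {u, v} = U" by (auto simp: U_def)
      ultimately have dU: "2 \<le> deficit U" using neg by simp
      have "X - U = insert u {a, v}" using u in_nb by (auto simp: U_def)
      then have "cut U (X - U) = card (nb u \<inter> U) + (card (nb a \<inter> U) + card (nb v \<inter> U))"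
        using U av in_nb nb_neq by (simp add: cut_insert cut_pair)
      moreover have "nb u \<inter> U = {}" using av by (auto simp: U_def)
      moreover have "card (nb a \<inter> U) \<le> 2" "card (nb v \<inter> U) \<le> 2"
        using in_nb by (auto intro!: card_nb_Int_le_2[of u] simp: U_def)
      ultimately have tight: "int (cut U (X - U)) \<le> 2 * deficit U" using dU by simp
      obtain w where "w \<in> U" using dU by fastforce
      then obtain C where C: "C \<subseteq> U" "conn C" "cut C (U - C) = 0"
        using component_exists U(2) by metis
      have eq: "int (cut C (X - C)) = 2 * deficit C"
        by (rule expands_tight[OF X(1) expands_2[OF bl small] U(1) C(1,3) tight])
      have CX: "C \<subset> X" "C \<noteq> {}" using C U by (auto simp: conn_def)
      then have "2 \<le> cut C (X - C)" using bl unfolding two_edge_conn_def by blast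
      moreover have "deficit C \<le> 1" using small CX C unfolding all_small_def by blast
      ultimately have C2: "deficit C = 1" "cut C (X - C) = 2" using eq by auto
      then obtain c where c: "C = {c}"
        using two_edge_piece_trivial[OF X(1) bl small _ CX(1) C(2)] neg by auto
      have "nb c \<inter> (X - C) \<subseteq> {a, v}"
      proof
        fix z assume z: "z \<in> nb c \<inter> (X - C)"
        have "z \<noteq> u" using z c C av nb_sym by (auto simp: U_def)
        moreover have "z \<notin> U - C" using z C c U cut_eq_0_iff[of C "U - C"] by blast
        ultimately show "z \<in> {a, v}" using z by (auto simp: U_def)
      qed
      moreover have "card (nb c \<inter> (X - C)) = 2"
        using C2 c cut_commute[of C] by (simp add: cut_singleton)
      ultimately have "nb c \<inter> (X - C) = {a, v}" using av by (intro card_subset_eq) auto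
      then have "c \<in> nb a" "c \<in> nb v" using nb_sym by blast+
      then have "c = u" using common_nb_unique[OF av(2)] in_nb by blast
      then show False using c C by (auto simp: U_def)
    qed
  qed
qed

section \<open>Vertices whose removal splits a set into three pieces of deficit 1\<close>

text \<open>Exactly one side \<open>H\<close> of the bridge has deficit 1. Since \<open>H\<close>
  without its end has deficit at most 0, using the bridge forces deficit at least 2 on the other
  side without its end \<open>y\<close>; this adds to the deficit of \<open>H\<close> once
  \<open>y\<close> is removed.\<close>

lemma bridge_connector:
  assumes X: "X \<subseteq> V" "conn X" "all_small X" "deficit X = 1"
    and Y: "Y \<subset> X" "cut Y (X - Y) = 1"
  shows "\<exists>y\<in>X. 3 \<le> deficit (X - {y})"
proof -
  obtain x y where xy: "x \<in> Y" "y \<in> X - Y" "y \<in> nb x"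
    and only: "\<And>u v. u \<in> Y \<Longrightarrow> v \<in> X - Y \<Longrightarrow> v \<in> nb u \<Longrightarrow> u = x \<and> v = y"
    using cut_eq_1E[OF Y(2)] by blast
  have main: "3 \<le> deficit (X - {y})"
    if H: "H \<subset> X" "x \<in> H" "y \<in> X - H" "y \<in> nb x" "cut H (X - H) = 1" "deficit H = 1"
      and only: "\<And>u v. u \<in> H \<Longrightarrow> v \<in> X - H \<Longrightarrow> v \<in> nb u \<Longrightarrow> u = x \<and> v = y"
    for H x y
  proof -
    have "deficit H \<le> 1 \<and> (deficit H = 1 \<longrightarrow> deficit (H - {x}) \<le> 0)"
      by (rule bridge_side[OF X(1-3) H(1,5,2)]) (use H(3,4) only in blast)+
    then have "deficit (H - {x}) \<le> 0" using H(6) by blast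
    moreover have "H \<union> (X - H) = X" "H \<subseteq> V" "X - H \<subseteq> V" "H \<inter> (X - H) = {}" using H X by auto
    note U = this
    have "deficit X \<le> deficit (H - {x}) + deficit (X - H - {y}) - 1"
      using deficit_bridge(2)[OF U(2-4) H(2,3) only H(4)] unfolding U(1) by blast
    ultimately have "2 \<le> deficit (X - H - {y})" using X(4) by simp
    moreover have "deficit (H \<union> (X - H - {y})) = deficit H + deficit (X - H - {y})"
    proof (rule deficit_Un)
      show "cut H (X - H - {y}) = 0" by (rule cut_eq_0I) (use only in blast)
    qed (use H X in auto)
    moreover have "H \<union> (X - H - {y}) = X - {y}" using H by auto
    ultimately show ?thesis using H(6) by simp
  qed
  have Y': "X - Y \<subset> X" "X - (X - Y) = Y" "Y \<union> (X - Y) = X" "Y \<subseteq> V" "X - Y \<subseteq> V"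
    using Y xy X by auto
  have "deficit X \<le> deficit Y + deficit (X - Y)"
    using deficit_bridge(1)[OF Y'(4,5) Diff_disjoint xy(1,2) only] unfolding Y'(3) by blast
  moreover have "card X = card Y + card (X - Y)"
    using Y' finite_V by (metis Diff_disjoint card_Un_disjoint finite_subset)
  moreover have "deficit Y \<le> 1" "deficit (X - Y) \<le> 1"
    using expands_deficit[OF X(1) expands_1[OF X(2,3)] Y(1)]
      expands_deficit[OF X(1) expands_1[OF X(2,3)] Y'(1)] Y(2) cut_commute[of "X - Y" Y]
    by (simp_all add: Y'(2))
  \<comment> \<open>Both deficits are at most 1, and their sum is at least 1 and congruent to 1
    modulo 3; so they are 1 and 0.\<close>
  ultimately have "deficit Y = 1 \<or> deficit (X - Y) = 1"
    using X(4) deficit_cong_card[of X] deficit_cong_card[of Y] deficit_cong_card[of "X - Y"] by presburger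
  then show ?thesis
  proof
    assume "deficit Y = 1"
    then have "3 \<le> deficit (X - {y})" using main[OF Y(1) xy Y(2) _ only] by blast
    then show ?thesis using xy by blast
  next
    assume d: "deficit (X - Y) = 1"
    have "3 \<le> deficit (X - {x})"
    proof (rule main[OF Y'(1) xy(2) _ _ _ d])
      show "x \<in> X - (X - Y)" "x \<in> nb y" using xy Y' nb_sym by auto
      show "cut (X - Y) (X - (X - Y)) = 1" unfolding Y'(2) using Y(2) cut_commute by simp
      show "u = y \<and> v = x" if "u \<in> X - Y" "v \<in> X - (X - Y)" "v \<in> nb u" for u v
        using only[of v u] that nb_sym Y' by blast
    qed
    then show ?thesis using xy Y' by blast
  qed
qed

text \<open>A component of a tight set is tight itself, hence has deficit 1 and two leaving edges,
  hence is trivial.\<close>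

lemma tight_single:
  assumes D: "D \<subseteq> V" "two_edge_conn D" "all_small D" "1 \<le> deficit D"
    and X: "X \<subset> D" "X \<noteq> {}" "int (cut X (D - X)) \<le> 2 * deficit X"
  shows "\<exists>c\<in>X. nb c \<inter> X = {} \<and> card (nb c \<inter> D) = 2"
proof -
  have XV: "X \<subseteq> V" using X D by auto
  obtain w where "w \<in> X" using X by auto
  then obtain C where C: "C \<subseteq> X" "conn C" "cut C (X - C) = 0"
    using component_exists XV by metis
  have eq: "int (cut C (D - C)) = 2 * deficit C"
    by (rule expands_tight[OF D(1) expands_2[OF D(2,3)] X(1) C(1,3) X(3)])
  have CD: "C \<subset> D" "C \<noteq> {}" using C X by (auto simp: conn_def)
  then have "2 \<le> cut C (D - C)" using D(2) unfolding two_edge_conn_def by blast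
  moreover have "deficit C \<le> 1" using D(3) CD C unfolding all_small_def by blast
  ultimately have C2: "deficit C = 1" "cut C (D - C) = 2" using eq by auto
  then obtain c where c: "C = {c}"
    using two_edge_piece_trivial[OF D CD(1) C(2)] by auto
  have "nb c \<inter> X = {}" using C c XV cut_eq_0_iff[of C "X - C"] nb_irrefl by auto
  moreover have "nb c \<inter> (D - C) = nb c \<inter> D" using c nb_irrefl by auto
  then have "card (nb c \<inter> D) = 2"
    using C2 c cut_commute[of C] by (simp add: cut_singleton)
  ultimately show ?thesis using c C by blast
qed

text \<open>\<open>H\<close> is the union of the components already taken, so the lemma can be
  iterated starting from the empty set.\<close>

lemma next_component:
  assumes "all_small D" "U \<subset> D" "D \<subseteq> V" and H: "H \<subseteq> U" "cut H (U - H) = 0" "U - H \<noteq> {}"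
  obtains C where "C \<subseteq> U - H" "conn C" "cut C (U - C) = 0" "cut (H \<union> C) (U - (H \<union> C)) = 0"
    "deficit (U - H) = deficit C + deficit (U - (H \<union> C))" "deficit C \<le> 1"
proof -
  have UV: "U \<subseteq> V" "U - H \<subseteq> V" "H \<subseteq> V" using assms by auto
  obtain v where "v \<in> U - H" using H by auto
  then obtain C where C: "C \<subseteq> U - H" "conn C" "cut C (U - H - C) = 0"
    using component_exists UV by metis
  have eq: "U - H - C = U - (H \<union> C)" by auto
  have CV: "C \<subseteq> V" using C UV by auto
  have no1: "b \<notin> nb a" if "a \<in> H" "b \<in> U - H" for a b
    using cut_eq_0D[OF UV(3) H(2) that] .
  have no2: "b \<notin> nb a" if "a \<in> C" "b \<in> U - H - C" for a b
    using cut_eq_0D[OF CV C(3) that] .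
  have "cut C (U - C) = 0"
  proof (rule cut_eq_0I)
    fix a b assume "a \<in> C" "b \<in> U - C"
    then show "b \<notin> nb a" using no1[of b a] no2[of a b] C nb_sym by blast
  qed
  moreover have "cut (H \<union> C) (U - (H \<union> C)) = 0"
    by (rule cut_eq_0I) (use no1 no2 in blast)
  moreover have "deficit (U - H) = deficit C + deficit (U - (H \<union> C))"
    using deficit_component[OF C(1) UV(2) C(3)] eq by simp
  moreover have "C \<subset> D" using C assms by auto
  then have "deficit C \<le> 1" using assms(1) C(2) by (simp add: all_small_def)
  ultimately show thesis using that[OF C(1,2)] by simp
qed

text \<open>Each component of \<open>Q - {y}\<close> has deficit at most 1, so there are at least
  three, and \<open>y\<close> has no edges for more. Each of them also needs an edge out of
  \<open>Q\<close>; with at most four such edges, two components have only one and are single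
  vertices.\<close>

lemma three_components:
  assumes D: "D \<subseteq> V" "two_edge_conn D" "all_small D" "1 \<le> deficit D"
    and Q: "Q \<subset> D" "conn Q" "y \<in> Q" "3 \<le> deficit (Q - {y})" "cut Q (D - Q) \<le> 4"
  obtains c1 c2 R where "c1 \<noteq> c2" "c1 \<notin> R" "c2 \<notin> R" "y \<notin> R" "Q = {y, c1, c2} \<union> R"
    "nb c1 \<inter> Q = {y}" "nb c2 \<inter> Q = {y}" "card (nb c1 \<inter> (D - Q)) = 1" "card (nb c2 \<inter> (D - Q)) = 1"
    "conn R" "deficit R = 1" "card (nb y \<inter> R) = 1" "cut R (D - Q) + 2 = cut Q (D - Q)"
    "cut R (D - R) = cut R (D - Q) + 1"
proof -
  define U where "U = Q - {y}"
  have QV: "Q \<subseteq> V" and U: "U \<subset> D" "U \<subseteq> V" using Q D by (auto simp: U_def)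
  note next_comp = next_component[OF D(3) U(1) D(1)]
  have "deficit U \<noteq> 0" using Q(4) by (simp add: U_def)
  then have "U \<noteq> {}" by (metis deficit_empty)
  obtain C1 where C1: "C1 \<subseteq> U" "conn C1" "cut C1 (U - C1) = 0"
    "deficit U = deficit C1 + deficit (U - C1)" "deficit C1 \<le> 1"
    using next_comp[of "{}"] \<open>U \<noteq> {}\<close> by auto
  have "2 \<le> deficit (U - C1)" using C1 Q(4) by (simp add: U_def)
  then have "U - C1 \<noteq> {}" by (metis deficit_empty not_numeral_le_zero)
  then obtain C2 where C2: "C2 \<subseteq> U - C1" "conn C2" "cut C2 (U - C2) = 0"
    "cut (C1 \<union> C2) (U - (C1 \<union> C2)) = 0"
    "deficit (U - C1) = deficit C2 + deficit (U - (C1 \<union> C2))" "deficit C2 \<le> 1"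
    using next_comp[OF C1(1,3)] by metis
  have "1 \<le> deficit (U - (C1 \<union> C2))" using C2 \<open>2 \<le> deficit (U - C1)\<close> by simp
  then have "U - (C1 \<union> C2) \<noteq> {}" by (metis deficit_empty not_one_le_zero)
  moreover have "C1 \<union> C2 \<subseteq> U" using C1 C2 by auto
  ultimately obtain C3 where C3: "C3 \<subseteq> U - (C1 \<union> C2)" "conn C3" "cut C3 (U - C3) = 0"
    "cut (C1 \<union> C2 \<union> C3) (U - (C1 \<union> C2 \<union> C3)) = 0"
    "deficit (U - (C1 \<union> C2)) = deficit C3 + deficit (U - (C1 \<union> C2 \<union> C3))" "deficit C3 \<le> 1"
    using next_comp[OF _ C2(4)] by metis
  have cut_y: "cut C (Q - C) = card (nb y \<inter> C)" "1 \<le> card (nb y \<inter> C)"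
    "cut C (D - C) = card (nb y \<inter> C) + cut C (D - Q)"
    if C: "C \<subseteq> U" "C \<noteq> {}" "cut C (U - C) = 0" for C
  proof -
    have CV: "C \<subseteq> V" using C U by auto
    have "Q - C = insert y (U - C)" "y \<notin> U - C" using C Q by (auto simp: U_def)
    then show e: "cut C (Q - C) = card (nb y \<inter> C)" using cut_insert[OF CV] C(3) by simp
    have "C \<subset> Q" using C Q by (auto simp: U_def)
    then show "1 \<le> card (nb y \<inter> C)" using conn_subset_cut[OF Q(2)] C(2) e by metis
    have "D - C = (Q - C) \<union> (D - Q)" "(Q - C) \<inter> (D - Q) = {}" using C Q U by (auto simp: U_def)
    then show "cut C (D - C) = card (nb y \<inter> C) + cut C (D - Q)" using cut_Un_right[OF CV] e by metis
  qed
  have ne: "C1 \<noteq> {}" "C2 \<noteq> {}" "C3 \<noteq> {}" using C1 C2 C3 by (auto simp: conn_def)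
  have sub: "C1 \<subseteq> U" "C2 \<subseteq> U" "C3 \<subseteq> U" using C1 C2 C3 by auto
  have disj: "C1 \<inter> C2 = {}" "C1 \<inter> C3 = {}" "C2 \<inter> C3 = {}" using C1 C2 C3 by auto
  define R where "R = U - (C1 \<union> C2 \<union> C3)"
  have al: "1 \<le> card (nb y \<inter> C1)" "1 \<le> card (nb y \<inter> C2)" "1 \<le> card (nb y \<inter> C3)"
    using cut_y(2) sub ne C1 C2 C3 by auto
  \<comment> \<open>The three components already use up the degree of \<open>y\<close>: there is no
    fourth component, and no edge from \<open>y\<close> leaves \<open>Q\<close>.\<close>
  have "card (nb y \<inter> C1) + card (nb y \<inter> C2) + card (nb y \<inter> C3) + card (nb y - U) + card (nb y \<inter> R) \<le> 3"
  proof -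
    have "nb y = (nb y \<inter> C1) \<union> (nb y \<inter> C2) \<union> (nb y \<inter> C3) \<union> (nb y - U) \<union> (nb y \<inter> R)"
      using sub by (auto simp: R_def)
    also have "card \<dots> = card (nb y \<inter> C1) + card (nb y \<inter> C2) + card (nb y \<inter> C3) + card (nb y - U) + card (nb y \<inter> R)"
      using disj sub by (subst card_Un_disjoint, force, force, force simp: R_def)+ simp
    finally show ?thesis using card_nb_le[of y] by simp
  qed
  then have a1: "card (nb y \<inter> C1) = 1" "card (nb y \<inter> C2) = 1" "card (nb y \<inter> C3) = 1"
    and "card (nb y - U) = 0" and yR: "card (nb y \<inter> R) = 0" using al by linarith+
  then have yU: "nb y \<subseteq> U" by simp
  have "R = {}"
  proof (rule ccontr)
    assume "R \<noteq> {}"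
    moreover have "cut R (U - R) = 0"
    proof -
      have "U - R = C1 \<union> C2 \<union> C3" using sub by (auto simp: R_def)
      then show ?thesis using C3(4) cut_commute[of R] by (simp add: R_def)
    qed
    ultimately show False using cut_y(2)[of R] yR by (auto simp: R_def)
  qed
  then have Ueq: "U = C1 \<union> C2 \<union> C3" using sub by (auto simp: R_def)
  have dR: "deficit (U - (C1 \<union> C2 \<union> C3)) = 0"
    using \<open>R = {}\<close> unfolding R_def by (metis deficit_empty)
  have d1: "deficit C1 = 1" "deficit C2 = 1" "deficit C3 = 1"
    using C1(4,5) C2(5,6) C3(5,6) Q(4) dR by (auto simp: U_def)
  have CD: "C1 \<subset> D" "C2 \<subset> D" "C3 \<subset> D" using sub U by auto
  have b: "1 \<le> cut C (D - Q)" "cut C (D - Q) = 1 \<Longrightarrow> \<exists>c. C = {c}" "cut C (D - C) = cut C (D - Q) + 1"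
    if "C \<in> {C1, C2, C3}" for C
  proof -
    have C: "C \<subset> D" "C \<noteq> {}" "conn C" "deficit C = 1" "card (nb y \<inter> C) = 1" "cut C (U - C) = 0" "C \<subseteq> U"
      using that CD ne d1 a1 C1 C2 C3 sub by auto
    show e: "cut C (D - C) = cut C (D - Q) + 1" using cut_y(3)[of C] C by simp
    have "2 \<le> cut C (D - C)" using D(2) C(1,2) by (simp add: two_edge_conn_def)
    then show "1 \<le> cut C (D - Q)" using e by simp
    show "\<exists>c. C = {c}" if "cut C (D - Q) = 1"
      by (rule two_edge_piece_trivial[OF D C(1,3,4)]) (use e that in simp)
  qed
  have DQ: "D - Q \<subseteq> V" using D by auto
  have Qeq: "Q = {y} \<union> (C1 \<union> C2 \<union> C3)" using Ueq Q by (auto simp: U_def)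
  have "nb y \<inter> (D - Q) = {}" using yU by (auto simp: U_def)
  then have "cut {y} (D - Q) = 0" using cut_commute[of "{y}"] by (simp add: cut_singleton)
  moreover have "{y} \<inter> (C1 \<union> C2 \<union> C3) = {}" using sub by (auto simp: U_def)
  ultimately have "cut Q (D - Q) = cut (C1 \<union> C2 \<union> C3) (D - Q)"
    using cut_Un_left[OF DQ, of "{y}" "C1 \<union> C2 \<union> C3"] Qeq by simp
  also have "\<dots> = cut C1 (D - Q) + cut C2 (D - Q) + cut C3 (D - Q)"
    using cut_Un_left[OF DQ, of "C1 \<union> C2" C3] cut_Un_left[OF DQ, of C1 C2] disj by (simp add: Int_Un_distrib2)
  finally have sum: "cut Q (D - Q) = cut C1 (D - Q) + cut C2 (D - Q) + cut C3 (D - Q)" .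
  note result = that
  \<comment> \<open>\<open>P1\<close>, \<open>P2\<close>, \<open>P3\<close> is any ordering of the
    components in which the first two have one edge out of \<open>Q\<close>.\<close>
  have fin: thesis
    if P: "{P1, P2, P3} = {C1, C2, C3}" "P1 \<inter> P2 = {}" "P1 \<inter> P3 = {}" "P2 \<inter> P3 = {}"
      "cut P1 (D - Q) = 1" "cut P2 (D - Q) = 1"
      "cut Q (D - Q) = cut P1 (D - Q) + cut P2 (D - Q) + cut P3 (D - Q)" for P1 P2 P3
  proof -
    have mem: "P1 \<in> {C1, C2, C3}" "P2 \<in> {C1, C2, C3}" "P3 \<in> {C1, C2, C3}" using P(1) by blast+
    obtain c1 c2 where c: "P1 = {c1}" "P2 = {c2}" using b(2) mem P by metis
    have "P1 \<union> P2 \<union> P3 = C1 \<union> C2 \<union> C3" using arg_cong[OF P(1), of Union] by (simp add: Un_assoc)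
    then have Q': "Q = {y, c1, c2} \<union> P3" using Qeq c by auto
    have props: "card (nb y \<inter> C) = 1" "conn C" "deficit C = 1" "cut C (U - C) = 0" "C \<subseteq> U" if "C \<in> {C1, C2, C3}" for C
      using that a1 C1 C2 C3 d1 sub by auto
    have nbc: "nb c \<inter> Q = {y}" "card (nb c \<inter> (D - Q)) = 1"
      if c: "{c} \<in> {C1, C2, C3}" "cut {c} (D - Q) = 1" for c
    proof -
      have "c \<in> nb y" using props(1)[OF c(1)] by (cases "c \<in> nb y") auto
      moreover have "c \<in> V" using props(5)[OF c(1)] U by auto
      then have "nb c \<inter> (U - {c}) = {}" using props(4)[OF c(1)] cut_eq_0_iff[of "{c}" "U - {c}"] by auto
      ultimately show "nb c \<inter> Q = {y}" using Q(3) nb_sym nb_irrefl by (auto simp: U_def)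
      show "card (nb c \<inter> (D - Q)) = 1" using c(2) cut_commute[of "{c}"] by (simp add: cut_singleton)
    qed
    show thesis
    proof (rule result[of c1 c2 P3])
      show "y \<notin> P3" using props(5)[OF mem(3)] by (auto simp: U_def)
      show "cut P3 (D - P3) = cut P3 (D - Q) + 1" using b(3)[OF mem(3)] .
    qed (use Q' nbc[of c1] nbc[of c2] P c mem props[OF mem(3)] in auto)
  qed
  \<comment> \<open>Three positive numbers with sum at most 4: at least two of them are 1.\<close>
  have "cut C1 (D - Q) = 1 \<and> cut C2 (D - Q) = 1 \<or> cut C1 (D - Q) = 1 \<and> cut C3 (D - Q) = 1
    \<or> cut C2 (D - Q) = 1 \<and> cut C3 (D - Q) = 1"
    using sum Q(5) b(1)[of C1] b(1)[of C2] b(1)[of C3] by simp linarith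
  then show thesis
  proof (elim disjE)
    assume "cut C1 (D - Q) = 1 \<and> cut C2 (D - Q) = 1"
    then show thesis using fin[of C1 C2 C3] disj sum by auto
  next
    assume "cut C1 (D - Q) = 1 \<and> cut C3 (D - Q) = 1"
    moreover have "{C1, C3, C2} = {C1, C2, C3}" by auto
    ultimately show thesis using fin[of C1 C3 C2] disj sum by (auto simp: Int_commute)
  next
    assume "cut C2 (D - Q) = 1 \<and> cut C3 (D - Q) = 1"
    moreover have "{C2, C3, C1} = {C1, C2, C3}" by auto
    ultimately show thesis using fin[of C2 C3 C1] disj sum by (auto simp: Int_commute)
  qed
qed

end

section \<open>Cubic graphs of deficit 2\<close>

text \<open>The graphs that remain after the non-cubic case; they are to be identified with the two
  exceptions.\<close>

locale cubic_deficient = subcubic_girth5 +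
  assumes conn_V: "conn V"
    and cubic: "v \<in> V \<Longrightarrow> card (nb v) = 3"
    and deficient: "2 \<le> deficit V"
begin

lemma small_V: "all_small V"
  unfolding all_small_def
proof (intro allI impI)
  fix C assume C: "C \<subset> V" "conn C"
  then have "C \<noteq> {}" "C \<subseteq> V" by (auto simp: conn_def)
  then show "deficit C \<le> 1"
    using deficit_non_cubic[OF _ C(2)] conn_psubset_low_degree[OF _ conn_V C(1)] by blast
qed

lemma bridgeless_V: "two_edge_conn V"
  using bridgeless_of_deficit[OF _ conn_V small_V deficient] by simp

text \<open>A connected piece of deficit 1 with two leaving edges would be a single vertex, but in a
  cubic graph three edges leave a vertex.\<close>

lemma expands_3: "expands 3 V"
  unfolding expands_def
proof (intro allI impI)
  fix C assume C: "C \<subset> V" "conn C"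
  then have "C \<noteq> {}" by (simp add: conn_def)
  then have "2 \<le> cut C (V - C)" using C bridgeless_V by (simp add: two_edge_conn_def)
  moreover have "deficit C \<le> 1" using C small_V by (simp add: all_small_def)
  moreover have "cut C (V - C) \<noteq> 2" if "deficit C = 1"
  proof
    assume "cut C (V - C) = 2"
    then obtain c where c: "C = {c}"
      using two_edge_piece_trivial[OF order_refl bridgeless_V small_V _ C \<open>deficit C = 1\<close>] deficient
      by auto
    then have "nb c \<inter> (V - C) = nb c" "c \<in> V" using C nb_subset nb_irrefl by auto
    then show False
      using \<open>cut C (V - C) = 2\<close> cut_commute[of C] c cubic[of c] C by (simp add: cut_singleton)
  qed
  ultimately show "3 * deficit C \<le> int (cut C (V - C))" by linarith
qed

lemma deficit_cut: "X \<subset> V \<Longrightarrow> 3 * deficit X \<le> int (cut X (V - X))"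
  using expands_deficit[OF _ expands_3] by simp

lemma ex_vertex: "\<exists>u. u \<in> V"
  using conn_V by (auto simp: conn_def)

text \<open>Three edges leave the complement of \<open>u\<close>, which bounds its deficit above;
  deleting \<open>u\<close> costs at most 1, which bounds it below.\<close>

lemma deficit_remove_vertex: "u \<in> V \<Longrightarrow> deficit (V - {u}) = 1"
proof -
  assume u: "u \<in> V"
  then have "V - {u} \<subset> V" "V - (V - {u}) = {u}" by auto
  then have "3 * deficit (V - {u}) \<le> int (card (nb u \<inter> (V - {u})))"
    using deficit_cut[of "V - {u}"] by (simp add: cut_singleton)
  also have "\<dots> \<le> 3" using card_mono[of "nb u" "nb u \<inter> (V - {u})"] card_nb_le[of u] by simp
  finally show ?thesis using deficit_remove[of V u] deficient by simp
qed

lemma deficit_V: "deficit V = 2"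
proof -
  obtain u where "u \<in> V" using ex_vertex by blast
  then show ?thesis using deficit_remove_vertex deficit_remove[of V u] deficient by force
qed

lemma card_V_mod: "3 dvd int (card V) - 2"
  using deficit_cong_card[of V] deficit_V by presburger

text \<open>The equality case of the inequality with factor 3. The assumption \<open>big\<close>
  excludes the complement of a vertex, which also has deficit 1 and three leaving edges.\<close>

lemma three_edge_piece_trivial:
  assumes C: "C \<subset> V" "C \<noteq> {}" "deficit C = 1" "cut C (V - C) = 3" and big: "\<nexists>v. V - C = {v}"
  shows "\<exists>c. C = {c}"
proof (rule ccontr)
  assume nontriv: "\<nexists>c. C = {c}"
  have CV: "C \<subseteq> V" "V - C \<subseteq> V" using C by auto
  have finC: "finite C" using CV finite_V finite_subset by blast
  \<comment> \<open>Otherwise deleting \<open>y\<close> and \<open>r\<close> leaves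
    \<open>x p\<close> as a bridge. Both remaining parts have at most five leaving edges, so deficit
    at most 1, and by congruence at most -1; matching the bridge gives \<open>V\<close> deficit at
    most 2 - 1 - 1 - 1.\<close>
  have core: "x = y \<or> p = r"
    if bt: "between C (V - C) = {(x, p), (y, q), (z, r)}" for x p y q z r
  proof (rule ccontr)
    assume "\<not> (x = y \<or> p = r)"
    then have neq: "x \<noteq> y" "p \<noteq> r" by auto
    have "(x, p) \<in> between C (V - C)" "(y, q) \<in> between C (V - C)" "(z, r) \<in> between C (V - C)"
      using bt by auto
    then have mem: "x \<in> C" "p \<in> V - C" "p \<in> nb x" "y \<in> C" "q \<in> V - C" "q \<in> nb y"
      "z \<in> C" "r \<in> V - C" "r \<in> nb z" by (auto simp: between_def)
    have only: "(u, v) \<in> {(x, p), (y, q), (z, r)}" if "u \<in> C" "v \<in> V - C" "v \<in> nb u" for u v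
    proof -
      have "(u, v) \<in> between C (V - C)" using that by (simp add: between_def)
      then show ?thesis using bt by simp
    qed
    define F R where "F = C - {x, y}" and "R = V - C - {p, r}"
    have F: "F \<subset> V" "F \<subseteq> V" and R: "R \<subset> V" "R \<subseteq> V" using C mem by (auto simp: F_def R_def)
    have "V - F = {x, y} \<union> (V - C)" "{x, y} \<inter> (V - C) = {}" using C mem by (auto simp: F_def)
    then have "cut F (V - F) = card (nb x \<inter> F) + card (nb y \<inter> F) + cut F (V - C)"
      using cut_Un_right[OF F(2)] cut_pair[OF F(2) neq(1)] by metis
    moreover have "card (nb x \<inter> F) \<le> 2" "card (nb y \<inter> F) \<le> 2"
      using card_nb_Int_le_2[of p x F] card_nb_Int_le_2[of q y F] mem by (auto simp: F_def)
    moreover have "cut F (V - C) \<le> 1"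
    proof -
      have "between F (V - C) \<subseteq> {(z, r)}" using only by (fastforce simp: between_def F_def)
      then show ?thesis unfolding cut_def using card_mono[of "{(z, r)}"] by fastforce
    qed
    ultimately have "deficit F \<le> 1" using deficit_cut[OF F(1)] by linarith
    moreover have "card C = card F + 2"
      using card_Diff_pair[OF CV(1) mem(1,4) neq(1)] by (simp add: F_def)
    ultimately have dF: "deficit F \<le> -1"
      using C(3) deficit_cong_card[of C] deficit_cong_card[of F] by presburger
    have "V - R = {p, r} \<union> C" "{p, r} \<inter> C = {}" using C mem by (auto simp: R_def)
    then have "cut R (V - R) = card (nb p \<inter> R) + card (nb r \<inter> R) + cut R C"
      using cut_Un_right[OF R(2)] cut_pair[OF R(2) neq(2)] by metis
    moreover have "card (nb p \<inter> R) \<le> 2" "card (nb r \<inter> R) \<le> 2"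
      using card_nb_Int_le_2[of x p R] card_nb_Int_le_2[of z r R] mem nb_sym by (auto simp: R_def)
    moreover have "cut R C \<le> 1"
    proof -
      have "between R C \<subseteq> {(q, y)}" using only nb_sym by (fastforce simp: between_def R_def)
      then show ?thesis unfolding cut_def using card_mono[of "{(q, y)}"] by fastforce
    qed
    ultimately have "deficit R \<le> 1" using deficit_cut[OF R(1)] by linarith
    moreover have "card (V - C) = card R + 2"
      using card_Diff_pair[OF CV(2) mem(2,8) neq(2)] by (simp add: R_def)
    moreover have "card V = card C + card (V - C)"
      using card_Diff_subset[OF finC CV(1)] card_mono[OF finite_V CV(1)] by simp
    ultimately have dR: "deficit R \<le> -1"
      using C(3) deficit_cong_card[of C] deficit_cong_card[of R] card_V_mod by presburger
    have "V \<inter> {y, r} = {y, r}" "y \<noteq> r" using mem C by auto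
    then have "deficit V \<le> deficit (V - {y, r}) + 2"
      using deficit_Diff[of V "{y, r}"] by simp
    moreover have "deficit ((C - {y}) \<union> (V - C - {r})) \<le> deficit (C - {y} - {x}) + deficit (V - C - {r} - {p}) - 1"
      by (rule deficit_bridge(2)) (use CV mem neq only in blast)+
    moreover have "(C - {y}) \<union> (V - C - {r}) = V - {y, r}" "C - {y} - {x} = F" "V - C - {r} - {p} = R"
      using mem C by (auto simp: F_def R_def)
    ultimately show False using dF dR deficient by simp
  qed
  obtain a b c where abc: "between C (V - C) = {a, b, c}" "a \<noteq> b" "a \<noteq> c" "b \<noteq> c"
    using C(4) unfolding cut_def by (metis card_3_iff)
  obtain x p y q z r where eqs: "a = (x, p)" "b = (y, q)" "c = (z, r)" by (metis surj_pair)
  have bt: "between C (V - C) = {(x, p), (y, q), (z, r)}" using abc eqs by simp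
  have "(x, p) \<in> between C (V - C)" "(y, q) \<in> between C (V - C)" "(z, r) \<in> between C (V - C)"
    using bt by auto
  then have mem: "x \<in> C" "p \<in> V - C" "p \<in> nb x" "y \<in> C" "q \<in> V - C" "q \<in> nb y"
    "z \<in> C" "r \<in> V - C" "r \<in> nb z" by (auto simp: between_def)
  have only: "(u, v) \<in> {(x, p), (y, q), (z, r)}" if "u \<in> C" "v \<in> V - C" "v \<in> nb u" for u v
  proof -
    have "(u, v) \<in> between C (V - C)" using that by (simp add: between_def)
    then show ?thesis using bt by simp
  qed
  \<comment> \<open>If all leaving edges of \<open>H\<close> start at \<open>x\<close>, they exhaust
    its degree, and nothing connects \<open>x\<close> to the remainder of \<open>H\<close>. It is
    used for \<open>C\<close> and for its complement.\<close>
  have lone: "H = {x}"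
    if H: "H \<subseteq> V" "x \<in> H" "distinct [p, q, r]" "{p, q, r} \<subseteq> nb x - H"
      "\<And>u v. u \<in> H \<Longrightarrow> v \<in> V - H \<Longrightarrow> v \<in> nb u \<Longrightarrow> u = x" for H x p q r
  proof (rule ccontr)
    assume "H \<noteq> {x}"
    then have ne: "H - {x} \<noteq> {}" "H - {x} \<subset> V" using H(1,2) by auto
    have "card {p, q, r} = 3" using H(3) by simp
    then have "nb x = {p, q, r}"
      using card_seteq[of "nb x" "{p, q, r}"] H(4) card_nb_le[of x] by auto
    then have "nb x \<inter> H = {}" using H(4) by auto
    then have "b \<notin> nb a" if "a \<in> H - {x}" "b \<in> V - (H - {x})" for a b
      using that H(5)[of a b] nb_sym[of b a] by (cases "b = x") auto
    then have "cut (H - {x}) (V - (H - {x})) = 0" by (rule cut_eq_0I)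
    moreover have "2 \<le> cut (H - {x}) (V - (H - {x}))"
      using bridgeless_V ne unfolding two_edge_conn_def by metis
    ultimately show False by simp
  qed
  have "\<not> (x = y \<and> x = z)"
  proof
    assume xyz: "x = y \<and> x = z"
    have "C = {x}"
    proof (rule lone)
      show "distinct [p, q, r]" using abc eqs xyz by auto
      show "{p, q, r} \<subseteq> nb x - C" using mem xyz by auto
    qed (use CV mem only xyz in auto)
    then show False using nontriv by blast
  qed
  moreover have "\<not> (p = q \<and> p = r)"
  proof
    assume pqr: "p = q \<and> p = r"
    have "V - C = {p}"
    proof (rule lone)
      show "distinct [x, y, z]" using abc eqs pqr by auto
      show "{x, y, z} \<subseteq> nb p - (V - C)" using mem pqr nb_sym by auto
      show "u = p" if "u \<in> V - C" "v \<in> V - (V - C)" "v \<in> nb u" for u v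
        using only[of v u] that pqr nb_sym by auto
    qed (use CV mem in auto)
    then show False using big by blast
  qed
  \<comment> \<open>Over all orderings of the three edges: if two inner ends differ, then all outer
    ends coincide. Both extremes have just been excluded.\<close>
  moreover have "x = y \<or> p = r" by (rule core[OF bt])
  moreover have "x = z \<or> p = q" by (rule core[of x p z r y q]) (use bt in auto)
  moreover have "y = x \<or> q = r" by (rule core[of y q x p z r]) (use bt in auto)
  moreover have "y = z \<or> q = p" by (rule core[of y q z r x p]) (use bt in auto)
  moreover have "z = x \<or> r = q" by (rule core[of z r x p y q]) (use bt in auto)
  moreover have "z = y \<or> r = p" by (rule core[of z r y q x p]) (use bt in auto)
  ultimately show False by auto
qed

lemma bridgeless_remove_vertex:
  assumes u: "u \<in> V"
  shows "two_edge_conn (V - {u})"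
proof -
  let ?X = "V - {u}"
  have small: "all_small ?X" using all_small_mono[OF small_V] by auto
  \<comment> \<open>If \<open>u\<close> separated the graph, each side would need two edges to
    \<open>u\<close>.\<close>
  have nz: "cut Y (?X - Y) \<noteq> 0" if Y: "Y \<subset> ?X" "Y \<noteq> {}" for Y
  proof
    assume c0: "cut Y (?X - Y) = 0"
    let ?Y = "?X - Y"
    have V: "Y \<subseteq> V" "?Y \<subseteq> V" "Y \<subset> V" "?Y \<subset> V" "?Y \<noteq> {}" using Y u by auto
    have "V - Y = insert u ?Y" "V - ?Y = insert u Y" using Y u by auto
    moreover have "u \<notin> ?Y" "u \<notin> Y" using Y by auto
    ultimately have "cut Y (V - Y) = card (nb u \<inter> Y)" "cut ?Y (V - ?Y) = card (nb u \<inter> ?Y)"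
      using c0 cut_commute[of Y ?Y] V by (simp_all add: cut_insert)
    then have "2 \<le> card (nb u \<inter> Y)" "2 \<le> card (nb u \<inter> ?Y)"
      using bridgeless_V V Y unfolding two_edge_conn_def by metis+
    moreover have "card (nb u \<inter> Y) + card (nb u \<inter> ?Y) \<le> card (nb u)"
      by (subst card_Un_disjoint[symmetric]) (auto intro: card_mono)
    ultimately show False using card_nb_le[of u] by simp
  qed
  have "V \<noteq> {u}" using deficit_le_card[of V] deficient by auto
  then have conn: "conn ?X" unfolding conn_def using nz u by auto
  show ?thesis
    unfolding two_edge_conn_def
  proof (intro allI impI, rule ccontr)
    fix Y assume Y: "Y \<subset> ?X" "Y \<noteq> {}" "\<not> 2 \<le> cut Y (?X - Y)"
    then have "cut Y (?X - Y) = 1" using nz[of Y] by linarith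
    \<comment> \<open>Deficit 3 requires nine edges leaving the set without \<open>u\<close> and
      \<open>y\<close>, but there are at most six.\<close>
    then obtain y where y: "y \<in> ?X" "3 \<le> deficit (?X - {y})"
      using bridge_connector[OF _ conn small deficit_remove_vertex[OF u] Y(1)] by auto
    have "?X - {y} \<subset> V" "V - (?X - {y}) = {u, y}" "?X - {y} \<subseteq> V" "u \<noteq> y" using u y by auto
    then have "3 * deficit (?X - {y}) \<le> int (card (nb u \<inter> (?X - {y})) + card (nb y \<inter> (?X - {y})))"
      using deficit_cut[of "?X - {y}"] by (simp add: cut_pair)
    moreover have "card (nb u \<inter> (?X - {y})) \<le> 3" "card (nb y \<inter> (?X - {y})) \<le> 3"
      using card_mono[of "nb u" "nb u \<inter> (?X - {y})"] card_mono[of "nb y" "nb y \<inter> (?X - {y})"]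
        card_nb_le[of u] card_nb_le[of y] by auto
    ultimately show False using y(2) by linarith
  qed
qed

lemma nb_eqI: "x \<in> nb a \<Longrightarrow> y \<in> nb a \<Longrightarrow> z \<in> nb a \<Longrightarrow> distinct [x, y, z] \<Longrightarrow> nb a = {x, y, z}"
  using card_seteq[of "nb a" "{x, y, z}"] card_nb_le[of a] by auto

text \<open>In a minimal bridgeless nontrivial \<open>D\<close> of deficit 1, a smaller connected
  nontrivial set of deficit 1 has a bridge and thus a vertex with three pieces around it. This
  applies twice: to \<open>D\<close> without a degree-2 vertex and its neighbours, and to the third
  piece found there.\<close>

lemma subdivided_K4_exists:
  obtains a1 a2 a3 a4 s12 s13 s14 s23 s24 s34
  where "distinct [a1, a2, a3, a4, s12, s13, s14, s23, s24, s34]"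
    "{a1, a2, a3, a4, s12, s13, s14, s23, s24, s34} \<subseteq> V"
    "nb a1 = {s12, s13, s14}" "nb a2 = {s12, s23, s24}" "nb a3 = {s13, s23, s34}" "nb a4 = {s14, s24, s34}"
    "\<And>s t. s \<in> {s12, s13, s14, s23, s24, s34} \<Longrightarrow> t \<in> {s12, s13, s14, s23, s24, s34} \<Longrightarrow> t \<notin> nb s"
proof -
  define P where "P D \<longleftrightarrow> D \<subset> V \<and> two_edge_conn D \<and> deficit D = 1 \<and> (\<nexists>v. D = {v})" for D
  obtain u where u: "u \<in> V" using ex_vertex by blast
  have "V - {u} \<noteq> {v}" for v
  proof
    assume "V - {u} = {v}"
    then have "nb u \<subseteq> {v}" using nb_subset nb_irrefl by blast
    then have "card (nb u) \<le> 1" using card_mono[of "{v}" "nb u"] by simp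
    then show False using cubic[OF u] by simp
  qed
  then have "P (V - {u})"
    using u bridgeless_remove_vertex deficit_remove_vertex unfolding P_def by blast
  then obtain D where PD: "P D" and min: "\<And>D'. P D' \<Longrightarrow> card D \<le> card D'"
    using ex_has_least_nat[of P "V - {u}" card] by blast
  have DV: "D \<subset> V" "D \<subseteq> V" and bl: "two_edge_conn D" and dD: "deficit D = 1" and nontriv: "\<nexists>v. D = {v}"
    using PD by (auto simp: P_def)
  have finD: "finite D" using DV finite_V finite_subset by blast
  have small: "all_small D" using all_small_mono[OF small_V DV(2)] .
  have dD1: "1 \<le> deficit D" using dD by simp
  have "D \<noteq> {}" using dD by auto
  note ground = DV(2) bl small dD1
  note expd = expands_deficit[OF DV(2) expands_2[OF bl small]]
  have connector: "\<exists>y\<in>Q. 3 \<le> deficit (Q - {y})" if Q: "Q \<subset> D" "conn Q" "deficit Q = 1" "\<nexists>v. Q = {v}" for Q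
  proof -
    have "\<not> P Q" using min[of Q] psubset_card_mono[OF finD Q(1)] by auto
    then have "\<not> two_edge_conn Q" using Q DV by (auto simp: P_def)
    then obtain Y where Y: "Y \<subset> Q" "Y \<noteq> {}" "\<not> 2 \<le> cut Y (Q - Y)" unfolding two_edge_conn_def by blast
    then have "cut Y (Q - Y) = 1" using conn_subset_cut[OF Q(2) Y(1,2)] by linarith
    moreover have "Q \<subseteq> V" "all_small Q" using Q DV all_small_mono[OF small] by auto
    ultimately show ?thesis using bridge_connector[OF _ Q(2) _ Q(3) Y(1)] by blast
  qed
  obtain b where b: "b \<in> D" "card (nb b \<inter> D) \<le> 2"
    using conn_psubset_low_degree[OF _ conn_V DV(1) \<open>D \<noteq> {}\<close>] by auto
  have "{b} \<subset> D" using b nontriv by auto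
  then have "2 \<le> cut {b} (D - {b})" using bl unfolding two_edge_conn_def by blast
  then have "2 \<le> card (nb b \<inter> (D - {b}))" using cut_commute[of "{b}"] by (simp add: cut_singleton)
  moreover have "nb b \<inter> (D - {b}) = nb b \<inter> D" using nb_irrefl by auto
  ultimately have "card (nb b \<inter> D) = 2" using b by simp
  then obtain p q where pq: "nb b \<inter> D = {p, q}" "p \<noteq> q" by (meson card_2_iff)
  have in_nb: "p \<in> nb b" "q \<in> nb b" "p \<in> D" "q \<in> D" "b \<in> nb p" "b \<in> nb q" using pq nb_sym by blast+
  have bneq: "b \<noteq> p" "b \<noteq> q" using in_nb nb_neq by blast+
  define Q where "Q = D - {b, p, q}"
  have Q: "Q \<subset> D" "Q \<subseteq> V" using b DV by (auto simp: Q_def)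
  have DQ: "D - Q = {b, p, q}" using b in_nb by (auto simp: Q_def)
  have nbbQ: "nb b \<inter> Q = {}" using pq by (auto simp: Q_def)
  have cutQ: "cut X (D - Q) = card (nb p \<inter> X) + card (nb q \<inter> X)" if "X \<subseteq> Q" for X
  proof -
    have "X \<subseteq> V" "nb b \<inter> X = {}" using that Q nbbQ by auto
    then show ?thesis unfolding DQ using pq(2) bneq by (simp add: cut_insert cut_pair)
  qed
  have le2: "card (nb p \<inter> Q) \<le> 2" "card (nb q \<inter> Q) \<le> 2"
    using in_nb by (auto intro!: card_nb_Int_le_2[of b] simp: Q_def)
  have le4: "cut Q (D - Q) \<le> 4" using cutQ[of Q] le2 by simp
  have no_pq: "\<not> (c \<in> nb p \<and> c \<in> nb q)" if "c \<in> Q" for c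
    using common_nb_unique[OF pq(2), of c b] in_nb that by (auto simp: Q_def)
  \<comment> \<open>Deleting \<open>p\<close> and matching \<open>b\<close> with \<open>q\<close>
    loses nothing.\<close>
  have dQ: "1 \<le> deficit Q"
  proof -
    have "deficit D \<le> deficit (D - {p}) + 1" by (rule deficit_remove[OF DV(2)])
    moreover have "deficit (D - {p}) \<le> deficit (D - {p} - {b, q}) - 1"
      by (rule deficit_leaf) (use DV b pq in_nb bneq in auto)
    moreover have "D - {p} - {b, q} = Q" by (auto simp: Q_def)
    ultimately show ?thesis using dD by simp
  qed
  \<comment> \<open>Four leaving edges allow at most 2, and removing three vertices keeps the
    residue modulo 3.\<close>
  have dQ1: "deficit Q = 1"
  proof -
    have "card D = card Q + 3"
    proof -
      have "card {b, p, q} = 3" using bneq pq(2) by simp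
      moreover have "{b, p, q} \<subseteq> D" using b in_nb by auto
      ultimately show ?thesis
        using card_Diff_subset[of "{b, p, q}" D] card_mono[OF finD, of "{b, p, q}"] by (simp add: Q_def)
    qed
    moreover have "2 * deficit Q \<le> 4" using expd[OF Q(1)] le4 by simp
    ultimately show ?thesis using dQ dD deficit_cong_card[of Q] deficit_cong_card[of D] by presburger
  qed
  \<comment> \<open>Such a set is tight, so it contains an isolated vertex attached to both
    \<open>p\<close> and \<open>q\<close>, which forms a 4-cycle with \<open>b\<close>.\<close>
  have small_cut: False if X: "X \<subseteq> Q" "1 \<le> deficit X" "cut X (D - X) \<le> 2" "cut X (Q - X) = 0" for X
  proof -
    have XV: "X \<subset> D" "X \<subseteq> V" using X Q by auto
    have "deficit X \<noteq> 0" using X by simp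
    then have "X \<noteq> {}" by (metis deficit_empty)
    then obtain c where c: "c \<in> X" "nb c \<inter> X = {}" "card (nb c \<inter> D) = 2"
      using tight_single[OF ground XV(1)] X by force
    have "nb c \<inter> (Q - X) = {}" using c X XV cut_eq_0D[of X "Q - X" c] by auto
    moreover have "b \<notin> nb c" using c X nbbQ nb_sym by blast
    ultimately have "nb c \<inter> D \<subseteq> {p, q}" using c by (auto simp: Q_def)
    then have "nb c \<inter> D = {p, q}" using c pq(2) by (intro card_subset_eq) auto
    then have "c \<in> nb p \<and> c \<in> nb q" using nb_sym by blast
    then show False using no_pq c X by blast
  qed
  \<comment> \<open>If \<open>Q\<close> splits, the at most four leaving edges give two to each
    side, and one side has positive deficit.\<close>
  have connQ: "conn Q"
    unfolding conn_def
  proof (intro conjI allI impI notI)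
    assume "Q = {}" then show False using dQ by simp
  next
    fix Y assume Y: "Y \<subset> Q" "Y \<noteq> {}" "cut Y (Q - Y) = 0"
    have "2 \<le> cut H (D - H)" if "H \<subset> Q" "H \<noteq> {}" for H
      using bl that Q unfolding two_edge_conn_def by (meson psubset_trans)
    then have "2 \<le> cut Y (D - Y)" "2 \<le> cut (Q - Y) (D - (Q - Y))" using Y by auto
    moreover have "cut Q (D - Q) = cut Y (D - Y) + cut (Q - Y) (D - (Q - Y))"
      by (rule cut_component) (use Y Q DV in auto)
    ultimately have le: "cut Y (D - Y) \<le> 2" "cut (Q - Y) (D - (Q - Y)) \<le> 2" using le4 by linarith+
    have "deficit Q = deficit Y + deficit (Q - Y)" by (rule deficit_component) (use Y Q in auto)
    then have "1 \<le> deficit Y \<or> 1 \<le> deficit (Q - Y)" using dQ by linarith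
    moreover have "Q - (Q - Y) = Y" using Y by auto
    then have "cut (Q - Y) (Q - (Q - Y)) = 0" using Y(3) cut_commute by simp
    ultimately show False using small_cut[of Y] small_cut[of "Q - Y"] le Y by auto
  qed
  have "Q \<noteq> {v}" for v
  proof
    assume v: "Q = {v}"
    have "2 \<le> cut Q (D - Q)" using bl Q v unfolding two_edge_conn_def by blast
    then have "2 \<le> card (nb p \<inter> {v}) + card (nb q \<inter> {v})" using cutQ[of Q] v by simp
    then have "v \<in> nb p \<and> v \<in> nb q" by (cases "v \<in> nb p"; cases "v \<in> nb q"; simp)
    then show False using no_pq v by blast
  qed
  then obtain y where y: "y \<in> Q" "3 \<le> deficit (Q - {y})" using connector[OF Q(1) connQ dQ1] by blast
  obtain c1 c2 R where c: "c1 \<noteq> c2" "c1 \<notin> R" "c2 \<notin> R" "y \<notin> R" "Q = {y, c1, c2} \<union> R"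
    "nb c1 \<inter> Q = {y}" "nb c2 \<inter> Q = {y}" "card (nb c1 \<inter> (D - Q)) = 1" "card (nb c2 \<inter> (D - Q)) = 1"
    and R: "conn R" "deficit R = 1" "card (nb y \<inter> R) = 1" "cut R (D - Q) + 2 = cut Q (D - Q)"
    "cut R (D - R) = cut R (D - Q) + 1"
    by (rule three_components[OF ground Q(1) connQ y le4])
  have cb: "b \<notin> nb c1" "b \<notin> nb c2" using nbbQ c(5) nb_sym by blast+
  have cy: "c1 \<in> nb y" "c2 \<in> nb y" "y \<in> nb c1" "y \<in> nb c2" using c(6,7) nb_sym by blast+
  have neqy: "c1 \<noteq> y" "c2 \<noteq> y" using cy nb_neq by blast+
  text \<open>\<open>c1\<close> and \<open>c2\<close> attach to different neighbours of \<open>b\<close>, since they already share \<open>y\<close>.\<close>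
  obtain a1 a2 where a: "{a1, a2} = {p, q}" "nb c1 \<inter> (D - Q) = {a1}" "nb c2 \<inter> (D - Q) = {a2}"
  proof -
    obtain a1 where a1: "nb c1 \<inter> (D - Q) = {a1}" using c(8) card_1_singletonE by blast
    obtain a2 where a2: "nb c2 \<inter> (D - Q) = {a2}" using c(9) card_1_singletonE by blast
    have am: "a1 \<in> nb c1" "a2 \<in> nb c2" "a1 \<in> {b, p, q}" "a2 \<in> {b, p, q}" using a1 a2 DQ by blast+
    moreover have "a1 \<noteq> a2"
    proof
      assume "a1 = a2"
      moreover have "a1 \<noteq> y" using y(1) a1 by auto
      ultimately show False
        using common_nb_unique[of a1 y c1 c2] am cy c(1) nb_sym by blast
    qed
    ultimately have "{a1, a2} = {p, q}" using cb by auto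
    then show thesis using that a1 a2 by blast
  qed
  have aneq: "a1 \<noteq> a2" "b \<noteq> a1" "b \<noteq> a2" and amem: "a1 \<in> D - Q" "a2 \<in> D - Q"
    and ab: "b \<in> nb a1" "b \<in> nb a2"
    and ac: "c1 \<in> nb a1" "c2 \<in> nb a2"
    using a pq(2) bneq in_nb DQ nb_sym by (auto simp: doubleton_eq_iff)
  have cutQ': "cut X (D - Q) = card (nb a1 \<inter> X) + card (nb a2 \<inter> X)" if "X \<subseteq> Q" for X
    using cutQ[OF that] a(1) by (auto simp: doubleton_eq_iff)
  have RQ: "R \<subseteq> Q" "R \<subset> D" "R \<subseteq> V" using c(5) Q by auto
  have bR: "b \<notin> R" "b \<notin> Q" using RQ DQ by auto
  have cQ: "c1 \<in> Q" "c2 \<in> Q" using c(5) by auto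
  have "card (nb a1 \<inter> R) \<le> 1" "card (nb a2 \<inter> R) \<le> 1"
  proof -
    have "card (nb x \<inter> R) \<le> 1" if "b \<in> nb x" "v \<in> nb x" "v \<notin> R" "v \<noteq> b" for x v
    proof -
      have "card ((nb x \<inter> R) \<union> {b, v}) \<le> card (nb x)" by (rule card_mono) (use that in auto)
      moreover have "card ((nb x \<inter> R) \<union> {b, v}) = card (nb x \<inter> R) + card {b, v}"
        by (rule card_Un_disjoint) (use that bR in auto)
      ultimately show ?thesis using that(4) card_nb_le[of x] by simp
    qed
    then show "card (nb a1 \<inter> R) \<le> 1" "card (nb a2 \<inter> R) \<le> 1" using ab ac c(2,3) cQ bR by metis+
  qed
  \<comment> \<open>With only one edge, \<open>R\<close> would be a single vertex adjacent to
    \<open>y\<close> and to \<open>a1\<close> or \<open>a2\<close>, closing a 4-cycle through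
    \<open>c1\<close> or \<open>c2\<close>.\<close>
  moreover have "cut R (D - Q) = 2"
  proof (rule ccontr)
    assume "cut R (D - Q) \<noteq> 2"
    then have "cut R (D - Q) \<le> 1" using R(4) le4 by simp
    moreover have "R \<noteq> {}" using R(1) by (simp add: conn_def)
    then have "2 \<le> cut R (D - R)" using bl RQ unfolding two_edge_conn_def by blast
    ultimately have one: "cut R (D - Q) = 1" and "cut R (D - R) = 2" using R(5) by linarith+
    then obtain v where v: "R = {v}" using two_edge_piece_trivial[OF ground RQ(2) R(1,2)] by blast
    have vy: "v \<in> nb y" using R(3) v by (cases "v \<in> nb y") auto
    have "v \<in> nb a1 \<or> v \<in> nb a2" using one cutQ'[OF RQ(1)] v by (cases "v \<in> nb a1"; cases "v \<in> nb a2"; simp)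
    moreover have "a1 \<noteq> y" "a2 \<noteq> y" using y(1) amem by auto
    ultimately show False
      using common_nb_unique[of a1 y c1 v] common_nb_unique[of a2 y c2 v] cy ac vy c(2,3) v by blast
  qed
  ultimately have nbaR: "card (nb a1 \<inter> R) = 1" "card (nb a2 \<inter> R) = 1" using cutQ'[OF RQ(1)] by simp_all
  obtain e1 e2 e3 where e: "nb a1 \<inter> R = {e1}" "nb a2 \<inter> R = {e2}" "nb y \<inter> R = {e3}"
    using nbaR R(3) by (meson card_1_singletonE)
  have emem: "e1 \<in> nb a1" "e2 \<in> nb a2" "e3 \<in> nb y" "e1 \<in> R" "e2 \<in> R" "e3 \<in> R" using e by auto
  have "R \<noteq> {v}" for v
  proof
    assume "R = {v}"
    then have "v \<in> nb a1" "v \<in> nb a2" "v \<noteq> b" using emem bR by auto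
    then show False using common_nb_unique[OF aneq(1), of v b] ab by blast
  qed
  then obtain z where z: "z \<in> R" "3 \<le> deficit (R - {z})" using connector[OF RQ(2) R(1,2)] by blast
  have cutR: "cut R (D - R) = 3" using R(5) \<open>cut R (D - Q) = 2\<close> by simp
  then have "cut R (D - R) \<le> 4" by simp
  then obtain d1 d2 F where d: "d1 \<noteq> d2" "d1 \<notin> F" "d2 \<notin> F" "z \<notin> F" "R = {z, d1, d2} \<union> F"
    "nb d1 \<inter> R = {z}" "nb d2 \<inter> R = {z}" "card (nb d1 \<inter> (D - R)) = 1" "card (nb d2 \<inter> (D - R)) = 1"
    and F: "conn F" "deficit F = 1" "card (nb z \<inter> F) = 1" "cut F (D - R) + 2 = cut R (D - R)"
    "cut F (D - F) = cut F (D - R) + 1"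
    using three_components[OF ground RQ(2) R(1) z] by metis
  \<comment> \<open>Only three edges leave \<open>R\<close> within \<open>D\<close>, so this time
    the third piece is a single vertex too, and \<open>R\<close> is a claw with centre
    \<open>z\<close>.\<close>
  have "cut F (D - F) = 2" using F cutR by simp
  moreover have "F \<subset> D" using d(5) RQ by auto
  ultimately obtain d3 where d3: "F = {d3}" using two_edge_piece_trivial[OF ground _ F(1,2)] by blast
  have Req: "R = {z, d1, d2, d3}" using d(5) d3 by auto
  have zd: "d1 \<in> nb z" "d2 \<in> nb z" using d(6,7) nb_sym by blast+
  have zd3: "d3 \<in> nb z" using F(3) d3 by (cases "d3 \<in> nb z") auto
  have ddist: "distinct [d1, d2, d3]" "z \<notin> {d1, d2, d3}" using d(1-4) d3 zd nb_irrefl by auto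
  have nbz: "nb z = {d1, d2, d3}" by (rule nb_eqI) (use zd zd3 ddist in auto)
  have d3R: "nb d3 \<inter> R = {z}" "card (nb d3 \<inter> (D - R)) = 1"
  proof -
    have "d3 \<in> R" "d3 \<noteq> z" using Req ddist by auto
    then have "d3 \<notin> nb d1" "d3 \<notin> nb d2" using d(6,7) by auto
    then have "d1 \<notin> nb d3" "d2 \<notin> nb d3" "d3 \<notin> nb d3" "z \<in> nb d3"
      using nb_sym[of d1] nb_sym[of d2] nb_sym[of z] zd3 nb_irrefl by simp_all
    then show "nb d3 \<inter> R = {z}" using Req by auto
    show "card (nb d3 \<inter> (D - R)) = 1"
      using F(4) cutR d3 cut_commute[of F] by (simp add: cut_singleton)
  qed
  have nbd: "nb v \<inter> R = {z}" "card (nb v \<inter> (D - R)) = 1" if "v \<in> {d1, d2, d3}" for v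
    using that d d3R by auto
  have D_R: "a1 \<in> D - R" "a2 \<in> D - R" "y \<in> D - R" using amem RQ y Q c(4) by auto
  have "z \<notin> nb a1" "z \<notin> nb a2" "z \<notin> nb y"
    using nbz Req D_R nb_sym[of z] by auto
  then have ed: "e1 \<in> {d1, d2, d3}" "e2 \<in> {d1, d2, d3}" "e3 \<in> {d1, d2, d3}" using emem Req by auto
  have ya: "y \<noteq> a1" "y \<noteq> a2" using y(1) amem by auto
  \<comment> \<open>Each leaf of the claw has one neighbour outside \<open>R\<close>, so the edges
    from \<open>a1\<close>, \<open>a2\<close> and \<open>y\<close> end at different leaves.\<close>
  have inj: "x = x'"
    if v: "v \<in> {d1, d2, d3}" "v \<in> nb x" "v \<in> nb x'" "x \<in> D - R" "x' \<in> D - R" for v x x'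
  proof -
    obtain w where "nb v \<inter> (D - R) = {w}" using nbd(2)[OF v(1)] card_1_singletonE by blast
    moreover have "x \<in> nb v \<inter> (D - R)" "x' \<in> nb v \<inter> (D - R)" using v nb_sym by blast+
    ultimately show ?thesis by auto
  qed
  have edist: "e1 \<noteq> e2" "e1 \<noteq> e3" "e2 \<noteq> e3"
    using inj[OF ed(1), of a1 a2] inj[OF ed(1), of a1 y] inj[OF ed(2), of a2 y] emem D_R aneq ya by auto
  have eset: "{e1, e2, e3} = {d1, d2, d3}"
    using ed edist ddist by auto
  have notR: "b \<notin> R" "c1 \<notin> R" "c2 \<notin> R" "a1 \<notin> R" "a2 \<notin> R" "y \<notin> R" using bR c D_R by auto
  have zR: "z \<in> R" "z \<notin> {e1, e2, e3}" using Req eset ddist by auto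
  have notQ: "a1 \<notin> Q" "a2 \<notin> Q" "b \<notin> Q" using amem bR by auto
  have dist: "distinct [a1, a2, y, z, b, c1, e1, c2, e2, e3]"
    using aneq ya notR notQ cQ y(1) zR emem edist neqy c(1) by auto
  have nbs: "nb a1 = {b, c1, e1}" "nb a2 = {b, c2, e2}" "nb y = {c1, c2, e3}" "nb z = {e1, e2, e3}"
  proof -
    show "nb a1 = {b, c1, e1}" by (rule nb_eqI[OF ab(1) ac(1) emem(1)]) (use dist in simp)
    show "nb a2 = {b, c2, e2}" by (rule nb_eqI[OF ab(2) ac(2) emem(2)]) (use dist in simp)
    show "nb y = {c1, c2, e3}" by (rule nb_eqI[OF cy(1,2) emem(3)]) (use dist in simp)
    show "nb z = {e1, e2, e3}" using nbz eset by simp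
  qed
  have ind: "t \<notin> nb s" if st: "s \<in> {b, c1, e1, c2, e2, e3}" "t \<in> {b, c1, e1, c2, e2, e3}" for s t
  proof -
    have "nb b \<inter> {b, c1, e1, c2, e2, e3} = {}"
      using nbbQ cQ emem RQ nb_irrefl[of b] by auto
    moreover have "nb c1 \<inter> {b, c1, e1, c2, e2, e3} = {}" "nb c2 \<inter> {b, c1, e1, c2, e2, e3} = {}"
      using c(6,7) cb cQ emem RQ neqy notR by auto
    moreover have "nb v \<inter> {b, c1, e1, c2, e2, e3} = {}" if "v \<in> {e1, e2, e3}" for v
    proof -
      have nbvR: "nb v \<inter> R = {z}" using nbd(1) that eset by blast
      have vR: "v \<in> R" using that emem(4-6) by auto
      then have vQ: "v \<in> Q" and vy: "v \<noteq> y" using RQ(1) notR(6) by auto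
      have "v \<notin> nb b" using nbbQ vQ by blast
      moreover have "v \<notin> nb c1" using c(6) vQ vy by blast
      moreover have "v \<notin> nb c2" using c(7) vQ vy by blast
      ultimately have "b \<notin> nb v" "c1 \<notin> nb v" "c2 \<notin> nb v"
        using nb_sym[of v b] nb_sym[of v c1] nb_sym[of v c2] by blast+
      moreover have "x \<notin> nb v" if "x \<in> R" "x \<noteq> z" for x using nbvR that by blast
      moreover have "e1 \<noteq> z" "e2 \<noteq> z" "e3 \<noteq> z" using zR(2) by auto
      ultimately have "e1 \<notin> nb v" "e2 \<notin> nb v" "e3 \<notin> nb v" "b \<notin> nb v" "c1 \<notin> nb v" "c2 \<notin> nb v"
        using emem(4-6) by simp_all
      then show ?thesis by blast
    qed
    ultimately show ?thesis using st by blast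
  qed
  have "{a1, a2, y, z, b, c1, e1, c2, e2, e3} \<subseteq> V"
    using D_R DV y(1) Q zR RQ b cQ emem by auto
  \<comment> \<open>The branch vertices are \<open>a1\<close>, \<open>a2\<close>, \<open>y\<close>,
    \<open>z\<close>; the paths \<open>a1 a2\<close>, \<open>a1 y\<close>, \<open>a1 z\<close>,
    \<open>a2 y\<close>, \<open>a2 z\<close>, \<open>y z\<close> have the midpoints
    \<open>b\<close>, \<open>c1\<close>, \<open>e1\<close>, \<open>c2\<close>, \<open>e2\<close>,
    \<open>e3\<close>.\<close>
  then show thesis using that[of a1 a2 y z b c1 e1 c2 e2 e3] dist nbs ind by blast
qed

end

text \<open>Labellings of the four branch vertices. Quantifying over them expresses the symmetry of
  \<open>K_4\<close>, so each configuration is treated once up to relabelling.\<close>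

definition perm4 :: "nat \<Rightarrow> nat \<Rightarrow> nat \<Rightarrow> nat \<Rightarrow> bool" where
  "perm4 i j k l \<longleftrightarrow> distinct [i, j, k, l] \<and> {i, j, k, l} \<subseteq> {1, 2, 3, 4}"

lemma perm4_swaps:
  assumes "perm4 i j k l"
  shows "perm4 j i k l" "perm4 i k j l" "perm4 i j l k"
  using assms by (auto simp: perm4_def)

section \<open>The surroundings of a subdivided \<open>K\<^sub>4\<close>\<close>

text \<open>The four branch vertices \<open>a i\<close> are joined by the paths \<open>a i, s i j, a j\<close>, and
  \<open>t i j\<close> is the third neighbour of \<open>s i j\<close>.\<close>

locale subdivided_K4 = cubic_deficient +
  fixes a :: "nat \<Rightarrow> 'a" and s t :: "nat \<Rightarrow> nat \<Rightarrow> 'a"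
  assumes s_commute: "s i j = s j i" and t_commute: "t i j = t j i"
    and nb_a: "perm4 i j k l \<Longrightarrow> nb (a i) = {s i j, s i k, s i l}"
    and nb_s: "perm4 i j k l \<Longrightarrow> nb (s i j) = {a i, a j, t i j}"
    and distinct_core:
      "perm4 i j k l \<Longrightarrow> distinct [a i, a j, a k, a l, s i j, s i k, s i l, s j k, s j l, s k l]"
    and t_notin: "perm4 i j k l \<Longrightarrow> t m n \<in> {a i, a j, a k, a l, s i j, s i k, s i l, s j k, s j l, s k l} \<Longrightarrow> False"
    and core_V: "perm4 i j k l \<Longrightarrow> {a i, a j, a k, a l, s i j, s i k, s i l, s j k, s j l, s k l} \<subseteq> V"

context cubic_deficient
begin

lemma third_nb:
  assumes "x \<in> V" "y \<in> nb x" "z \<in> nb x" "y \<noteq> z"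
  obtains w where "nb x = {y, z, w}" "w \<noteq> y" "w \<noteq> z" "w \<in> V"
proof -
  have "card (nb x - {y, z}) = 1"
    using card_Diff_subset[of "{y, z}" "nb x"] cubic[OF assms(1)] assms by simp
  then obtain w where w: "nb x - {y, z} = {w}" using card_1_singletonE by blast
  then have "nb x = {y, z, w}" "w \<noteq> y" "w \<noteq> z" "w \<in> V" using assms nb_subset by blast+
  then show thesis using that by blast
qed

lemma ex_subdivided_K4: "\<exists>a s t. subdivided_K4 V E a s t"
proof -
  obtain a1 a2 a3 a4 s12 s13 s14 s23 s24 s34
  where dist: "distinct [a1, a2, a3, a4, s12, s13, s14, s23, s24, s34]"
    and inV: "{a1, a2, a3, a4, s12, s13, s14, s23, s24, s34} \<subseteq> V"
    and nba: "nb a1 = {s12, s13, s14}" "nb a2 = {s12, s23, s24}" "nb a3 = {s13, s23, s34}" "nb a4 = {s14, s24, s34}"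
    and ind: "\<And>s t. s \<in> {s12, s13, s14, s23, s24, s34} \<Longrightarrow> t \<in> {s12, s13, s14, s23, s24, s34} \<Longrightarrow> t \<notin> nb s"
    by (rule subdivided_K4_exists) blast
  have inc: "a1 \<in> nb s12" "a2 \<in> nb s12" "a1 \<in> nb s13" "a3 \<in> nb s13" "a1 \<in> nb s14" "a4 \<in> nb s14"
    "a2 \<in> nb s23" "a3 \<in> nb s23" "a2 \<in> nb s24" "a4 \<in> nb s24" "a3 \<in> nb s34" "a4 \<in> nb s34"
    by (simp_all add: nb_sym[of a1] nb_sym[of a2] nb_sym[of a3] nb_sym[of a4] nba)
  have sV: "s12 \<in> V" "s13 \<in> V" "s14 \<in> V" "s23 \<in> V" "s24 \<in> V" "s34 \<in> V" using inV by auto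
  have an: "a1 \<noteq> a2" "a1 \<noteq> a3" "a1 \<noteq> a4" "a2 \<noteq> a3" "a2 \<noteq> a4" "a3 \<noteq> a4" using dist by simp_all
  obtain t12 where t12: "nb s12 = {a1, a2, t12}" "t12 \<noteq> a1" "t12 \<noteq> a2" "t12 \<in> V"
    by (rule third_nb[OF sV(1) inc(1,2) an(1)])
  obtain t13 where t13: "nb s13 = {a1, a3, t13}" "t13 \<noteq> a1" "t13 \<noteq> a3" "t13 \<in> V"
    by (rule third_nb[OF sV(2) inc(3,4) an(2)])
  obtain t14 where t14: "nb s14 = {a1, a4, t14}" "t14 \<noteq> a1" "t14 \<noteq> a4" "t14 \<in> V"
    by (rule third_nb[OF sV(3) inc(5,6) an(3)])
  obtain t23 where t23: "nb s23 = {a2, a3, t23}" "t23 \<noteq> a2" "t23 \<noteq> a3" "t23 \<in> V"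
    by (rule third_nb[OF sV(4) inc(7,8) an(4)])
  obtain t24 where t24: "nb s24 = {a2, a4, t24}" "t24 \<noteq> a2" "t24 \<noteq> a4" "t24 \<in> V"
    by (rule third_nb[OF sV(5) inc(9,10) an(5)])
  obtain t34 where t34: "nb s34 = {a3, a4, t34}" "t34 \<noteq> a3" "t34 \<noteq> a4" "t34 \<in> V"
    by (rule third_nb[OF sV(6) inc(11,12) an(6)])
  let ?K = "{a1, a2, a3, a4, s12, s13, s14, s23, s24, s34}"
  have nots: "s12 \<notin> nb a3" "s12 \<notin> nb a4" "s13 \<notin> nb a2" "s13 \<notin> nb a4" "s14 \<notin> nb a2" "s14 \<notin> nb a3"
    "s23 \<notin> nb a1" "s23 \<notin> nb a4" "s24 \<notin> nb a1" "s24 \<notin> nb a3" "s34 \<notin> nb a1" "s34 \<notin> nb a2"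
    unfolding nba using dist by auto
  have notA: "t12 \<notin> {a1, a2, a3, a4}" "t13 \<notin> {a1, a2, a3, a4}" "t14 \<notin> {a1, a2, a3, a4}"
    "t23 \<notin> {a1, a2, a3, a4}" "t24 \<notin> {a1, a2, a3, a4}" "t34 \<notin> {a1, a2, a3, a4}"
  proof -
    have "t12 \<in> nb s12" "t13 \<in> nb s13" "t14 \<in> nb s14" "t23 \<in> nb s23" "t24 \<in> nb s24" "t34 \<in> nb s34"
      using t12 t13 t14 t23 t24 t34 by auto
    then have "s12 \<in> nb t12" "s13 \<in> nb t13" "s14 \<in> nb t14" "s23 \<in> nb t23" "s24 \<in> nb t24" "s34 \<in> nb t34"
      using nb_sym by blast+
    then show "t12 \<notin> {a1, a2, a3, a4}" "t13 \<notin> {a1, a2, a3, a4}" "t14 \<notin> {a1, a2, a3, a4}"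
      "t23 \<notin> {a1, a2, a3, a4}" "t24 \<notin> {a1, a2, a3, a4}" "t34 \<notin> {a1, a2, a3, a4}"
      using nots t12(2,3) t13(2,3) t14(2,3) t23(2,3) t24(2,3) t34(2,3) by blast+
  qed
  have notK: "t12 \<notin> ?K" "t13 \<notin> ?K" "t14 \<notin> ?K" "t23 \<notin> ?K" "t24 \<notin> ?K" "t34 \<notin> ?K"
    using notA ind[of s12 t12] ind[of s13 t13] ind[of s14 t14] ind[of s23 t23] ind[of s24 t24] ind[of s34 t34]
    by (auto simp: t12 t13 t14 t23 t24 t34)
  define a where "a i = (if i = 1 then a1 else if i = 2 then a2 else if i = 3 then a3 else a4)" for i :: nat
  \<comment> \<open>Testing the unordered pair makes \<open>f\<close> symmetric for all indices.
    Indices out of range give \<open>x34\<close>, so every value \<open>t m n\<close> is one of the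
    six outer neighbours, as the locale demands for arbitrary \<open>m\<close> and
    \<open>n\<close>.\<close>
  define f where "f x12 x13 x14 x23 x24 x34 i j = (if {i, j} = {1, 2} then x12 else if {i, j} = {1, 3} then x13
    else if {i, j} = {1, 4} then x14 else if {i, j} = {2, 3} then x23 else if {i, j} = {2, 4} then x24 else x34)"
    for x12 x13 x14 x23 x24 x34 :: 'a and i j :: nat
  define s where "s = f s12 s13 s14 s23 s24 s34"
  define t where "t = f t12 t13 t14 t23 t24 t34"
  have comm: "f x12 x13 x14 x23 x24 x34 i j = f x12 x13 x14 x23 x24 x34 j i" for x12 x13 x14 x23 x24 x34 i j
    unfolding f_def by (simp add: insert_commute)
  have av: "a 1 = a1" "a 2 = a2" "a 3 = a3" "a 4 = a4" by (auto simp: a_def)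
  have fv: "f x12 x13 x14 x23 x24 x34 1 2 = x12" "f x12 x13 x14 x23 x24 x34 1 3 = x13" "f x12 x13 x14 x23 x24 x34 1 4 = x14"
    "f x12 x13 x14 x23 x24 x34 2 3 = x23" "f x12 x13 x14 x23 x24 x34 2 4 = x24" "f x12 x13 x14 x23 x24 x34 3 4 = x34"
    for x12 x13 x14 x23 x24 x34 by (auto simp: f_def doubleton_eq_iff)
  have fv': "f x12 x13 x14 x23 x24 x34 2 1 = x12" "f x12 x13 x14 x23 x24 x34 3 1 = x13" "f x12 x13 x14 x23 x24 x34 4 1 = x14"
    "f x12 x13 x14 x23 x24 x34 3 2 = x23" "f x12 x13 x14 x23 x24 x34 4 2 = x24" "f x12 x13 x14 x23 x24 x34 4 3 = x34"
    for x12 x13 x14 x23 x24 x34 by (auto simp: f_def doubleton_eq_iff)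
  note vals = av s_def t_def fv fv'
  let ?I = "{1, 2, 3, 4} :: nat set"
  have tval: "t i j \<in> {t12, t13, t14, t23, t24, t34}" for i j by (simp add: t_def f_def)
  have sc: "s i j = s j i" "t i j = t j i" for i j unfolding s_def t_def by (rule comm)+
  have I: "{i, j, k, l} = ?I" if "perm4 i j k l" for i j k l
    by (rule card_subset_eq) (use that in \<open>auto simp: perm4_def\<close>)
  have spaths: "(\<Union>x\<in>{i, j, k, l}. s x ` ({i, j, k, l} - {x})) = {s i j, s i k, s i l, s j k, s j l, s k l}"
    if "perm4 i j k l" for i j k l
  proof -
    have "{i, j, k, l} - {i} = {j, k, l}" "{i, j, k, l} - {j} = {i, k, l}"
      "{i, j, k, l} - {k} = {i, j, l}" "{i, j, k, l} - {l} = {i, j, k}"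
      using that by (auto simp: perm4_def)
    then show ?thesis using sc(1)[of j i] sc(1)[of k i] sc(1)[of l i] sc(1)[of k j] sc(1)[of l j] sc(1)[of l k]
      by auto
  qed
  have p1: "perm4 1 2 3 4" by (simp add: perm4_def)
  \<comment> \<open>Writing the ten vertices as images of the index set makes invariance under
    relabelling immediate, without 24 cases.\<close>
  have core: "{a i, a j, a k, a l, s i j, s i k, s i l, s j k, s j l, s k l} = ?K" if p: "perm4 i j k l" for i j k l
  proof -
    have "{a i, a j, a k, a l, s i j, s i k, s i l, s j k, s j l, s k l} =
      a ` {i, j, k, l} \<union> (\<Union>x\<in>{i, j, k, l}. s x ` ({i, j, k, l} - {x}))"
      unfolding spaths[OF p] by auto
    also have "\<dots> = a ` ?I \<union> (\<Union>x\<in>?I. s x ` (?I - {x}))" unfolding I[OF p] ..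
    also have "\<dots> = ?K" unfolding spaths[OF p1] by (simp add: vals del: One_nat_def) blast
    finally show ?thesis .
  qed
  have nbI: "nb (a i) = s i ` (?I - {i})" if "i \<in> ?I" for i
    using that by (elim insertE emptyE) (simp_all add: vals nba insert_Diff_if del: One_nat_def)
  have nbsI: "nb (s i j) = {a i, a j, t i j}" if "i \<in> ?I" "j \<in> ?I" "i \<noteq> j" for i j
    using that by (elim insertE emptyE) (simp_all add: vals t12 t13 t14 t23 t24 t34 insert_commute del: One_nat_def)
  have dist': "card ?K = 10" using distinct_card[OF dist] by simp
  have "subdivided_K4 V E a s t"
  proof unfold_locales
    show "s i j = s j i" "t i j = t j i" for i j by (rule sc)+
    fix i j k l assume p: "perm4 i j k l"
    have mem: "i \<in> ?I" "j \<in> ?I" "i \<noteq> j" using p by (auto simp: perm4_def)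
    have "{i, j, k, l} - {i} = {j, k, l}" using p by (auto simp: perm4_def)
    then show "nb (a i) = {s i j, s i k, s i l}"
      using nbI[OF mem(1)] unfolding I[OF p, symmetric] by simp
    show "nb (s i j) = {a i, a j, t i j}" by (rule nbsI[OF mem])
    show "distinct [a i, a j, a k, a l, s i j, s i k, s i l, s j k, s j l, s k l]"
    proof (rule card_distinct)
      show "card (set [a i, a j, a k, a l, s i j, s i k, s i l, s j k, s j l, s k l])
        = length [a i, a j, a k, a l, s i j, s i k, s i l, s j k, s j l, s k l]"
        unfolding list.set core[OF p] dist' by simp
    qed
    show "{a i, a j, a k, a l, s i j, s i k, s i l, s j k, s j l, s k l} \<subseteq> V"
      unfolding core[OF p] by (rule inV)
    show False if "t m n \<in> {a i, a j, a k, a l, s i j, s i k, s i l, s j k, s j l, s k l}" for m n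
    proof -
      have "t m n \<in> ?K" using that unfolding core[OF p] .
      then show False using tval[of m n] notK by (elim insertE[of "t m n" t12] insertE[of "t m n" t13]
          insertE[of "t m n" t14] insertE[of "t m n" t23] insertE[of "t m n" t24] insertE[of "t m n" t34] emptyE)
        (simp_all only:)
    qed
  qed
  then show ?thesis by blast
qed

end

section \<open>Certificates for lower bounds: successive matching of leaves\<close>

context subcubic_girth5
begin

text \<open>A certificate for repeated leaf matching: \<open>R\<close> collects the vertices already
  gone, and each \<open>u\<close> in turn has at most its partner \<open>v\<close> left as a
  neighbour.\<close>

fun peelable :: "'a set \<Rightarrow> ('a \<times> 'a) list \<Rightarrow> bool" where
  "peelable R [] \<longleftrightarrow> True"
| "peelable R ((u, v) # ps) \<longleftrightarrow> v \<in> nb u \<and> u \<notin> R \<and> v \<notin> R \<and> nb u \<subseteq> insert v R \<and>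
     peelable (insert u (insert v R)) ps"

fun ends :: "('a \<times> 'a) list \<Rightarrow> 'a set" where
  "ends [] = {}"
| "ends ((u, v) # ps) = insert u (insert v (ends ps))"

lemma deficit_peel_aux:
  "peelable R ps \<Longrightarrow> deficit (V - R) \<le> deficit (V - (R \<union> ends ps)) - int (length ps)"
proof (induction ps arbitrary: R)
  case (Cons p ps)
  obtain u v where p: "p = (u, v)" by (cases p)
  have h: "v \<in> nb u" "u \<notin> R" "v \<notin> R" "nb u \<subseteq> insert v R" "peelable (insert u (insert v R)) ps"
    using Cons.prems p by auto
  have "deficit (V - R) \<le> deficit (V - R - {u, v}) - 1"
  proof (rule deficit_leaf)
    show "u \<in> V - R" "v \<in> V - R" using h nb_subset nb_sym by blast+
  qed (use h in auto)
  moreover have "V - R - {u, v} = V - insert u (insert v R)" by auto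
  moreover have "insert u (insert v R) \<union> ends ps = R \<union> ends (p # ps)" using p by auto
  ultimately show ?case using Cons.IH[OF h(5)] by simp
qed simp

text \<open>Every vertex deleted in advance costs 1 and every leaf edge gains 1. All later deficit
  estimates are instances with explicit \<open>R\<close> and \<open>ps\<close>.\<close>

lemma deficit_peel:
  assumes "R \<subseteq> V" "peelable R ps"
  shows "deficit V \<le> deficit (V - (R \<union> ends ps)) + int (card R) - int (length ps)"
proof -
  have "V \<inter> R = R" using assms by auto
  then have "deficit V \<le> deficit (V - R) + int (card R)" using deficit_Diff[of V R] by simp
  then show ?thesis using deficit_peel_aux[OF assms(2)] by simp
qed

lemma cut_sum: "finite Q \<Longrightarrow> P \<subseteq> V \<Longrightarrow> cut P Q = (\<Sum>q\<in>Q. card (nb q \<inter> P))"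
  by (induction Q rule: finite_induct) (simp_all add: cut_insert)

end

section \<open>Counting edges between the outer neighbours and the remaining vertices\<close>

context subdivided_K4
begin

lemma t_V: "perm4 i j k l \<Longrightarrow> t i j \<in> V"
  using nb_s nb_subset by blast

lemma s_nb_t: "perm4 i j k l \<Longrightarrow> s i j \<in> nb (t i j)"
  using nb_s[of i j k l] nb_sym[of "s i j"] by simp

text \<open>A common outer neighbour of two midpoints at \<open>a i\<close> would close a 4-cycle
  through \<open>a i\<close>; so only opposite paths can share one.\<close>

lemma t_adjacent_neq:
  assumes p: "perm4 i j k l"
  shows "t i j \<noteq> t i k"
proof
  assume eq: "t i j = t i k"
  have "nb (a i) = {s i j, s i k, s i l}" by (rule nb_a[OF p])
  then have "s i j \<in> nb (a i)" "s i k \<in> nb (a i)" by auto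
  moreover have "s i j \<in> nb (t i j)" "s i k \<in> nb (t i j)"
    using s_nb_t[OF p] s_nb_t[OF perm4_swaps(2)[OF p]] eq by auto
  moreover have "a i \<noteq> t i j" using t_notin[OF p, of i j] by auto
  moreover have "s i j \<noteq> s i k" using distinct_core[OF p] by simp
  ultimately show False using common_nb_unique by metis
qed

lemma perm4_all:
  assumes "perm4 i j k l"
  shows "perm4 i j k l" "perm4 i k j l" "perm4 i l j k" "perm4 j k i l" "perm4 j l i k" "perm4 k l i j"
    "perm4 j i k l" "perm4 k i j l" "perm4 l i j k"
    "perm4 k j i l" "perm4 l j i k" "perm4 l k i j"
  using assms by (auto simp: perm4_def)

lemma nb_core_eqs:
  assumes p: "perm4 i j k l"
  shows "nb (a i) = {s i j, s i k, s i l}" "nb (a j) = {s i j, s j k, s j l}"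
    "nb (a k) = {s i k, s j k, s k l}" "nb (a l) = {s i l, s j l, s k l}"
    "nb (s i j) = {a i, a j, t i j}" "nb (s i k) = {a i, a k, t i k}" "nb (s i l) = {a i, a l, t i l}"
    "nb (s j k) = {a j, a k, t j k}" "nb (s j l) = {a j, a l, t j l}" "nb (s k l) = {a k, a l, t k l}"
  using nb_a[OF perm4_all(1)[OF p]] nb_a[OF perm4_all(7)[OF p]] nb_a[OF perm4_all(8)[OF p]] nb_a[OF perm4_all(9)[OF p]]
    nb_s[OF perm4_all(1)[OF p]] nb_s[OF perm4_all(2)[OF p]] nb_s[OF perm4_all(3)[OF p]]
    nb_s[OF perm4_all(4)[OF p]] nb_s[OF perm4_all(5)[OF p]] nb_s[OF perm4_all(6)[OF p]]
    s_commute[of j i] s_commute[of k i] s_commute[of l i] s_commute[of k j] s_commute[of l j] s_commute[of l k]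
  by auto

lemma t_neqs:
  assumes p: "perm4 i j k l"
  shows "t i j \<noteq> t i k" "t i j \<noteq> t i l" "t i j \<noteq> t j k" "t i j \<noteq> t j l"
    "t i k \<noteq> t i l" "t i k \<noteq> t j k" "t i k \<noteq> t k l" "t i l \<noteq> t j l" "t i l \<noteq> t k l"
    "t j k \<noteq> t j l" "t j k \<noteq> t k l" "t j l \<noteq> t k l"
proof -
  have n: "t x y \<noteq> t x z" if "{x, y, z, w} = {i, j, k, l}" "distinct [x, y, z, w]" for x y z w
  proof (rule t_adjacent_neq)
    show "perm4 x y z w" using p that unfolding perm4_def by metis
  qed
  have d: "distinct [i, j, k, l]" using p by (simp add: perm4_def)
  show "t i j \<noteq> t i k" using n[of i j k l] d t_commute[of i j] t_commute[of i k] by auto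
  show "t i j \<noteq> t i l" using n[of i j l k] d t_commute[of i j] t_commute[of i l] by auto
  show "t i j \<noteq> t j k" using n[of j i k l] d t_commute[of i j] t_commute[of j k] by auto
  show "t i j \<noteq> t j l" using n[of j i l k] d t_commute[of i j] t_commute[of j l] by auto
  show "t i k \<noteq> t i l" using n[of i k l j] d t_commute[of i k] t_commute[of i l] by auto
  show "t i k \<noteq> t j k" using n[of k i j l] d t_commute[of i k] t_commute[of j k] by auto
  show "t i k \<noteq> t k l" using n[of k i l j] d t_commute[of i k] t_commute[of k l] by auto
  show "t i l \<noteq> t j l" using n[of l i j k] d t_commute[of i l] t_commute[of j l] by auto
  show "t i l \<noteq> t k l" using n[of l i k j] d t_commute[of i l] t_commute[of k l] by auto
  show "t j k \<noteq> t j l" using n[of j k l i] d t_commute[of j k] t_commute[of j l] by auto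
  show "t j k \<noteq> t k l" using n[of k j l i] d t_commute[of j k] t_commute[of k l] by auto
  show "t j l \<noteq> t k l" using n[of l j k i] d t_commute[of j l] t_commute[of k l] by auto
qed

definition core :: "nat \<Rightarrow> nat \<Rightarrow> nat \<Rightarrow> nat \<Rightarrow> 'a set" where
  "core i j k l = {a i, a j, a k, a l, s i j, s i k, s i l, s j k, s j l, s k l}"

definition rim :: "nat \<Rightarrow> nat \<Rightarrow> nat \<Rightarrow> nat \<Rightarrow> 'a set" where
  "rim i j k l = {t i j, t i k, t i l, t j k, t j l, t k l}"

definition rest :: "nat \<Rightarrow> nat \<Rightarrow> nat \<Rightarrow> nat \<Rightarrow> 'a set" where
  "rest i j k l = V - (core i j k l \<union> rim i j k l)"

lemma t_notin_core: "perm4 i j k l \<Longrightarrow> t m n \<notin> core i j k l"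
  using t_notin unfolding core_def by blast

lemma rim_V: "perm4 i j k l \<Longrightarrow> rim i j k l \<subseteq> V"
  using perm4_all t_V unfolding rim_def by (metis empty_subsetI insert_subset)

lemma nb_core:
  assumes "perm4 i j k l" "v \<in> core i j k l"
  shows "nb v \<subseteq> core i j k l \<union> rim i j k l"
  using assms(2) unfolding core_def rim_def by (elim insertE emptyE) (simp_all add: nb_core_eqs[OF assms(1)])

text \<open>All neighbours of the core lie in the core or the rim, so edges leaving the rest end in
  the rim.\<close>

lemma cut_rest:
  assumes p: "perm4 i j k l"
  shows "cut (rest i j k l) (V - rest i j k l) = (\<Sum>v\<in>rim i j k l. card (nb v \<inter> rest i j k l))"
proof -
  let ?U = "rest i j k l"
  have U: "?U \<subseteq> V" by (auto simp: rest_def)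
  have "core i j k l \<subseteq> V" using core_V[OF p] by (simp add: core_def)
  then have "V - ?U = core i j k l \<union> rim i j k l" using rim_V[OF p] by (auto simp: rest_def)
  moreover have "core i j k l \<inter> rim i j k l = {}" using t_notin_core[OF p] by (auto simp: rim_def)
  moreover have "cut (core i j k l) ?U = 0"
    by (rule cut_eq_0I) (use nb_core[OF p] in \<open>auto simp: rest_def\<close>)
  ultimately have "cut ?U (V - ?U) = cut ?U (rim i j k l)"
    using cut_Un_right[OF U] cut_commute[of ?U "core i j k l"] by simp
  also have "\<dots> = (\<Sum>v\<in>rim i j k l. card (nb v \<inter> ?U))"
    by (rule cut_sum[OF _ U]) (simp add: rim_def)
  finally show ?thesis .
qed

lemma s_notin_rest:
  assumes "perm4 i j k l"
  shows "s i j \<notin> rest i j k l" "s i k \<notin> rest i j k l" "s i l \<notin> rest i j k l"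
    "s j k \<notin> rest i j k l" "s j l \<notin> rest i j k l" "s k l \<notin> rest i j k l"
  by (auto simp: rest_def core_def)

lemma s_nb_ts:
  assumes p: "perm4 i j k l"
  shows "s i j \<in> nb (t i j)" "s i k \<in> nb (t i k)" "s i l \<in> nb (t i l)"
    "s j k \<in> nb (t j k)" "s j l \<in> nb (t j l)" "s k l \<in> nb (t k l)"
  using s_nb_t perm4_all[OF p] by blast+

lemma card_t_rest:
  assumes p: "perm4 i j k l" and v: "v \<in> rim i j k l"
  shows "card (nb v \<inter> rest i j k l) \<le> 2"
proof -
  note le = card_nb_Int_le_2[where X = "rest i j k l"]
  note n = s_nb_ts[OF p] and r = s_notin_rest[OF p]
  show ?thesis
    using v le[OF n(1) r(1)] le[OF n(2) r(2)] le[OF n(3) r(3)] le[OF n(4) r(4)] le[OF n(5) r(5)]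
      le[OF n(6) r(6)]
    unfolding rim_def by blast
qed

lemma card_nb_Int_le_1:
  assumes "x \<in> nb v" "y \<in> nb v" "x \<noteq> y" "x \<notin> X" "y \<notin> X"
  shows "card (nb v \<inter> X) \<le> 1"
proof -
  have "card ((nb v \<inter> X) \<union> {x, y}) \<le> card (nb v)" by (rule card_mono) (use assms in auto)
  moreover have "card ((nb v \<inter> X) \<union> {x, y}) = card (nb v \<inter> X) + card {x, y}"
    by (rule card_Un_disjoint) (use assms in auto)
  ultimately show ?thesis using assms(3) card_nb_le[of v] by simp
qed

lemma card_t_coincident:
  assumes p: "perm4 i j k l" and eq: "t i j = t k l"
  shows "card (nb (t i j) \<inter> rest i j k l) \<le> 1"
proof (rule card_nb_Int_le_1)
  show "s i j \<noteq> s k l" using distinct_core[OF p] by simp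
qed (use s_nb_ts[OF p] s_notin_rest[OF p] eq in auto)

lemma rest_psubset: "perm4 i j k l \<Longrightarrow> rest i j k l \<subset> V"
  using core_V[of i j k l] by (auto simp: rest_def core_def)

lemma core_neqs:
  assumes p: "perm4 i j k l"
  shows "t m n \<noteq> a i" "t m n \<noteq> a j" "t m n \<noteq> a k" "t m n \<noteq> a l"
    "t m n \<noteq> s i j" "t m n \<noteq> s i k" "t m n \<noteq> s i l" "t m n \<noteq> s j k" "t m n \<noteq> s j l" "t m n \<noteq> s k l"
  using t_notin_core[OF p, of m n] by (auto simp: core_def)

text \<open>Six leaf edges are gained for three or four deleted vertices, depending on whether
  \<open>t k l\<close> equals \<open>t i j\<close>; the rest then has deficit at least 5 or
  4.\<close>

lemma deficit_rest_if_few_coincidences: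
  assumes p: "perm4 i j k l" and ne: "t i k \<noteq> t j l" "t i l \<noteq> t j k"
  shows "2 \<le> deficit (rest i j k l) + int (card ({a l, t i l, t j l} \<union> ({t k l} - {t i j}))) - 6"
proof -
  let ?R = "{a l, t i l, t j l} \<union> ({t k l} - {t i j})"
  \<comment> \<open>The order matters: \<open>t i j\<close> is gone before \<open>s k l\<close> is
    matched, so \<open>s k l\<close> is a leaf also when \<open>t k l = t i j\<close> and
    \<open>t k l\<close> is not deleted in advance.\<close>
  let ?ps = "[(s i l, a i), (s j l, a j), (s i j, t i j), (s k l, a k), (s i k, t i k), (s j k, t j k)]"
  note D = distinct_core[OF p] t_neqs[OF p] t_neqs[OF p, symmetric] core_neqs[OF p] core_neqs[OF p, symmetric] ne ne[symmetric]
  have pe: "peelable ?R ?ps"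
    using D by (auto simp: nb_core_eqs[OF p])
  have RV: "?R \<subseteq> V" using core_V[OF p] t_V perm4_all[OF p] by auto
  have "?R \<union> ends ?ps = core i j k l \<union> rim i j k l" by (auto simp: core_def rim_def)
  then show ?thesis using deficit_peel[OF RV pe] deficient by (simp add: rest_def)
qed

text \<open>Each coincidence removes a vertex but keeps the number of matched edges, so the deficit of
  the rest becomes too large for the few edges that lead to it.\<close>

lemma no_single_coincidence:
  assumes p: "perm4 i j k l" and eq: "t i j = t k l" and ne: "t i k \<noteq> t j l" "t i l \<noteq> t j k"
  shows False
proof -
  let ?U = "rest i j k l"
  have rim: "rim i j k l = {t i j, t i k, t i l, t j k, t j l}" using eq by (auto simp: rim_def)
  have "card ({a l, t i l, t j l} \<union> ({t k l} - {t i j})) = 3"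
    using t_neqs[OF p] core_neqs(4)[OF p, symmetric] eq by auto
  then have "5 \<le> deficit ?U" using deficit_rest_if_few_coincidences[OF p ne] by simp
  moreover have "cut ?U (V - ?U) \<le> 9"
  proof -
    have "cut ?U (V - ?U) = card (nb (t i j) \<inter> ?U) + card (nb (t i k) \<inter> ?U) + card (nb (t i l) \<inter> ?U)
      + card (nb (t j k) \<inter> ?U) + card (nb (t j l) \<inter> ?U)"
      unfolding cut_rest[OF p] rim using t_neqs[OF p] ne ne(1)[symmetric] ne(2)[symmetric] by simp
    moreover have "card (nb (t i k) \<inter> ?U) \<le> 2" "card (nb (t i l) \<inter> ?U) \<le> 2"
      "card (nb (t j k) \<inter> ?U) \<le> 2" "card (nb (t j l) \<inter> ?U) \<le> 2"
      by (rule card_t_rest[OF p]; simp add: rim_def)+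
    ultimately show ?thesis using card_t_coincident[OF p eq] by simp
  qed
  \<comment> \<open>Deficit 5 needs 15 edges, but at most 1 + 4 * 2 = 9 lead to the rest.\<close>
  ultimately show False using deficit_cut[OF rest_psubset[OF p]] by linarith
qed

lemma rest_swap:
  assumes "perm4 i j k l"
  shows "rest i l j k = rest i j k l" "rest i k j l = rest i j k l"
  using s_commute t_commute by (auto simp: rest_def core_def rim_def)

text \<open>Four deletions and five leaf edges leave deficit at least 3, which needs nine edges; the
  two shared and two unshared rim vertices provide at most 1 + 1 + 2 + 2.\<close>

lemma no_double_coincidence:
  assumes p: "perm4 i j k l" and eq: "t i j = t k l" "t i l = t j k" and ne: "t i k \<noteq> t j l"
  shows False
proof -
  let ?U = "rest i j k l"
  have rim: "rim i j k l = {t i j, t i l, t i k, t j l}" using eq by (auto simp: rim_def)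
  let ?R = "{a l, t i j, t i l, s i l}"
  let ?ps = "[(s k l, a k), (s j k, a j), (s i j, a i), (s i k, t i k), (s j l, t j l)]"
  note D = distinct_core[OF p] t_neqs[OF p] t_neqs[OF p, symmetric] core_neqs[OF p] core_neqs[OF p, symmetric]
    ne ne[symmetric]
  have pe: "peelable ?R ?ps"
    using D by (auto simp: nb_core_eqs[OF p] eq)
  have RV: "?R \<subseteq> V" using core_V[OF p] t_V perm4_all[OF p] by auto
  have "?R \<union> ends ?ps = core i j k l \<union> rim i j k l" unfolding rim by (auto simp: core_def)
  moreover have "card ?R = 4" using D by auto
  ultimately have "3 \<le> deficit ?U" using deficit_peel[OF RV pe] deficient by (simp add: rest_def)
  moreover have "cut ?U (V - ?U) \<le> 6"
  proof -
    have "cut ?U (V - ?U) = card (nb (t i j) \<inter> ?U) + card (nb (t i l) \<inter> ?U) + card (nb (t i k) \<inter> ?U)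
      + card (nb (t j l) \<inter> ?U)"
      unfolding cut_rest[OF p] rim using D by simp
    moreover have "card (nb (t i k) \<inter> ?U) \<le> 2" "card (nb (t j l) \<inter> ?U) \<le> 2"
      by (rule card_t_rest[OF p]; simp add: rim_def)+
    moreover have "card (nb (t i l) \<inter> ?U) \<le> 1"
      using card_t_coincident[OF perm4_all(3)[OF p]] eq(2) rest_swap(1)[OF p] by simp
    ultimately show ?thesis using card_t_coincident[OF p eq(1)] by simp
  qed
  ultimately show False using deficit_cut[OF rest_psubset[OF p]] by linarith
qed

text \<open>Five deletions and four leaf edges leave deficit at least 1, and three shared rim
  vertices send at most three edges; equality makes the rest a single vertex.\<close>

lemma triple_coincidence:
  assumes p: "perm4 i j k l" and eq: "t i j = t k l" "t i l = t j k" "t i k = t j l"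
  shows "\<exists>x. rest i j k l = {x} \<and> nb x = {t i j, t i k, t i l}"
proof -
  let ?U = "rest i j k l"
  have rim: "rim i j k l = {t i j, t i k, t i l}" using eq by (auto simp: rim_def)
  let ?R = "{a k, s k l, s j l, t i l, t i k}"
  let ?ps = "[(s i k, a i), (s j k, a j), (s i j, t i j), (a l, s i l)]"
  note D = distinct_core[OF p] t_neqs[OF p] t_neqs[OF p, symmetric] core_neqs[OF p] core_neqs[OF p, symmetric]
  have pe: "peelable ?R ?ps"
    using D by (auto simp: nb_core_eqs[OF p] eq)
  have RV: "?R \<subseteq> V" using core_V[OF p] t_V perm4_all[OF p] by auto
  have "?R \<union> ends ?ps = core i j k l \<union> rim i j k l" unfolding rim by (auto simp: core_def)
  moreover have "card ?R = 5" using D by auto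
  ultimately have d: "1 \<le> deficit ?U" using deficit_peel[OF RV pe] deficient by (simp add: rest_def)
  have "cut ?U (V - ?U) = card (nb (t i j) \<inter> ?U) + card (nb (t i k) \<inter> ?U) + card (nb (t i l) \<inter> ?U)"
    unfolding cut_rest[OF p] rim using D by simp
  moreover have "card (nb (t i l) \<inter> ?U) \<le> 1"
    using card_t_coincident[OF perm4_all(3)[OF p]] eq(2) rest_swap(1)[OF p] by simp
  moreover have "card (nb (t i k) \<inter> ?U) \<le> 1"
    using card_t_coincident[OF perm4_all(2)[OF p]] eq(3) rest_swap(2)[OF p] by simp
  ultimately have "cut ?U (V - ?U) \<le> 3" using card_t_coincident[OF p eq(1)] by simp
  then have c: "cut ?U (V - ?U) = 3" "deficit ?U = 1"
    using d deficit_cut[OF rest_psubset[OF p]] by linarith+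
  have "?U \<noteq> {}" using d by auto
  have in_c: "a i \<in> V - ?U" "a j \<in> V - ?U" using core_V[OF p] by (auto simp: rest_def core_def)
  moreover have "a i \<noteq> a j" using D by simp
  ultimately have "\<nexists>v. V - ?U = {v}" by (metis singletonD)
  then obtain x where x: "?U = {x}"
    using three_edge_piece_trivial[OF rest_psubset[OF p] \<open>?U \<noteq> {}\<close> c(2,1)] by blast
  have "nb x \<subseteq> {t i j, t i k, t i l}"
  proof
    fix v assume v: "v \<in> nb x"
    then have "v \<in> V" "v \<noteq> x" using nb_subset nb_irrefl by auto
    then have "v \<in> core i j k l \<union> rim i j k l" using x by (auto simp: rest_def)
    moreover have "v \<notin> core i j k l"
    proof
      assume "v \<in> core i j k l"
      then have "x \<in> core i j k l \<union> rim i j k l" using nb_core[OF p] v nb_sym by blast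
      then show False using x by (auto simp: rest_def)
    qed
    ultimately show "v \<in> {t i j, t i k, t i l}" using rim by simp
  qed
  moreover have "x \<in> V" using x by (auto simp: rest_def)
  then have "card (nb x) = 3" by (rule cubic)
  moreover have "card {t i j, t i k, t i l} = 3" using t_neqs[OF p] by simp
  ultimately have "nb x = {t i j, t i k, t i l}" by (intro card_subset_eq) auto
  then show ?thesis using x by blast
qed

text \<open>The rest has deficit at least 4, and at most 6 * 2 = 12 edges lead to it, so equality
  holds throughout and all its components are single vertices. Four vertices of degree 3 face six
  rim vertices with two neighbours each: the second subdivided \<open>K_4\<close>, with the rim as
  its midpoints.\<close>

lemma no_coincidence_rest:
  assumes p: "perm4 i j k l" and ne: "t i j \<noteq> t k l" "t i k \<noteq> t j l" "t i l \<noteq> t j k"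
  shows "v \<in> rest i j k l \<Longrightarrow> nb v \<subseteq> rim i j k l"
    and "card (rest i j k l) = 4"
    and "v \<in> rim i j k l \<Longrightarrow> card (nb v \<inter> rest i j k l) = 2"
proof -
  let ?U = "rest i j k l"
  let ?O = "rim i j k l"
  note D = t_neqs[OF p] t_neqs[OF p, symmetric] ne ne[symmetric] core_neqs(4)[OF p, symmetric] core_neqs(4)[OF p]
  have UV: "?U \<subseteq> V" "?U \<subset> V" using rest_psubset[OF p] by auto
  have "card ({a l, t i l, t j l} \<union> ({t k l} - {t i j})) = 4" using D by auto
  then have d: "4 \<le> deficit ?U" using deficit_rest_if_few_coincidences[OF p ne(2,3)] by simp
  have fin: "finite ?O" by (simp add: rim_def)
  have "card ?O = 6" using D by (simp add: rim_def)
  moreover have "(\<Sum>v\<in>?O. card (nb v \<inter> ?U)) \<le> (\<Sum>v\<in>?O. 2)"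
    by (rule sum_mono) (rule card_t_rest[OF p])
  ultimately have "cut ?U (V - ?U) \<le> 12" unfolding cut_rest[OF p] by simp
  then have c12: "cut ?U (V - ?U) = 12" and d4: "deficit ?U = 4"
    using d deficit_cut[OF UV(2)] by linarith+
  show two: "card (nb v \<inter> ?U) = 2" if "v \<in> ?O" for v
  proof (rule ccontr)
    assume "card (nb v \<inter> ?U) \<noteq> 2"
    then have "card (nb v \<inter> ?U) < 2" using card_t_rest[OF p that] by simp
    then have "(\<Sum>v\<in>?O. card (nb v \<inter> ?U)) < (\<Sum>v\<in>?O. 2)"
      using that fin card_t_rest[OF p] by (intro sum_strict_mono_ex1) auto
    then show False using c12 \<open>card ?O = 6\<close> unfolding cut_rest[OF p] by simp
  qed
  have "a i \<in> V - ?U" "a j \<in> V - ?U" "a i \<noteq> a j"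
    using core_V[OF p] distinct_core[OF p] by (auto simp: rest_def core_def)
  note big = this
  have single: "nb v \<inter> ?U = {}" if v: "v \<in> ?U" for v
  proof -
    obtain C where C: "v \<in> C" "C \<subseteq> ?U" "conn C" "cut C (?U - C) = 0"
      by (rule component_exists[OF v UV(1)])
    have CV: "C \<subset> V" "C \<noteq> {}" "C \<subseteq> V" using C UV by auto
    have "int (cut C (V - C)) = 3 * deficit C"
      by (rule expands_tight[OF order_refl expands_3 UV(2) C(2,4)]) (use c12 d4 in simp)
    moreover have "2 \<le> cut C (V - C)" using bridgeless_V CV by (simp add: two_edge_conn_def)
    moreover have "deficit C \<le> 1" using small_V C CV by (simp add: all_small_def)
    ultimately have d1: "deficit C = 1" and "int (cut C (V - C)) = 3 * deficit C" by presburger+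
    then have "cut C (V - C) = 3" by simp
    moreover have "\<nexists>w. V - C = {w}"
    proof
      assume "\<exists>w. V - C = {w}"
      then obtain w where "V - C = {w}" by blast
      moreover have "a i \<in> V - C" "a j \<in> V - C" using big C(2) by auto
      ultimately show False using big(3) by (metis singletonD)
    qed
    ultimately have "C = {v}" using three_edge_piece_trivial[OF CV(1,2) d1] C(1) by blast
    then show ?thesis using C(4) cut_eq_0_iff[OF CV(3)] nb_irrefl by auto
  qed
  show nbU: "nb v \<subseteq> ?O" if v: "v \<in> ?U" for v
  proof
    fix w assume w: "w \<in> nb v"
    then have "w \<in> core i j k l \<union> ?O" using single[OF v] nb_subset by (auto simp: rest_def)
    moreover have "w \<notin> core i j k l"
    proof
      assume "w \<in> core i j k l"
      then have "v \<in> core i j k l \<union> rim i j k l" using nb_core[OF p] w nb_sym by blast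
      then show False using v by (auto simp: rest_def)
    qed
    ultimately show "w \<in> ?O" by simp
  qed
  have "cut (V - ?U) ?U = (\<Sum>v\<in>?U. card (nb v \<inter> (V - ?U)))"
    by (rule cut_sum) (use UV finite_V finite_subset in auto)
  also have "\<dots> = (\<Sum>v\<in>?U. 3)"
  proof (rule sum.cong)
    fix v assume v: "v \<in> ?U"
    then have "nb v \<inter> (V - ?U) = nb v" using single[OF v] nb_subset by blast
    then show "card (nb v \<inter> (V - ?U)) = 3" using cubic v UV by auto
  qed simp
  finally show "card ?U = 4" using c12 cut_commute[of ?U] by simp
qed

text \<open>Otherwise seven leaf edges after five deletions leave at most one vertex, and
  \<open>V\<close> has deficit at most 5 - 7 + 1. The certificate exists because the rim vertices in
  \<open>?L\<close>, belonging to the star at \<open>l\<close>, can be matched one by one into the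
  rest.\<close>

lemma triangle_star:
  assumes p: "perm4 i j k l" and ne: "t i j \<noteq> t k l" "t i k \<noteq> t j l" "t i l \<noteq> t j k"
  shows "\<exists>c\<in>rest i j k l. c \<in> nb (t i j) \<and> c \<in> nb (t i k) \<and> c \<in> nb (t j k)"
proof (rule ccontr)
  assume no: "\<not> ?thesis"
  let ?U = "rest i j k l"
  let ?L = "{t i l, t j l, t k l}"
  note U = no_coincidence_rest[OF p ne]
  note D = distinct_core[OF p] t_neqs[OF p] t_neqs[OF p, symmetric] ne ne[symmetric] core_neqs[OF p] core_neqs[OF p, symmetric]
  have UV: "?U \<subseteq> V" "finite ?U" using rest_psubset[OF p] finite_V finite_subset by blast+
  have LO: "?L \<subseteq> rim i j k l" by (auto simp: rim_def)
  \<comment> \<open>A vertex of the rest without a neighbour in \<open>?L\<close> would be adjacent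
    to the whole triangle.\<close>
  have ge1: "1 \<le> card (nb c \<inter> ?L)" if c: "c \<in> ?U" for c
  proof (rule ccontr)
    assume "\<not> 1 \<le> card (nb c \<inter> ?L)"
    then have "card (nb c \<inter> ?L) = 0" by linarith
    then have "nb c \<inter> ?L = {}" by (metis card_0_eq finite_Int finite_nb)
    then have "nb c \<subseteq> {t i j, t i k, t j k}" using U(1)[OF c] by (auto simp: rim_def)
    moreover have "card (nb c) = 3" using c UV cubic by auto
    moreover have "card {t i j, t i k, t j k} = 3" using D by simp
    ultimately have "nb c = {t i j, t i k, t j k}" by (intro card_subset_eq) auto
    then have "t i j \<in> nb c" "t i k \<in> nb c" "t j k \<in> nb c" by auto
    then show False using no c nb_sym by blast
  qed
  have sum6: "(\<Sum>c\<in>?U. card (nb c \<inter> ?L)) = 6"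
  proof -
    have LV: "?L \<subseteq> V" using LO rim_V[OF p] by auto
    have "(\<Sum>c\<in>?U. card (nb c \<inter> ?L)) = cut ?L ?U" by (rule cut_sum[symmetric, OF UV(2) LV])
    also have "\<dots> = cut ?U ?L" by (rule cut_commute)
    also have "\<dots> = (\<Sum>v\<in>?L. card (nb v \<inter> ?U))" by (rule cut_sum) (use UV in auto)
    also have "\<dots> = (\<Sum>v\<in>?L. 2)" by (rule sum.cong) (use U(3) LO in auto)
    also have "\<dots> = 6" using D by simp
    finally show ?thesis .
  qed
  \<comment> \<open>Four vertices share six edges to \<open>?L\<close>, so one of them has only
    one.\<close>
  obtain c0 where c0: "c0 \<in> ?U" "card (nb c0 \<inter> ?L) = 1"
  proof -
    have "\<exists>c\<in>?U. card (nb c \<inter> ?L) < 2"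
    proof (rule ccontr)
      assume "\<not> ?thesis"
      then have "(\<Sum>c\<in>?U. 2) \<le> (\<Sum>c\<in>?U. card (nb c \<inter> ?L))" by (intro sum_mono) auto
      then show False using sum6 U(2) by simp
    qed
    then show thesis using that ge1 by (metis One_nat_def Suc_1 le_antisym less_Suc_eq_le)
  qed
  then obtain x where x: "nb c0 \<inter> ?L = {x}" using card_1_singletonE by blast
  have xL: "x \<in> ?L" using x by blast
  obtain y w where yw: "?L = {x, y, w}" "distinct [x, y, w]"
  proof -
    have "distinct [t i l, t j l, t k l]" using D by simp
    then show thesis
      using xL that[of "t j l" "t k l"] that[of "t i l" "t k l"] that[of "t i l" "t j l"]
      by (auto simp: insert_commute)
  qed
  have ywO: "x \<in> rim i j k l" "y \<in> rim i j k l" "w \<in> rim i j k l" using yw LO by auto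
  have notc0: "y \<notin> nb c0" "w \<notin> nb c0" using x yw by auto
  \<comment> \<open>If both neighbours of \<open>y\<close> in the rest were adjacent to
    \<open>w\<close>, there would be a 4-cycle.\<close>
  obtain c1 where c1: "c1 \<in> nb y" "c1 \<in> ?U" "c1 \<notin> nb w"
  proof -
    obtain d e where de: "nb y \<inter> ?U = {d, e}" "d \<noteq> e" using U(3)[OF ywO(2)] by (meson card_2_iff)
    then have "d \<in> nb y" "e \<in> nb y" "d \<in> ?U" "e \<in> ?U" by auto
    moreover have "\<not> (d \<in> nb w \<and> e \<in> nb w)" using common_nb_unique[of y w d e] yw(2) de calculation by auto
    ultimately show thesis using that by blast
  qed
  obtain c2 where c2: "c2 \<in> nb w" "c2 \<in> ?U"
    using U(3)[OF ywO(3)] by (metis card.empty disjoint_iff zero_neq_numeral)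
  have sym: "x \<in> nb c0" "y \<in> nb c1" "w \<in> nb c2" "w \<notin> nb c1" using x c1 c2 nb_sym by blast+
  have cdist: "c0 \<noteq> c1" "c0 \<noteq> c2" "c1 \<noteq> c2" using notc0 sym by auto
  have rimeq: "rim i j k l = {t i j, t i k, t j k, x, y, w}" using yw(1) by (auto simp: rim_def)
  have nbc: "nb c0 \<subseteq> {t i j, t i k, t j k, x}" "nb c1 \<subseteq> {t i j, t i k, t j k, x, y}"
    "nb c2 \<subseteq> {t i j, t i k, t j k, x, y, w}"
    using U(1)[OF c0(1)] U(1)[OF c1(2)] U(1)[OF c2(2)] notc0 sym unfolding rimeq by auto
  let ?R = "{a k, s i l, s j l, t i k, t j k}"
  \<comment> \<open>After these pairs the core and the rim vertices of the triangle are gone. Then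
    \<open>c0\<close> sees at most \<open>x\<close>, next \<open>c1\<close> at most
    \<open>y\<close>, and finally \<open>c2\<close> at most \<open>w\<close>.\<close>
  let ?qs = "[(s i k, a i), (s j k, a j), (s i j, t i j), (a l, s k l)]"
  let ?ps = "?qs @ [(c0, x), (c1, y), (c2, w)]"
  have cU: "c \<notin> core i j k l" "c \<notin> rim i j k l" if "c \<in> ?U" for c using that by (auto simp: rest_def)
  have xyw: "t i j \<notin> ?L" "t i k \<notin> ?L" "t j k \<notin> ?L" using D by auto
  have Lcore: "x \<notin> core i j k l" "y \<notin> core i j k l" "w \<notin> core i j k l"
    using ywO t_notin_core[OF p] unfolding rim_def by blast+
  have pe: "peelable ?R ?ps"
  proof -
    let ?T = "{t i j, t i k, t j k}"
    have T: "x \<notin> ?T" "y \<notin> ?T" "w \<notin> ?T" using xyw yw by auto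
    have cR: "c \<notin> core i j k l \<union> ?T" "c \<noteq> x" "c \<noteq> y" "c \<noteq> w" if "c \<in> ?U" for c
      using cU[OF that] unfolding rimeq by auto
    note cs = cR[OF c0(1)] cR[OF c1(2)] cR[OF c2(2)]
    have 1: "peelable ?R ?qs" using D by (auto simp: nb_core_eqs[OF p])
    have 2: "peelable (R' \<union> ends qs) rs \<Longrightarrow> peelable R' qs \<Longrightarrow> peelable R' (qs @ rs)" for R' qs rs
      by (induction R' qs rule: peelable.induct) (simp_all add: Un_insert_left Un_insert_right)
    have "?R \<union> ends ?qs = core i j k l \<union> ?T" by (auto simp: core_def)
    moreover have "peelable (core i j k l \<union> ?T) [(c0, x), (c1, y), (c2, w)]"
    proof -
      have "nb c0 \<subseteq> insert x (core i j k l \<union> ?T)"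
        "nb c1 \<subseteq> insert y (insert c0 (insert x (core i j k l \<union> ?T)))"
        "nb c2 \<subseteq> insert w (insert c1 (insert y (insert c0 (insert x (core i j k l \<union> ?T)))))"
        using nbc by blast+
      moreover have "x \<noteq> y" "x \<noteq> w" "y \<noteq> w" using yw(2) by auto
      ultimately show ?thesis using sym cs T Lcore cdist by auto
    qed
    ultimately have "peelable (?R \<union> ends ?qs) [(c0, x), (c1, y), (c2, w)]" by (simp only:)
    then show ?thesis by (rule 2[OF _ 1])
  qed
  have RV: "?R \<subseteq> V" using core_V[OF p] t_V perm4_all[OF p] by auto
  have "card ?R = 5" using D by auto
  then have "deficit V \<le> deficit (V - (?R \<union> ends ?ps)) - 2" using deficit_peel[OF RV pe] by simp
  moreover have "V - (?R \<union> ends ?ps) \<subseteq> ?U - {c0, c1, c2}"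
  proof -
    have "core i j k l \<union> rim i j k l \<union> {c0, c1, c2} \<subseteq> ?R \<union> ends ?ps"
      unfolding rimeq by (auto simp: core_def)
    then show ?thesis by (auto simp: rest_def)
  qed
  then have "card (V - (?R \<union> ends ?ps)) \<le> card (?U - {c0, c1, c2})" using UV by (intro card_mono) auto
  moreover have "card (?U - {c0, c1, c2}) = 1"
    using U(2) c0 c1 c2 cdist UV by (subst card_Diff_subset) auto
  ultimately show False using deficient deficit_le_card[of "V - (?R \<union> ends ?ps)"] by linarith
qed

end

context subcubic_girth5
begin

text \<open>The map goes from the explicit graph into \<open>V\<close>, so it can be given by cases
  on constructors and checked vertex by vertex; the required isomorphism is its inverse.\<close>

lemma graph_isoI:
  fixes g :: "'b \<Rightarrow> 'a"
  assumes inj: "inj_on g HV" and im: "g ` HV = V"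
    and HE: "\<And>p q. p \<in> HV \<Longrightarrow> {p, q} \<in> HE \<Longrightarrow> q \<in> HV"
    and nb_g: "\<And>p. p \<in> HV \<Longrightarrow> nb (g p) = g ` {q. {p, q} \<in> HE}"
  shows "graph_iso V E HV HE"
  unfolding graph_iso_def
proof (intro exI conjI ballI)
  let ?f = "inv_into HV g"
  have "bij_betw g HV V" using inj im by (simp add: bij_betw_def)
  then show "bij_betw ?f V HV" by (rule bij_betw_inv_into)
  fix u v assume "u \<in> V" "v \<in> V"
  then obtain p q where pq: "p \<in> HV" "q \<in> HV" "u = g p" "v = g q" using im by blast
  then have f: "?f u = p" "?f v = q" using inj by simp_all
  have "{u, v} \<in> E \<longleftrightarrow> g q \<in> g ` {q. {p, q} \<in> HE}"
    using nb_g[OF pq(1)] pq by (simp add: nb_def set_eq_iff)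
  also have "\<dots> \<longleftrightarrow> {p, q} \<in> HE"
  proof
    assume "g q \<in> g ` {q. {p, q} \<in> HE}"
    then obtain q' where "g q = g q'" "{p, q'} \<in> HE" by blast
    then show "{p, q} \<in> HE" using HE[OF pq(1), of q'] pq(2) inj_onD[OF inj] by metis
  qed blast
  finally show "({u, v} \<in> E) = ({?f u, ?f v} \<in> HE)" using f by simp
qed

end

section \<open>Recognising the exceptional graphs\<close>

lemma H1_V_eq: "H1_V = set [h1v.A 1, h1v.A 2, h1v.A 3, h1v.A 4, h1v.S 1 2, h1v.S 1 3, h1v.S 1 4, h1v.S 2 3, h1v.S 2 4,
    h1v.S 3 4, h1v.T 1, h1v.T 2, h1v.T 3, X1]"
proof -
  have "{1..4} = {1, 2, 3, 4 :: nat}" "{1..3} = {1, 2, 3 :: nat}" by auto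
  moreover have "{h1v.S i j | i j. 1 \<le> i \<and> i < j \<and> j \<le> 4}
    = {h1v.S 1 2, h1v.S 1 3, h1v.S 1 4, h1v.S 2 3, h1v.S 2 4, h1v.S 3 4}"
  proof -
    have "1 \<le> i \<and> i < j \<and> j \<le> 4 \<longleftrightarrow> (i, j) \<in> {(1, 2), (1, 3), (1, 4), (2, 3), (2, 4), (3, 4)}" for i j :: nat
      by auto
    then show ?thesis by auto
  qed
  ultimately show ?thesis unfolding H1_V_def by auto
qed

lemma H1_E_eq: "H1_E = {{h1v.A 1, h1v.S 1 2}, {h1v.A 2, h1v.S 1 2}, {h1v.A 1, h1v.S 1 3}, {h1v.A 3, h1v.S 1 3},
    {h1v.A 1, h1v.S 1 4}, {h1v.A 4, h1v.S 1 4}, {h1v.A 2, h1v.S 2 3}, {h1v.A 3, h1v.S 2 3},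
    {h1v.A 2, h1v.S 2 4}, {h1v.A 4, h1v.S 2 4}, {h1v.A 3, h1v.S 3 4}, {h1v.A 4, h1v.S 3 4},
    {h1v.T 1, h1v.S 1 4}, {h1v.T 1, h1v.S 2 3}, {h1v.T 2, h1v.S 2 4}, {h1v.T 2, h1v.S 1 3},
    {h1v.T 3, h1v.S 1 2}, {h1v.T 3, h1v.S 3 4}, {X1, h1v.T 1}, {X1, h1v.T 2}, {X1, h1v.T 3}}"
proof -
  have "1 \<le> i \<and> i < j \<and> j \<le> 4 \<longleftrightarrow> (i, j) \<in> {(1, 2), (1, 3), (1, 4), (2, 3), (2, 4), (3, 4)}" for i j :: nat
    by auto
  note pairs = this
  have gen: "{F i j | i j. (i, j) \<in> P} = (\<lambda>(i, j). F i j) ` P" for F :: "nat \<Rightarrow> nat \<Rightarrow> h1v set" and P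
    by auto
  have "{{X1, h1v.T k} | k. k \<in> {1..3}} = (\<lambda>k. {X1, h1v.T k}) ` {1..3}" by auto
  moreover have "{1..3} = {1, 2, 3 :: nat}" by auto
  ultimately show ?thesis unfolding H1_E_def pairs gen
    by (simp add: insert_commute del: One_nat_def)
qed

lemma H2_V_eq: "H2_V = set [h2v.Z, X2, h2v.W 0, h2v.W 1, h2v.W 2, h2v.W 3, h2v.W 4, h2v.W 5, h2v.B 0, h2v.B 1, h2v.B 2,
    h2v.B 3, h2v.B 4, h2v.B 5, h2v.C 0, h2v.C 1, h2v.C 2, h2v.C 3, h2v.C 4, h2v.C 5]"
proof -
  have "{0..<6} = {0, 1, 2, 3, 4, 5 :: nat}" by auto
  then show ?thesis unfolding H2_V_def by auto
qed

lemma H2_E_eq: "H2_E = {{h2v.B 0, h2v.B 1}, {h2v.B 1, h2v.B 2}, {h2v.B 2, h2v.B 3}, {h2v.B 3, h2v.B 4}, {h2v.B 4, h2v.B 5},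
    {h2v.B 5, h2v.B 0}, {h2v.C 0, h2v.C 1}, {h2v.C 1, h2v.C 2}, {h2v.C 2, h2v.C 3}, {h2v.C 3, h2v.C 4},
    {h2v.C 4, h2v.C 5}, {h2v.C 5, h2v.C 0}, {h2v.Z, h2v.W 0}, {h2v.Z, h2v.W 2}, {h2v.Z, h2v.W 4},
    {h2v.W 0, h2v.B 0}, {h2v.W 1, h2v.B 1}, {h2v.W 2, h2v.B 2}, {h2v.W 3, h2v.B 3}, {h2v.W 4, h2v.B 4},
    {h2v.W 5, h2v.B 5}, {h2v.W 0, h2v.C 0}, {h2v.W 1, h2v.C 1}, {h2v.W 2, h2v.C 2}, {h2v.W 3, h2v.C 3},
    {h2v.W 4, h2v.C 4}, {h2v.W 5, h2v.C 5}, {X2, h2v.W 1}, {X2, h2v.W 3}, {X2, h2v.W 5}}"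
proof -
  have I: "{..<6} = {0, 1, 2, 3, 4, 5 :: nat}" by auto
  have "{{h2v.B i, h2v.B ((i + 1) mod 6)} | i. i < 6} = (\<lambda>i. {h2v.B i, h2v.B ((i + 1) mod 6)}) ` {..<6}"
    "{{h2v.C i, h2v.C ((i + 1) mod 6)} | i. i < 6} = (\<lambda>i. {h2v.C i, h2v.C ((i + 1) mod 6)}) ` {..<6}"
    "{{h2v.W j, h2v.B j} | j. j < 6} = (\<lambda>j. {h2v.W j, h2v.B j}) ` {..<6}"
    "{{h2v.W j, h2v.C j} | j. j < 6} = (\<lambda>j. {h2v.W j, h2v.C j}) ` {..<6}"
    "{{h2v.Z, h2v.W j} | j. j \<in> {0, 2, 4}} = (\<lambda>j. {h2v.Z, h2v.W j}) ` {0, 2, 4}"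
    "{{X2, h2v.W j} | j. j \<in> {1, 3, 5}} = (\<lambda>j. {X2, h2v.W j}) ` {1, 3, 5}"
    by (auto simp: image_iff)
  then show ?thesis unfolding H2_E_def by (simp add: I insert_commute del: One_nat_def)
qed

context subdivided_K4
begin

lemma perm4_id: "perm4 1 2 3 4"
  by (simp add: perm4_def)

lemma V_eq: "V = core 1 2 3 4 \<union> rim 1 2 3 4 \<union> rest 1 2 3 4"
  using core_V[OF perm4_id] rim_V[OF perm4_id] unfolding rest_def core_def by auto

lemma card_V: "card V = 10 + card (rim 1 2 3 4) + card (rest 1 2 3 4)"
proof -
  have "core 1 2 3 4 \<inter> rim 1 2 3 4 = {}" using t_notin_core[OF perm4_id] by (auto simp: rim_def)
  moreover have "finite (core 1 2 3 4)" "finite (rim 1 2 3 4)" "finite (rest 1 2 3 4)"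
    using finite_V by (simp_all add: core_def rim_def rest_def)
  moreover have "(core 1 2 3 4 \<union> rim 1 2 3 4) \<inter> rest 1 2 3 4 = {}" by (auto simp: rest_def)
  moreover have "card (core 1 2 3 4) = 10"
    using distinct_card[OF distinct_core[OF perm4_id]] by (simp add: core_def)
  ultimately show ?thesis by (subst V_eq) (simp add: card_Un_disjoint)
qed

lemma iso_H1:
  assumes eq: "t 1 2 = t 3 4" "t 1 4 = t 2 3" "t 1 3 = t 2 4"
  shows "graph_iso V E H1_V H1_E"
proof -
  note p = perm4_id
  obtain x where x: "rest 1 2 3 4 = {x}" "nb x = {t 1 2, t 1 3, t 1 4}"
    using triple_coincidence[OF p eq] by blast
  \<comment> \<open>The numbering of the \<open>T\<close> vertices follows the opposite pairs: 14
    and 23, 24 and 13, 12 and 34.\<close>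
  define g where "g v = (case v of h1v.A i \<Rightarrow> a i | h1v.S i j \<Rightarrow> s i j
    | h1v.T n \<Rightarrow> (if n = 1 then t 1 4 else if n = 2 then t 1 3 else t 1 2) | X1 \<Rightarrow> x)" for v
  have rim: "rim 1 2 3 4 = {t 1 2, t 1 3, t 1 4}" using eq by (auto simp: rim_def)
  have xt: "x \<in> nb (t 1 2)" "x \<in> nb (t 1 3)" "x \<in> nb (t 1 4)"
    using x(2) nb_sym[of x] by simp_all
  have nbt: "nb (t 1 2) = {s 1 2, s 3 4, x}" "nb (t 1 3) = {s 1 3, s 2 4, x}" "nb (t 1 4) = {s 1 4, s 2 3, x}"
  proof -
    have sx: "s 1 2 \<noteq> x" "s 1 3 \<noteq> x" "s 1 4 \<noteq> x" "s 2 3 \<noteq> x" "s 2 4 \<noteq> x" "s 3 4 \<noteq> x"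
      using s_notin_rest[OF p] x(1) by auto
    have ss: "s 1 2 \<noteq> s 3 4" "s 1 3 \<noteq> s 2 4" "s 1 4 \<noteq> s 2 3" using distinct_core[OF p] by simp_all
    show "nb (t 1 2) = {s 1 2, s 3 4, x}"
      by (rule nb_eqI[OF s_nb_ts(1)[OF p] s_nb_ts(6)[OF p, folded eq] xt(1)]) (use sx ss in simp)
    show "nb (t 1 3) = {s 1 3, s 2 4, x}"
      by (rule nb_eqI[OF s_nb_ts(2)[OF p] s_nb_ts(5)[OF p, folded eq] xt(2)]) (use sx ss in simp)
    show "nb (t 1 4) = {s 1 4, s 2 3, x}"
      by (rule nb_eqI[OF s_nb_ts(3)[OF p] s_nb_ts(4)[OF p, folded eq] xt(3)]) (use sx ss in simp)
  qed
  let ?xs = "[h1v.A 1, h1v.A 2, h1v.A 3, h1v.A 4, h1v.S 1 2, h1v.S 1 3, h1v.S 1 4, h1v.S 2 3, h1v.S 2 4,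
    h1v.S 3 4, h1v.T 1, h1v.T 2, h1v.T 3, X1]"
  show ?thesis
  proof (rule graph_isoI[where g = g])
    have "g ` H1_V = core 1 2 3 4 \<union> rim 1 2 3 4 \<union> rest 1 2 3 4"
      unfolding H1_V_eq rim x(1) by (simp add: g_def core_def) blast
    then show im: "g ` H1_V = V" by (simp only: V_eq[symmetric])
    \<comment> \<open>Both graphs have 14 vertices, so injectivity follows from
      surjectivity.\<close>
    have "distinct ?xs" by simp
    then have "card H1_V = 14" unfolding H1_V_eq using distinct_card by fastforce
    moreover have "card (rim 1 2 3 4) = 3" unfolding rim using t_neqs[OF p] by simp
    then have "card V = 14" using card_V x(1) by simp
    ultimately show "inj_on g H1_V" using im by (intro eq_card_imp_inj_on) (simp_all add: H1_V_eq)
    show "q \<in> H1_V" if "p \<in> H1_V" "{p, q} \<in> H1_E" for p q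
      using that(2) unfolding H1_V_eq H1_E_eq by (simp add: doubleton_eq_iff) blast
    show "nb (g p) = g ` {q. {p, q} \<in> H1_E}" if "p \<in> H1_V" for p
    proof -
      have N: "{q. {h1v.A 1, q} \<in> H1_E} = {h1v.S 1 2, h1v.S 1 3, h1v.S 1 4}"
        "{q. {h1v.A 2, q} \<in> H1_E} = {h1v.S 1 2, h1v.S 2 3, h1v.S 2 4}"
        "{q. {h1v.A 3, q} \<in> H1_E} = {h1v.S 1 3, h1v.S 2 3, h1v.S 3 4}"
        "{q. {h1v.A 4, q} \<in> H1_E} = {h1v.S 1 4, h1v.S 2 4, h1v.S 3 4}"
        "{q. {h1v.S 1 2, q} \<in> H1_E} = {h1v.A 1, h1v.A 2, h1v.T 3}"
        "{q. {h1v.S 1 3, q} \<in> H1_E} = {h1v.A 1, h1v.A 3, h1v.T 2}"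
        "{q. {h1v.S 1 4, q} \<in> H1_E} = {h1v.A 1, h1v.A 4, h1v.T 1}"
        "{q. {h1v.S 2 3, q} \<in> H1_E} = {h1v.A 2, h1v.A 3, h1v.T 1}"
        "{q. {h1v.S 2 4, q} \<in> H1_E} = {h1v.A 2, h1v.A 4, h1v.T 2}"
        "{q. {h1v.S 3 4, q} \<in> H1_E} = {h1v.A 3, h1v.A 4, h1v.T 3}"
        "{q. {h1v.T 1, q} \<in> H1_E} = {h1v.S 1 4, h1v.S 2 3, X1}"
        "{q. {h1v.T 2, q} \<in> H1_E} = {h1v.S 2 4, h1v.S 1 3, X1}"
        "{q. {h1v.T 3, q} \<in> H1_E} = {h1v.S 1 2, h1v.S 3 4, X1}"
        "{q. {X1, q} \<in> H1_E} = {h1v.T 1, h1v.T 2, h1v.T 3}"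
        unfolding H1_E_eq by (auto simp: doubleton_eq_iff)
      show ?thesis using that unfolding H1_V_eq
        by (simp del: One_nat_def, elim disjE; simp only: N; simp add: g_def nb_core_eqs[OF p] nbt x(2) eq[symmetric] insert_commute del: One_nat_def)
    qed
  qed
qed

lemma iso_H2:
  assumes ne: "t 1 2 \<noteq> t 3 4" "t 1 4 \<noteq> t 2 3" "t 1 3 \<noteq> t 2 4"
  shows "graph_iso V E H2_V H2_E"
proof -
  note p = perm4_id
  let ?U = "rest 1 2 3 4"
  \<comment> \<open>The four triangles, each labelled with the omitted branch vertex last; below,
    \<open>c4\<close>, \<open>c3\<close>, \<open>c2\<close>, \<open>c1\<close> are named after
    it.\<close>
  have q: "perm4 1 2 4 3" "perm4 1 3 4 2" "perm4 2 3 4 1" by (simp_all add: perm4_def)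
  have rests: "rest 1 2 4 3 = ?U" "rest 1 3 4 2 = ?U" "rest 2 3 4 1 = ?U"
    unfolding rest_def core_def rim_def
    by (simp_all only: s_commute[of 2 1] s_commute[of 3 1] s_commute[of 4 1] s_commute[of 3 2] s_commute[of 4 2] s_commute[of 4 3]
        t_commute[of 2 1] t_commute[of 3 1] t_commute[of 4 1] t_commute[of 3 2] t_commute[of 4 2] t_commute[of 4 3]) blast+
  note U = no_coincidence_rest[OF p ne(1,3,2)]
  obtain c4 where c4: "c4 \<in> ?U" "c4 \<in> nb (t 1 2)" "c4 \<in> nb (t 1 3)" "c4 \<in> nb (t 2 3)"
    using triangle_star[OF p] ne by blast
  obtain c3 where c3: "c3 \<in> ?U" "c3 \<in> nb (t 1 2)" "c3 \<in> nb (t 1 4)" "c3 \<in> nb (t 2 4)"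
    using triangle_star[OF q(1)] ne rests t_commute[of 4 3] by (metis (no_types))
  obtain c2 where c2: "c2 \<in> ?U" "c2 \<in> nb (t 1 3)" "c2 \<in> nb (t 1 4)" "c2 \<in> nb (t 3 4)"
    using triangle_star[OF q(2)] ne rests t_commute[of 4 2] t_commute[of 3 2] by (metis (no_types))
  obtain c1 where c1: "c1 \<in> ?U" "c1 \<in> nb (t 2 3)" "c1 \<in> nb (t 2 4)" "c1 \<in> nb (t 3 4)"
    using triangle_star[OF q(3)] ne rests t_commute[of 4 1] t_commute[of 3 1] t_commute[of 2 1] by (metis (no_types))
  note T = t_neqs[OF p] t_neqs[OF p, symmetric] ne ne[symmetric]
  have nbc: "nb c4 = {t 1 2, t 1 3, t 2 3}" "nb c3 = {t 1 2, t 1 4, t 2 4}"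
    "nb c2 = {t 1 3, t 1 4, t 3 4}" "nb c1 = {t 2 3, t 2 4, t 3 4}"
    using c4(2-4) c3(2-4) c2(2-4) c1(2-4) T
    by (simp_all only: nb_sym[of c4] nb_sym[of c3] nb_sym[of c2] nb_sym[of c1]) (rule nb_eqI; simp)+
  have cd: "distinct [c1, c2, c3, c4]"
  proof -
    have "t 1 2 \<in> nb c4" "t 1 2 \<in> nb c3" "t 1 2 \<notin> nb c2" "t 1 2 \<notin> nb c1"
      "t 1 3 \<in> nb c4" "t 1 3 \<notin> nb c3" "t 1 3 \<in> nb c2" "t 1 3 \<notin> nb c1"
      unfolding nbc using T by simp_all
    then show ?thesis by auto
  qed
  have Ueq: "?U = {c1, c2, c3, c4}"
  proof -
    have "finite ?U" using finite_V by (simp add: rest_def)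
    moreover have "card {c1, c2, c3, c4} = 4" using cd by simp
    ultimately show ?thesis using card_subset_eq[of ?U "{c1, c2, c3, c4}"] U(2) c1(1) c2(1) c3(1) c4(1) by simp
  qed
  have nbt: "nb (t 1 2) = {s 1 2, c3, c4}" "nb (t 1 3) = {s 1 3, c2, c4}" "nb (t 1 4) = {s 1 4, c2, c3}"
    "nb (t 2 3) = {s 2 3, c1, c4}" "nb (t 2 4) = {s 2 4, c1, c3}" "nb (t 3 4) = {s 3 4, c1, c2}"
  proof -
    have sc: "s m n \<noteq> c" if "s m n \<notin> ?U" "c \<in> ?U" for m n c using that by blast
    note sn = s_notin_rest[OF p]
    show "nb (t 1 2) = {s 1 2, c3, c4}"
      by (rule nb_eqI[OF s_nb_ts(1)[OF p] c3(2) c4(2)]) (use sc[OF sn(1)] c3(1) c4(1) cd in simp)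
    show "nb (t 1 3) = {s 1 3, c2, c4}"
      by (rule nb_eqI[OF s_nb_ts(2)[OF p] c2(2) c4(3)]) (use sc[OF sn(2)] c2(1) c4(1) cd in simp)
    show "nb (t 1 4) = {s 1 4, c2, c3}"
      by (rule nb_eqI[OF s_nb_ts(3)[OF p] c2(3) c3(3)]) (use sc[OF sn(3)] c2(1) c3(1) cd in simp)
    show "nb (t 2 3) = {s 2 3, c1, c4}"
      by (rule nb_eqI[OF s_nb_ts(4)[OF p] c1(2) c4(4)]) (use sc[OF sn(4)] c1(1) c4(1) cd in simp)
    show "nb (t 2 4) = {s 2 4, c1, c3}"
      by (rule nb_eqI[OF s_nb_ts(5)[OF p] c1(3) c3(4)]) (use sc[OF sn(5)] c1(1) c3(1) cd in simp)
    show "nb (t 3 4) = {s 3 4, c1, c2}"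
      by (rule nb_eqI[OF s_nb_ts(6)[OF p] c1(4) c2(4)]) (use sc[OF sn(6)] c1(1) c2(1) cd in simp)
  qed
  \<comment> \<open>The hubs are \<open>a 1\<close> and the vertex \<open>c1\<close> facing it. The
    \<open>C\<close> hexagon is the subdivided triangle on 2, 3, 4 of the first \<open>K_4\<close>,
    the \<open>B\<close> hexagon the one on \<open>c4\<close>, \<open>c2\<close>, \<open>c3\<close>
    of the second; even \<open>W\<close> vertices are midpoints at \<open>a 1\<close>, odd ones at
    \<open>c1\<close>.\<close>
  define g where "g v = (case v of h2v.Z \<Rightarrow> a 1 | X2 \<Rightarrow> c1
    | h2v.W n \<Rightarrow> [s 1 2, t 2 3, s 1 3, t 3 4, s 1 4, t 2 4] ! n
    | h2v.B n \<Rightarrow> [t 1 2, c4, t 1 3, c2, t 1 4, c3] ! n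
    | h2v.C n \<Rightarrow> [a 2, s 2 3, a 3, s 3 4, a 4, s 2 4] ! n)" for v
  let ?xs = "[h2v.Z, X2, h2v.W 0, h2v.W 1, h2v.W 2, h2v.W 3, h2v.W 4, h2v.W 5, h2v.B 0, h2v.B 1, h2v.B 2,
    h2v.B 3, h2v.B 4, h2v.B 5, h2v.C 0, h2v.C 1, h2v.C 2, h2v.C 3, h2v.C 4, h2v.C 5]"
  have gm: "map g ?xs = [a 1, c1, s 1 2, t 2 3, s 1 3, t 3 4, s 1 4, t 2 4, t 1 2, c4, t 1 3, c2, t 1 4, c3,
    a 2, s 2 3, a 3, s 3 4, a 4, s 2 4]" by (simp add: g_def)
  show ?thesis
  proof (rule graph_isoI[where g = g])
    have "g ` H2_V = set (map g ?xs)" unfolding H2_V_eq by simp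
    also have "\<dots> = core 1 2 3 4 \<union> rim 1 2 3 4 \<union> rest 1 2 3 4"
      unfolding gm Ueq core_def rim_def by auto
    finally show im: "g ` H2_V = V" by (simp only: V_eq[symmetric])
    have "distinct ?xs" by simp
    then have "card H2_V = 20" unfolding H2_V_eq using distinct_card by fastforce
    moreover have "card (rim 1 2 3 4) = 6" unfolding rim_def using T by simp
    then have "card V = 20" using card_V U(2) by simp
    ultimately show "inj_on g H2_V" using im by (intro eq_card_imp_inj_on) (simp_all add: H2_V_eq)
    show "q \<in> H2_V" if "p \<in> H2_V" "{p, q} \<in> H2_E" for p q
      using that(2) unfolding H2_V_eq H2_E_eq by (simp add: doubleton_eq_iff) blast
    show "nb (g p) = g ` {q. {p, q} \<in> H2_E}" if "p \<in> H2_V" for p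
    proof -
      have N: "{q. {h2v.Z, q} \<in> H2_E} = {h2v.W 0, h2v.W 2, h2v.W 4}"
        "{q. {X2, q} \<in> H2_E} = {h2v.W 1, h2v.W 3, h2v.W 5}"
        "{q. {h2v.W 0, q} \<in> H2_E} = {h2v.Z, h2v.B 0, h2v.C 0}"
        "{q. {h2v.W 1, q} \<in> H2_E} = {h2v.B 1, h2v.C 1, X2}"
        "{q. {h2v.W 2, q} \<in> H2_E} = {h2v.Z, h2v.B 2, h2v.C 2}"
        "{q. {h2v.W 3, q} \<in> H2_E} = {h2v.B 3, h2v.C 3, X2}"
        "{q. {h2v.W 4, q} \<in> H2_E} = {h2v.Z, h2v.B 4, h2v.C 4}"
        "{q. {h2v.W 5, q} \<in> H2_E} = {h2v.B 5, h2v.C 5, X2}"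
        "{q. {h2v.B 0, q} \<in> H2_E} = {h2v.B 1, h2v.B 5, h2v.W 0}"
        "{q. {h2v.B 1, q} \<in> H2_E} = {h2v.B 0, h2v.B 2, h2v.W 1}"
        "{q. {h2v.B 2, q} \<in> H2_E} = {h2v.B 1, h2v.B 3, h2v.W 2}"
        "{q. {h2v.B 3, q} \<in> H2_E} = {h2v.B 2, h2v.B 4, h2v.W 3}"
        "{q. {h2v.B 4, q} \<in> H2_E} = {h2v.B 3, h2v.B 5, h2v.W 4}"
        "{q. {h2v.B 5, q} \<in> H2_E} = {h2v.B 4, h2v.B 0, h2v.W 5}"
        "{q. {h2v.C 0, q} \<in> H2_E} = {h2v.C 1, h2v.C 5, h2v.W 0}"
        "{q. {h2v.C 1, q} \<in> H2_E} = {h2v.C 0, h2v.C 2, h2v.W 1}"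
        "{q. {h2v.C 2, q} \<in> H2_E} = {h2v.C 1, h2v.C 3, h2v.W 2}"
        "{q. {h2v.C 3, q} \<in> H2_E} = {h2v.C 2, h2v.C 4, h2v.W 3}"
        "{q. {h2v.C 4, q} \<in> H2_E} = {h2v.C 3, h2v.C 5, h2v.W 4}"
        "{q. {h2v.C 5, q} \<in> H2_E} = {h2v.C 4, h2v.C 0, h2v.W 5}"
        unfolding H2_E_eq by (auto simp: doubleton_eq_iff)
      show ?thesis using that unfolding H2_V_eq
        by (simp del: One_nat_def, elim disjE; simp only: N; simp add: g_def nb_core_eqs[OF p] nbt nbc insert_commute del: One_nat_def)
    qed
  qed
qed

text \<open>Of the three opposite pairs, one or two coincidences are impossible; relabelling moves
  each such case to the position treated before.\<close>

lemma iso_H1_or_H2: "graph_iso V E H1_V H1_E \<or> graph_iso V E H2_V H2_E"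
proof -
  have p: "perm4 1 2 3 4" "perm4 1 3 2 4" "perm4 1 4 2 3" "perm4 1 3 4 2" by (simp_all add: perm4_def)
  consider "t 1 2 = t 3 4" "t 1 4 = t 2 3" "t 1 3 = t 2 4" | "t 1 2 \<noteq> t 3 4" "t 1 4 \<noteq> t 2 3" "t 1 3 \<noteq> t 2 4"
  proof -
    have False if "t 1 2 = t 3 4" "t 1 3 \<noteq> t 2 4" "t 1 4 \<noteq> t 2 3"
      using no_single_coincidence[OF p(1)] that by blast
    moreover have False if "t 1 3 = t 2 4" "t 1 2 \<noteq> t 3 4" "t 1 4 \<noteq> t 2 3"
      using no_single_coincidence[OF p(2)] that t_commute[of 3 2] by auto
    moreover have False if "t 1 4 = t 2 3" "t 1 2 \<noteq> t 3 4" "t 1 3 \<noteq> t 2 4"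
      using no_single_coincidence[OF p(3)] that t_commute[of 4 3] t_commute[of 4 2] by auto
    moreover have False if "t 1 2 = t 3 4" "t 1 4 = t 2 3" "t 1 3 \<noteq> t 2 4"
      using no_double_coincidence[OF p(1)] that by blast
    moreover have False if "t 1 3 = t 2 4" "t 1 4 = t 2 3" "t 1 2 \<noteq> t 3 4"
      using no_double_coincidence[OF p(2)] that t_commute[of 3 2] by auto
    moreover have False if "t 1 3 = t 2 4" "t 1 2 = t 3 4" "t 1 4 \<noteq> t 2 3"
      using no_double_coincidence[OF p(4)] that t_commute[of 4 2] t_commute[of 3 2] by auto
    ultimately show thesis using that by blast
  qed
  then show ?thesis
  proof cases
    case 1
    then show ?thesis using iso_H1 by blast
  next
    case 2
    then show ?thesis using iso_H2 by blast
  qed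
qed

end

section \<open>Assembling the bound\<close>

context subcubic_girth5
begin

lemma conn_if_connected_graph:
  assumes "connected_graph V E" "V \<noteq> {}"
  shows "conn V"
  unfolding conn_def
proof (intro conjI allI impI notI)
  fix Y assume Y: "Y \<subset> V" "Y \<noteq> {}" "cut Y (V - Y) = 0"
  then obtain u v where uv: "u \<in> Y" "v \<in> V - Y" by blast
  then have "(u, v) \<in> {(x, y). {x, y} \<in> E}\<^sup>*" using assms(1) Y unfolding connected_graph_def by blast
  then have "v \<in> Y"
  proof (induction rule: rtrancl_induct)
    case (step x y)
    then have "y \<in> nb x" by (simp add: nb_def)
    then show ?case using cut_eq_0D[OF _ Y(3) step.IH, of y] Y(1) nb_subset by blast
  qed (use uv in simp)
  then show False using uv by simp
qed (use assms in simp)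

lemma deficit_le_1:
  assumes "connected_graph V E" "V \<noteq> {}"
    and "\<not> graph_iso V E H1_V H1_E" "\<not> graph_iso V E H2_V H2_E"
  shows "deficit V \<le> 1"
proof (rule ccontr)
  assume neg: "\<not> deficit V \<le> 1"
  have conn: "conn V" by (rule conn_if_connected_graph[OF assms(1,2)])
  have "card (nb v) = 3" if v: "v \<in> V" for v
  proof (rule ccontr)
    assume "card (nb v) \<noteq> 3"
    then have "card (nb v \<inter> V) \<le> 2"
      using card_nb_le[of v] card_mono[of "nb v" "nb v \<inter> V"] by simp
    then show False using deficit_non_cubic[OF order_refl conn] v neg by blast
  qed
  then have "cubic_deficient V E" using conn neg by unfold_locales auto
  then obtain a s t where "subdivided_K4 V E a s t" using cubic_deficient.ex_subdivided_K4 by blast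
  then show False using subdivided_K4.iso_H1_or_H2 assms by blast
qed

end

theorem theorem1:
  fixes V :: "'a set" and E :: "'a set set"
  assumes "simple_graph V E"
    and "connected_graph V E"
    and "max_degree_le V E 3"
    and "girth_ge_5 V E"
    and "\<not> graph_iso V E H1_V H1_E"
    and "\<not> graph_iso V E H2_V H2_E"
  shows "real (nu_ur E) \<ge> (real (card V) - 1) / 3"
\<comment> \<open>\<open>conn\<close> requires a vertex; for the empty graph the claimed bound is
  negative.\<close>
proof (cases "V = {}")
  case False
  interpret subcubic_girth5 V E using assms by unfold_locales
  have "deficit V \<le> 1" using deficit_le_1 assms False by blast
  then have "int (card V) \<le> 3 * int (nu_ur E) + 1" by (simp add: deficit_def nu_V)
  then have "real (card V) \<le> 3 * real (nu_ur E) + 1" by linarith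
  then show ?thesis by simp
qed simp

end
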